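(* Let $G=(V,E,w)$ be a connected weighted hypergraph with $V=\{1,\dots,N\}$, let $p\in[1,\infty)$, $a>0$, $q>2$, $T>0$, $u_0\in\mathbb{R}^N$, and let $\pi:\mathbb{R}^N\to\mathbb{R}^N$ be Lipschitz continuous with a primitive $k:\mathbb{R}^N\to\mathbb{R}$ (i.e. $\nabla k=\pi$). For $\tau\ge 0$ consider the system (with zero external force) $$(\mathrm{P}_\tau)\quad\begin{cases} u'(t)+\mathcal{L}_{G,p}(\mu(t))\ni 0, & t\in(0,T),\\ \mu(t)\in \tau u'(t)+\mathcal{L}_{G,p}(u(t))+a\|u(t)\|^{q-2}u(t)+\pi(u(t)), & t\in(0,T),\\ u(0)=u_0.\end{cases}$$ For each $\tau\in(0,1)$ let $(u_\tau,\mu_\tau)$ be a solution to $(\mathrm{P}_\tau)$. Then there exist a sequence $\{\tau_n\}_{n\in\mathbb{N}}\subset(0,1)$ with $\tau_n\to0$ as $n\to\infty$ and functions $u,\mu:[0,T]\to\mathbb{R}^N$ such that, as $n\to\infty$: (i) if $p=1$, then $u_{\tau_n}\to u$ strongly in $C([0,T];\mathbb{R}^N)$, $u'_{\tau_n}\rightharpoonup u'$ $*$-weakly in $L^\infty(0,T;\mathbb{R}^N)$, and $\mu_{\tau_n}\rightharpoonup\mu$ $*$-weakly in $L^\infty(0,T;\mathbb{R}^N)$; (ii) if $p>1$, then $u_{\tau_n}\to u$ strongly in $C([0,T];\mathbb{R}^N)$, $u'_{\tau_n}\rightharpoonup u'$ weakly in $L^{p'}(0,T;\mathbb{R}^N)$,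 and $\mu_{\tau_n}\rightharpoonup\mu$ weakly in $L^{\bar p}(0,T;\mathbb{R}^N)$, where $p':=p/(p-1)$ and $\bar p:=\max\{p,p'\}$. Furthermore, the pair of limits $(u,\mu)$ is a solution to $(\mathrm{P}_\tau)$ with $\tau=0$.
   Context: A weighted hypergraph $G=(V,E,w)$ consists of a finite vertex set $V=\{1,\dots,N\}$, a family $E$ of subsets $e\subset V$ with $\#e\ge 2$ (hyperedges), and a weight $w:E\to(0,\infty)$. $G$ is connected if for all $i,j\in V$ there exist $i_1,\dots,i_{n-1}\in V$ and $e_1,\dots,e_n\in E$ such that, with $i_0=i$ and $i_n=j$, one has $i_{l-1},i_l\in e_l$ for every $l=1,\dots,n$. For $e\in E$ and $x\in\mathbb{R}^N$ put $f_e(x):=\max_{i,j\in e}|x_i-x_j|$, and for $p\in[1,\infty)$ put $\varphi_{G,p}(x):=\frac1p\sum_{e\in E}w(e)(f_e(x))^p$, a continuous convex function on $\mathbb{R}^N$. The hypergraph Laplacian is the set-valued operator $\mathcal{L}_{G,p}:=\partial\varphi_{G,p}:\mathbb{R}^N\to 2^{\mathbb{R}^N}$, where $\partial\varphi_{G,p}(x)=\{\eta\in\mathbb{R}^N:\ \eta\cdot(z-x)\le\varphi_{G,p}(z)-\varphi_{G,p}(x)\ \ \forall z\in\mathbb{R}^N\}$. $\|\cdot\|$ and $\cdot$ denote the Euclidean norm and inner product on $\mathbb{R}^N$; $\|x\|^{q-2}x$ is $0$ at $x=0$. A solution on $[0,T]$ is a pair $u,\mu:[0,T]\to\mathbb{R}^N$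 with $u\in W^{1,1}(0,T;\mathbb{R}^N)$ (identified with its absolutely continuous representative) and $\mu\in L^1(0,T;\mathbb{R}^N)$ such that the two inclusions hold for a.e. $t\in(0,T)$ and $u(0)=u_0$. *)

theory Defs
  imports "HOL-Analysis.Analysis"
begin

section \<open>Weighted hypergraphs and the hypergraph Laplacian\<close>

text \<open>The vertex set \<open>{1,\<dots>,N}\<close> is an arbitrary finite type \<^typ>\<open>'n\<close>, so that
  \<open>\<real>\<^sup>N\<close> is \<^typ>\<open>real ^ 'n\<close>. Only the values of \<open>w\<close> on \<open>E\<close> are ever used.\<close>

definition weighted_hypergraph :: "'n::finite set set \<Rightarrow> ('n set \<Rightarrow> real) \<Rightarrow> bool" where
  "weighted_hypergraph E w \<longleftrightarrow> (\<forall>e\<in>E. card e \<ge> 2 \<and> w e > 0)"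

text \<open>The trivial chain \<open>n = 0\<close> is allowed; it only matters for the hypergraph with a single
  vertex (and hence no hyperedge), which thereby counts as connected.\<close>

definition hypergraph_connected :: "'n::finite set set \<Rightarrow> bool" where
  "hypergraph_connected E \<longleftrightarrow>
     (\<forall>i j. \<exists>(n::nat) (v :: nat \<Rightarrow> 'n) (e :: nat \<Rightarrow> 'n set).
        v 0 = i \<and> v n = j \<and>
        (\<forall>l\<in>{1..n}. e l \<in> E \<and> v (l - 1) \<in> e l \<and> v l \<in> e l))"

definition hyperedge_fun :: "'n::finite set \<Rightarrow> real ^ 'n \<Rightarrow> real" where
  "hyperedge_fun e x = Max ((\<lambda>(i, j). \<bar>x $ i - x $ j\<bar>) ` (e \<times> e))"

definition hypergraph_energy ::
  "'n::finite set set \<Rightarrow> ('n set \<Rightarrow> real) \<Rightarrow> real \<Rightarrow> real ^ 'n \<Rightarrow> real" where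
  "hypergraph_energy E w p x = 1 / p * (\<Sum>e\<in>E. w e * hyperedge_fun e x powr p)"

definition subdifferential :: "('a::real_inner \<Rightarrow> real) \<Rightarrow> 'a \<Rightarrow> 'a set" where
  "subdifferential \<phi> x = {\<eta>. \<forall>z. \<eta> \<bullet> (z - x) \<le> \<phi> z - \<phi> x}"

definition hypergraph_Laplacian ::
  "'n::finite set set \<Rightarrow> ('n set \<Rightarrow> real) \<Rightarrow> real \<Rightarrow> real ^ 'n \<Rightarrow> (real ^ 'n) set" where
  "hypergraph_Laplacian E w p = subdifferential (hypergraph_energy E w p)"

section \<open>Lebesgue and Sobolev spaces on \<open>(0,T)\<close>\<close>

text \<open>Elements of these spaces are represented by functions; everything below is invariant under
  changes on null sets of \<open>(0,T)\<close>.\<close>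

abbreviation leb_interval :: "real \<Rightarrow> real measure" where
  "leb_interval T \<equiv> lebesgue_on {0<..<T}"

abbreviation L1_fun :: "real \<Rightarrow> (real \<Rightarrow> 'a::euclidean_space) \<Rightarrow> bool" where
  "L1_fun T f \<equiv> integrable (leb_interval T) f"

definition Lp_fun :: "real \<Rightarrow> real \<Rightarrow> (real \<Rightarrow> 'a::euclidean_space) \<Rightarrow> bool" where
  "Lp_fun r T f \<longleftrightarrow> f \<in> borel_measurable (leb_interval T) \<and>
     integrable (leb_interval T) (\<lambda>t. norm (f t) powr r)"

definition Lp_norm :: "real \<Rightarrow> real \<Rightarrow> (real \<Rightarrow> 'a::euclidean_space) \<Rightarrow> real" where
  "Lp_norm r T f = (\<integral>t. norm (f t) powr r \<partial>leb_interval T) powr (1 / r)"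

definition Linf_fun :: "real \<Rightarrow> (real \<Rightarrow> 'a::euclidean_space) \<Rightarrow> bool" where
  "Linf_fun T f \<longleftrightarrow> f \<in> borel_measurable (leb_interval T) \<and>
     (\<exists>C. AE t in leb_interval T. norm (f t) \<le> C)"

text \<open>Bounded linear functionals on \<open>L\<^sup>r(0,T)\<close>. The bound forces \<open>F\<close> to agree on functions that
  are equal almost everywhere.\<close>

definition Lp_dual :: "real \<Rightarrow> real \<Rightarrow> ((real \<Rightarrow> 'a::euclidean_space) \<Rightarrow> real) \<Rightarrow> bool" where
  "Lp_dual r T F \<longleftrightarrow>
     (\<forall>f g. Lp_fun r T f \<longrightarrow> Lp_fun r T g \<longrightarrow> F (\<lambda>t. f t + g t) = F f + F g) \<and>
     (\<forall>c f. Lp_fun r T f \<longrightarrow> F (\<lambda>t. c *\<^sub>R f t) = c * F f) \<and>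
     (\<exists>C. \<forall>f. Lp_fun r T f \<longrightarrow> \<bar>F f\<bar> \<le> C * Lp_norm r T f)"

definition Lp_weak_conv ::
  "real \<Rightarrow> real \<Rightarrow> (nat \<Rightarrow> real \<Rightarrow> 'a::euclidean_space) \<Rightarrow> (real \<Rightarrow> 'a) \<Rightarrow> bool" where
  "Lp_weak_conv r T f g \<longleftrightarrow>
     (\<forall>n. Lp_fun r T (f n)) \<and> Lp_fun r T g \<and>
     (\<forall>F. Lp_dual r T F \<longrightarrow> (\<lambda>n. F (f n)) \<longlonglongrightarrow> F g)"

text \<open>*-weak convergence in \<open>L\<^sup>\<infinity>(0,T)\<close>, as the dual of \<open>L\<^sup>1(0,T)\<close>.\<close>

definition Linf_weak_star_conv ::
  "real \<Rightarrow> (nat \<Rightarrow> real \<Rightarrow> 'a::euclidean_space) \<Rightarrow> (real \<Rightarrow> 'a) \<Rightarrow> bool" where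
  "Linf_weak_star_conv T f g \<longleftrightarrow>
     (\<forall>n. Linf_fun T (f n)) \<and> Linf_fun T g \<and>
     (\<forall>h. L1_fun T h \<longrightarrow>
        (\<lambda>n. \<integral>t. f n t \<bullet> h t \<partial>leb_interval T) \<longlonglongrightarrow> (\<integral>t. g t \<bullet> h t \<partial>leb_interval T))"

text \<open>\<open>C\<^sub>c\<^sup>\<infinity>(0,T)\<close>, each function being extended by zero to the real line.\<close>

definition test_fun :: "real \<Rightarrow> (real \<Rightarrow> real) \<Rightarrow> bool" where
  "test_fun T \<psi> \<longleftrightarrow> (\<forall>k. (deriv ^^ k) \<psi> differentiable_on UNIV) \<and>
     closure {t. \<psi> t \<noteq> 0} \<subseteq> {0<..<T}"

definition has_weak_deriv ::
  "real \<Rightarrow> (real \<Rightarrow> 'a::euclidean_space) \<Rightarrow> (real \<Rightarrow> 'a) \<Rightarrow> bool" where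
  "has_weak_deriv T u g \<longleftrightarrow>
     (\<forall>\<psi>. test_fun T \<psi> \<longrightarrow>
        (\<integral>t. deriv \<psi> t *\<^sub>R u t \<partial>leb_interval T) = - (\<integral>t. \<psi> t *\<^sub>R g t \<partial>leb_interval T))"

definition W11_fun :: "real \<Rightarrow> (real \<Rightarrow> 'a::euclidean_space) \<Rightarrow> bool" where
  "W11_fun T u \<longleftrightarrow> L1_fun T u \<and> (\<exists>g. L1_fun T g \<and> has_weak_deriv T u g)"

text \<open>A representative of the weak derivative, which is unique up to null sets.\<close>

definition weak_deriv :: "real \<Rightarrow> (real \<Rightarrow> 'a::euclidean_space) \<Rightarrow> real \<Rightarrow> 'a" where
  "weak_deriv T u = (SOME g. L1_fun T g \<and> has_weak_deriv T u g)"

definition abs_cont_on :: "real \<Rightarrow> real \<Rightarrow> (real \<Rightarrow> 'a::euclidean_space) \<Rightarrow> bool" where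
  "abs_cont_on a b f \<longleftrightarrow>
     (\<forall>\<epsilon>>0. \<exists>\<delta>>0. \<forall>D :: (real \<times> real) set.
        finite D \<and> (\<forall>(s, t)\<in>D. a \<le> s \<and> s \<le> t \<and> t \<le> b) \<and>
        pairwise (\<lambda>I J. disjnt {fst I<..<snd I} {fst J<..<snd J}) D \<and>
        (\<Sum>(s, t)\<in>D. t - s) < \<delta> \<longrightarrow>
        (\<Sum>(s, t)\<in>D. norm (f t - f s)) < \<epsilon>)"

section \<open>Solutions of the system\<close>

text \<open>\<^const>\<open>abs_cont_on\<close> expresses that \<open>u\<close> is the absolutely continuous representative of its
  class in \<open>W\<^sup>1\<^sup>,\<^sup>1(0,T)\<close>. Note that \<open>0 powr (q - 2) = 0\<close>.\<close>

definition is_solution ::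
  "'n::finite set set \<Rightarrow> ('n set \<Rightarrow> real) \<Rightarrow> real \<Rightarrow> real \<Rightarrow> real \<Rightarrow> (real ^ 'n \<Rightarrow> real ^ 'n) \<Rightarrow>
   real \<Rightarrow> real ^ 'n \<Rightarrow> real \<Rightarrow> (real \<Rightarrow> real ^ 'n) \<Rightarrow> (real \<Rightarrow> real ^ 'n) \<Rightarrow> bool" where
  "is_solution E w p a q \<pi> T u\<^sub>0 \<tau> u \<mu> \<longleftrightarrow>
     W11_fun T u \<and> abs_cont_on 0 T u \<and> L1_fun T \<mu> \<and>
     (AE t in leb_interval T.
        0 \<in> (\<lambda>\<eta>. weak_deriv T u t + \<eta>) ` hypergraph_Laplacian E w p (\<mu> t)) \<and>
     (AE t in leb_interval T.
        \<mu> t \<in> (\<lambda>\<xi>. \<tau> *\<^sub>R weak_deriv T u t + \<xi> + (a * norm (u t) powr (q - 2)) *\<^sub>R u t + \<pi> (u t))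
                ` hypergraph_Laplacian E w p (u t)) \<and>
     u 0 = u\<^sub>0"

end

theory Submission
  imports Defs "HOL-Complex_Analysis.Great_Picard"
begin

text \<open>The equations are a gradient structure for the free energy
  \<open>\<Phi>(x) = \<phi>(x) + (a/q) \<bar>x\<bar>\<^sup>q + k(x)\<close>, where \<open>\<phi>\<close> is the hypergraph energy: the second inclusion says that
  \<open>\<mu> - \<tau> u'\<close> is a generalised gradient of \<open>\<Phi>\<close> at \<open>u\<close>, and the first one that \<open>-u' \<in> \<partial>\<phi>(\<mu>)\<close>, so that
  \<open>\<mu> \<bullet> u' \<le> -\<phi>(\<mu>)\<close>. The chain rule yields
  \<open>\<Phi>(u(t)) + \<tau> \<integral> \<bar>u'\<bar>\<^sup>2 + \<integral> \<phi>(\<mu>) \<le> \<Phi>(u\<^sub>0)\<close>. Since \<open>q > 2\<close> and \<open>k\<close> grows at most quadratically, \<open>u\<close> is bounded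
  and the integral of \<open>\<phi>(\<mu>)\<close> is bounded, uniformly in \<open>\<tau>\<close>. Subgradients at \<open>\<mu>\<close> are of size at most
  \<open>C (1 + \<phi>(\<mu>))\<^sup>1\<^sup>-\<^sup>1\<^sup>/\<^sup>p\<close>, which bounds \<open>u'\<close>; connectedness makes \<open>\<phi>\<close> coercive on vectors of prescribed
  mean, and the mean of \<open>\<mu>\<close> only involves the bounded lower order terms, which bounds \<open>\<mu>\<close>
  (\<open>flow_uniform_bounds\<close>).

  By the Arzela--Ascoli theorem and weak compactness a subsequence converges. The second inclusion passes
  to the limit because \<open>u\<close> converges uniformly (\<open>limit_second_inclusion\<close>). For the first one, the energy
  inequality at level \<open>\<tau>\<close> and the energy identity for the limit bound the upper limit of
  \<open>\<integral> -u' \<bullet> \<mu>\<close> on every interval, and maximal monotonicity of \<open>\<partial>\<phi>\<close> applies (\<open>limit_first_inclusion\<close>).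

  Three general tools are developed for this. The chain rule for semiconvex functions along an
  indefinite integral (\<open>chain_rule\<close>) rests on the \<open>L\<^sup>1\<close> convergence of averages. Weak compactness and weak
  convergence in \<open>L\<^sup>r\<close>, tested with arbitrary bounded functionals, are derived from a norm convergent
  sequence of iterated midpoints (\<open>Mazur_midpoints\<close>), which uniform convexity provides. Weak
  derivatives are related to indefinite integrals by testing with smooth trapezoids
  (\<open>weak_deriv_increment\<close>).\<close>

section \<open>Uniform convexity of powers of the norm\<close>

lemma powr_convex_combination_le:
  fixes x y r :: real
  assumes "r \<ge> 1" "x \<ge> 0" "y \<ge> 0" "0 \<le> c" "c \<le> 1"
  shows "((1 - c) * x + c * y) powr r \<le> (1 - c) * x powr r + c * y powr r"
proof -
  have z: "(d * x) powr r \<le> d * x powr r" if "0 \<le> d" "d \<le> 1" "x \<ge> 0" for d x :: real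
  proof -
    have "d powr r \<le> d" using that assms(1) powr_mono'[of 1 r d] by (cases "d = 0") auto
    then show ?thesis using that by (simp add: powr_mult mult_right_mono)
  qed
  consider "x = 0" | "y = 0" | "c = 0" | "c = 1" | "x > 0" "y > 0" using assms by linarith
  then show ?thesis
  proof cases
    case 5
    then show ?thesis
      using convex_onD[OF powr_convex[OF assms(1)], of c x y] assms by simp
  qed (use z[of c y] z[of "1 - c" x] assms in auto)
qed

lemma powr_strict_midpoint:
  fixes x y r :: real
  assumes "r > 1" "x \<ge> 0" "y > x"
  shows "((x + y) / 2) powr r < (x powr r + y powr r) / 2"
proof -
  define m where "m = (x + y) / 2"
  have m: "x < m" "m < y" "0 < m" "m - x = y - m" using assms by (auto simp: m_def field_simps)
  have cont: "continuous_on {a..b} (\<lambda>t. t powr r)" if "0 \<le> a" for a b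
    using assms that by (intro continuous_on_powr' continuous_intros) auto
  have der: "((\<lambda>t. t powr r) has_real_derivative r * t powr (r - 1)) (at t)" if "t > 0" for t
    using that by (auto intro!: derivative_eq_intros)
  have df: "(\<lambda>t. t powr r) differentiable (at t)" if "t > 0" for t
    using der[OF that] real_differentiable_def by blast
  obtain l z where z: "x < z" "z < m" "((\<lambda>t. t powr r) has_real_derivative l) (at z)"
      "m powr r - x powr r = (m - x) * l"
    using MVT[of x m "\<lambda>t. t powr r"] cont[of x m] df m assms by auto
  obtain l' z' where z': "m < z'" "z' < y" "((\<lambda>t. t powr r) has_real_derivative l') (at z')"
      "y powr r - m powr r = (y - m) * l'"
    using MVT[of m y "\<lambda>t. t powr r"] cont[of m y] df m assms by auto
  have "l = r * z powr (r - 1)" "l' = r * z' powr (r - 1)"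
    using der[of z] der[of z'] z z' m assms DERIV_unique by (smt (verit))+
  moreover have "z powr (r - 1) < z' powr (r - 1)"
    using z z' assms by (intro powr_less_mono2) auto
  ultimately have "l < l'" using assms by simp
  then have "(m - x) * l < (y - m) * l'" using m by auto
  then have "m powr r - x powr r < y powr r - m powr r" using z z' by simp
  then show ?thesis unfolding m_def by simp
qed

text \<open>The gap in the midpoint convexity inequality for \<open>\<lambda>x. norm x powr r\<close>.\<close>
definition powr_deficit :: "real \<Rightarrow> 'a::euclidean_space \<Rightarrow> 'a \<Rightarrow> real" where
  "powr_deficit r x y = (norm x powr r + norm y powr r) / 2 - norm ((1/2) *\<^sub>R (x + y)) powr r"

lemma powr_deficit_nonneg:
  assumes "r \<ge> 1" shows "powr_deficit r x y \<ge> 0"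
proof -
  have "norm ((1/2) *\<^sub>R (x + y)) \<le> (norm x + norm y) / 2"
    using norm_triangle_ineq[of x y] by simp
  then have "norm ((1/2) *\<^sub>R (x + y)) powr r \<le> ((norm x + norm y) / 2) powr r"
    using assms by (intro powr_mono2) auto
  also have "\<dots> \<le> (norm x powr r + norm y powr r) / 2"
    using powr_convex_combination_le[of r "norm x" "norm y" "1/2"] assms by (simp add: field_simps)
  finally show ?thesis by (simp add: powr_deficit_def)
qed

lemma powr_deficit_pos:
  assumes "r > 1" "x \<noteq> y" shows "powr_deficit r x y > 0"
proof (cases "norm x = norm y")
  case True
  have "norm y \<noteq> 0" using True assms(2) by auto
  then have "norm (x + y) \<noteq> norm x + norm y"
    unfolding norm_triangle_eq using assms(2) by (simp add: True)
  then have "norm ((1/2) *\<^sub>R (x + y)) < norm x"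
    using norm_triangle_ineq[of x y] True by simp
  then show ?thesis using True assms powr_less_mono2[of r "norm ((1/2) *\<^sub>R (x + y))" "norm x"] 
    by (simp add: powr_deficit_def)
next
  case False
  have "norm ((1/2) *\<^sub>R (x + y)) \<le> (norm x + norm y) / 2"
    using norm_triangle_ineq[of x y] by simp
  then have "norm ((1/2) *\<^sub>R (x + y)) powr r \<le> ((norm x + norm y) / 2) powr r"
    using assms by (intro powr_mono2) auto
  also have "\<dots> < (norm x powr r + norm y powr r) / 2"
    using powr_strict_midpoint[of r "norm x" "norm y"] powr_strict_midpoint[of r "norm y" "norm x"]
      False assms by (smt (verit) norm_ge_zero)
  finally show ?thesis by (simp add: powr_deficit_def)
qed

lemma continuous_on_norm_powr [continuous_intros]:
  fixes f :: "'b::topological_space \<Rightarrow> 'a::real_normed_vector"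
  assumes "continuous_on S f" "r > 0"
  shows "continuous_on S (\<lambda>x. norm (f x) powr r)"
  using assms by (intro continuous_on_powr' continuous_intros) auto

lemma powr_deficit_scale:
  assumes "c > 0"
  shows "powr_deficit r (c *\<^sub>R x) (c *\<^sub>R y) = c powr r * powr_deficit r x y"
proof -
  have "norm (c *\<^sub>R v) powr r = c powr r * norm v powr r" for v :: 'a
    using assms by (simp add: powr_mult)
  moreover have "(1/2) *\<^sub>R (c *\<^sub>R x + c *\<^sub>R y) = c *\<^sub>R ((1/2) *\<^sub>R (x + y))"
    by (simp add: algebra_simps)
  ultimately show ?thesis unfolding powr_deficit_def by (simp only:) (simp add: algebra_simps)
qed

text \<open>Uniform convexity in a form that can be integrated. On the part of the unit sphere of the
  product space where the inequality does not hold strictly with \<open>C = 0\<close>, the points \<open>x\<close> and \<open>y\<close> differ, so the gap is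
  positive there and bounded below by compactness; both sides are homogeneous of degree \<open>r\<close>.\<close>
lemma norm_diff_powr_le_deficit:
  assumes "r > 1" "\<epsilon> > 0"
  obtains C where "C \<ge> 0" "\<And>x y :: 'a::euclidean_space. norm (x - y) powr r \<le>
     \<epsilon> * (norm x powr r + norm y powr r) + C * powr_deficit r x y"
proof -
  define S where "S = {z :: 'a \<times> 'a. norm z = 1 \<and>
     \<epsilon> * (norm (fst z) powr r + norm (snd z) powr r) \<le> norm (fst z - snd z) powr r}"
  let ?D = "\<lambda>z :: 'a \<times> 'a. powr_deficit r (fst z) (snd z)"
  have cD: "continuous_on UNIV ?D"
    unfolding powr_deficit_def using assms by (intro continuous_intros) auto
  have "closed S" unfolding S_def
    using assms by (intro closed_Collect_conj closed_Collect_eq closed_Collect_le continuous_intros) auto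
  then have "compact S"
    by (simp add: compact_eq_bounded_closed bounded_iff S_def) (auto intro!: exI[of _ 1])
  have pos: "?D z > 0" if "z \<in> S" for z
  proof (rule powr_deficit_pos[OF assms(1)])
    show "fst z \<noteq> snd z"
    proof
      assume e: "fst z = snd z"
      then have "\<epsilon> * (2 * norm (snd z) powr r) \<le> 0" using that by (auto simp: S_def)
      then have "snd z = 0" using assms by (simp add: mult_le_0_iff)
      then have "z = 0" using e by (metis prod.expand fst_zero snd_zero)
      then show False using that by (simp add: S_def)
    qed
  qed
  obtain c where c: "c > 0" "\<And>z. z \<in> S \<Longrightarrow> c \<le> ?D z"
  proof (cases "S = {}")
    case True
    then show ?thesis using that[of 1] by auto
  next
    case False
    then obtain z where "z \<in> S" "\<And>w. w \<in> S \<Longrightarrow> ?D z \<le> ?D w"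
      using continuous_attains_inf[OF \<open>compact S\<close> False, of ?D] cD continuous_on_subset by blast
    then show ?thesis using pos that by blast
  qed
  define C where "C = 2 powr r / c"
  have C: "C \<ge> 0" using c by (simp add: C_def)
  have unit: "norm (x - y) powr r \<le> \<epsilon> * (norm x powr r + norm y powr r) + C * powr_deficit r x y"
    if "norm (x, y) = 1" for x y :: 'a
  proof (cases "(x, y) \<in> S")
    case True
    have "norm (x - y) \<le> norm x + norm y" by (rule norm_triangle_ineq4)
    also have "\<dots> \<le> 2" using that norm_fst_le[of "x" "y"] norm_snd_le[of y x] by simp
    finally have "norm (x - y) powr r \<le> 2 powr r" using assms by (intro powr_mono2) auto
    also have "\<dots> = C * c" using c by (simp add: C_def)
    also have "\<dots> \<le> C * powr_deficit r x y" using c(2)[OF True] C by (intro mult_left_mono) auto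
    finally show ?thesis using assms(2) by (smt (verit) powr_ge_zero mult_nonneg_nonneg)
  next
    case False
    then have "norm (x - y) powr r \<le> \<epsilon> * (norm x powr r + norm y powr r)" using that by (auto simp: S_def)
    then show ?thesis using C powr_deficit_nonneg[of r x y] assms(1) by (smt (verit) mult_nonneg_nonneg)
  qed
  have "norm (x - y) powr r \<le> \<epsilon> * (norm x powr r + norm y powr r) + C * powr_deficit r x y" for x y :: 'a
  proof (cases "(x, y) = 0")
    case True
    then show ?thesis by (simp add: powr_deficit_def zero_prod_def)
  next
    case False
    define s where "s = norm (x, y)"
    have s: "s > 0" using False by (simp add: s_def)
    define x' y' where "x' = x /\<^sub>R s" and "y' = y /\<^sub>R s"
    have xy: "x = s *\<^sub>R x'" "y = s *\<^sub>R y'" using s by (auto simp: x'_def y'_def)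
    have n: "norm (x', y') = 1"
    proof -
      have "(x', y') = (x, y) /\<^sub>R s" by (simp add: x'_def y'_def)
      then have "norm (x', y') = norm ((x, y) /\<^sub>R s)" by (rule arg_cong)
      also have "\<dots> = norm (x, y) / s" using s by (simp only: norm_scaleR) (simp add: divide_inverse)
      finally show ?thesis using s by (simp add: s_def)
    qed
    have nn: "norm (s *\<^sub>R v) powr r = s powr r * norm v powr r" for v :: 'a
      using s by (simp add: powr_mult)
    have "norm (x - y) powr r = s powr r * norm (x' - y') powr r"
      unfolding xy by (simp only: nn scaleR_diff_right[symmetric])
    also have "\<dots> \<le> s powr r * (\<epsilon> * (norm x' powr r + norm y' powr r) + C * powr_deficit r x' y')"
      by (intro mult_left_mono unit n) auto
    also have "\<dots> = \<epsilon> * (norm x powr r + norm y powr r) + C * powr_deficit r x y"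
      unfolding xy nn powr_deficit_scale[OF s] by (simp add: algebra_simps)
    finally show ?thesis .
  qed
  then show ?thesis using that C by blast
qed

section \<open>Strongly convergent iterated midpoints in \<open>L\<^sup>r\<close>\<close>

text \<open>All functions obtained from the tail \<open>f n, f (n + 1), \<dots>\<close> by repeatedly taking pointwise
  midpoints; a substitute for the convex hull of the tail that needs no finite convex combinations.\<close>
inductive_set mids :: "(nat \<Rightarrow> 'x \<Rightarrow> 'a::real_vector) \<Rightarrow> nat \<Rightarrow> ('x \<Rightarrow> 'a) set"
  for f :: "nat \<Rightarrow> 'x \<Rightarrow> 'a" and n :: nat where
  base: "m \<ge> n \<Longrightarrow> f m \<in> mids f n"
| mid: "x \<in> mids f n \<Longrightarrow> y \<in> mids f n \<Longrightarrow> (\<lambda>t. (1/2) *\<^sub>R (x t + y t)) \<in> mids f n"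

lemma mids_mono: "m \<le> n \<Longrightarrow> mids f n \<subseteq> mids f m"
proof
  fix x assume "m \<le> n" "x \<in> mids f n"
  from this(2,1) show "x \<in> mids f m"
    by induction (auto intro: mids.intros)
qed

text \<open>Membership in \<open>L\<^sup>r(M)\<close> for an arbitrary measure, by a representative.\<close>
definition Lr_fun :: "'x measure \<Rightarrow> real \<Rightarrow> ('x \<Rightarrow> 'a::euclidean_space) \<Rightarrow> bool" where
  "Lr_fun M r f \<longleftrightarrow> f \<in> borel_measurable M \<and> integrable M (\<lambda>t. norm (f t) powr r)"

lemma Lr_funD [dest]:
  assumes "Lr_fun M r f"
  shows "f \<in> borel_measurable M" "integrable M (\<lambda>t. norm (f t) powr r)"
  using assms by (auto simp: Lr_fun_def)

lemma Lr_fun_scale: "Lr_fun M r f \<Longrightarrow> Lr_fun M r (\<lambda>t. c *\<^sub>R f t)"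
  by (auto simp: Lr_fun_def powr_mult)

lemma norm_add_powr_le:
  fixes x y :: "'a::real_normed_vector"
  assumes "r \<ge> 1"
  shows "norm (x + y) powr r \<le> 2 powr (r - 1) * (norm x powr r + norm y powr r)"
proof -
  have "norm (x + y) powr r \<le> (2 * ((norm x + norm y) / 2)) powr r"
    using assms norm_triangle_ineq[of x y] by (intro powr_mono2) auto
  also have "\<dots> = 2 powr r * ((norm x + norm y) / 2) powr r"
    by (subst powr_mult) auto
  also have "\<dots> \<le> 2 powr r * ((norm x powr r + norm y powr r) / 2)"
    using powr_convex_combination_le[of r "norm x" "norm y" "1/2"] assms
    by (intro mult_left_mono) (simp_all add: field_simps)
  also have "\<dots> = 2 powr (r - 1) * (norm x powr r + norm y powr r)"
    by (simp add: powr_diff)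
  finally show ?thesis .
qed

lemma Lr_fun_add:
  assumes "Lr_fun M r f" "Lr_fun M r g" "r \<ge> 1"
  shows "Lr_fun M r (\<lambda>t. f t + g t)"
proof -
  note [measurable] = Lr_funD(1)[OF assms(1)] Lr_funD(1)[OF assms(2)]
  have "integrable M (\<lambda>t. norm (f t + g t) powr r)"
    by (rule Bochner_Integration.integrable_bound[of _ "\<lambda>t. 2 powr (r - 1) * (norm (f t) powr r + norm (g t) powr r)"])
       (use assms norm_add_powr_le[OF assms(3)] in \<open>auto intro!: AE_I2\<close>)
  then show ?thesis by (simp add: Lr_fun_def)
qed

lemma Lr_fun_diff:
  assumes "Lr_fun M r f" "Lr_fun M r g" "r \<ge> 1"
  shows "Lr_fun M r (\<lambda>t. f t - g t)"
  using Lr_fun_add[OF assms(1) Lr_fun_scale[OF assms(2), of "-1"] assms(3)] by simp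

lemma mids_induct_props:
  assumes "x \<in> mids f n"
    and "\<And>m. P (f m)" and "\<And>x y. P x \<Longrightarrow> P y \<Longrightarrow> P (\<lambda>t. (1/2) *\<^sub>R (x t + y t))"
  shows "P x"
  using assms(1) by induction (use assms in auto)

lemma ennreal_finite_ex: "x \<noteq> \<infinity> \<Longrightarrow> \<exists>S\<ge>0. x = ennreal S"
  by (cases x) auto

text \<open>Completeness of \<open>L\<^sup>r\<close> for rapidly converging sequences. The ratio \<open>2 powr (- r - 1)\<close> leaves
  room for the weights \<open>2 powr (k * r)\<close>: the weighted increments still have a finite sum almost
  everywhere, so the increments themselves decay like \<open>2 powr (- k)\<close> pointwise.\<close>
lemma Lr_Cauchy_fast_converges:
  fixes h :: "nat \<Rightarrow> 'x \<Rightarrow> 'a::euclidean_space"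
  assumes r: "r > 1" and L: "\<And>k. Lr_fun M r (h k)"
    and fast: "\<And>k m. k \<le> m \<Longrightarrow> (\<integral>t. norm (h k t - h m t) powr r \<partial>M) \<le> (2 powr (- r - 1)) ^ k"
  obtains g where "Lr_fun M r g" "AE t in M. (\<lambda>k. h k t) \<longlonglongrightarrow> g t"
    "(\<lambda>k. \<integral>t. norm (h k t - g t) powr r \<partial>M) \<longlonglongrightarrow> 0"
proof -
  define c where "c = 2 powr (- r - 1 :: real)"
  have c: "0 < c" "c < 1" using r by (auto simp: c_def powr_less_one)
  note [measurable] = Lr_funD(1)[OF L]
  have Ld: "integrable M (\<lambda>t. norm (h k t - h m t) powr r)" for k m
    using Lr_fun_diff[OF L L] r by (auto simp: Lr_fun_def)
  have nn: "(\<integral>\<^sup>+t. ennreal (norm (h k t - h m t) powr r) \<partial>M) \<le> ennreal (c ^ k)" if "k \<le> m" for k m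
    using fast[OF that] Ld by (simp add: nn_integral_eq_integral c_def ennreal_leI)
  let ?d = "\<lambda>k t. 2 powr (k * r) * norm (h k t - h (Suc k) t) powr r"
  have "(\<integral>\<^sup>+t. (\<Sum>k. ennreal (?d k t)) \<partial>M) = (\<Sum>k. \<integral>\<^sup>+t. ennreal (?d k t) \<partial>M)"
    by (rule nn_integral_suminf) auto
  also have "\<dots> \<le> (\<Sum>k. ennreal ((1/2) ^ k))"
  proof (intro suminf_le)
    fix k :: nat
    have "(\<integral>\<^sup>+t. ennreal (?d k t) \<partial>M) = 2 powr (k * r) * (\<integral>\<^sup>+t. ennreal (norm (h k t - h (Suc k) t) powr r) \<partial>M)"
      by (simp add: ennreal_mult' nn_integral_cmult)
    also have "\<dots> \<le> ennreal (2 powr (k * r)) * ennreal (c ^ k)"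
      by (intro mult_left_mono nn) auto
    also have "\<dots> = ennreal (2 powr (k * r) * c ^ k)" using c by (simp add: ennreal_mult')
    also have "2 powr (k * r) * c ^ k = (1/2) ^ k"
    proof -
      have "c ^ k = c powr k" using c by (simp add: powr_realpow)
      also have "\<dots> = 2 powr ((- r - 1) * k)" by (simp add: c_def powr_powr)
      finally have "2 powr (k * r) * c ^ k = 2 powr (- real k)" by (simp add: powr_add[symmetric] algebra_simps)
      then show ?thesis by (simp add: powr_minus powr_realpow power_one_over inverse_eq_divide)
    qed
    finally show "(\<integral>\<^sup>+t. ennreal (?d k t) \<partial>M) \<le> ennreal ((1/2) ^ k)" .
  qed auto
  also have "\<dots> = ennreal (\<Sum>k. (1/2) ^ k)" by (intro suminf_ennreal2) (auto intro: summable_geometric)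
  also have "\<dots> < \<infinity>" by simp
  finally have "AE t in M. (\<Sum>k. ennreal (?d k t)) \<noteq> \<infinity>"
    by (intro nn_integral_PInf_AE) auto
  then have conv: "AE t in M. convergent (\<lambda>k. h k t)"
  proof eventually_elim
    fix t assume "(\<Sum>k. ennreal (?d k t)) \<noteq> \<infinity>"
    then obtain S where S: "S \<ge> 0" "(\<Sum>k. ennreal (?d k t)) = ennreal S"
      using ennreal_finite_ex by blast
    have "?d k t \<le> S" for k
    proof -
      have "(\<Sum>i\<in>{k}. ennreal (?d i t)) \<le> (\<Sum>k. ennreal (?d k t))" by (intro sum_le_suminf) auto
      then show ?thesis using S by simp
    qed
    then have b: "norm (h k t - h (Suc k) t) \<le> S powr (1/r) * (1/2) ^ k" for k
    proof -
      have "(2 ^ k * norm (h k t - h (Suc k) t)) powr r \<le> S"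
      proof -
        have "(2 ^ k) powr r = 2 powr (k * r)" by (simp add: powr_realpow[symmetric] powr_powr)
        then show ?thesis using \<open>?d k t \<le> S\<close> by (simp add: powr_mult)
      qed
      then have "((2 ^ k * norm (h k t - h (Suc k) t)) powr r) powr (1/r) \<le> S powr (1/r)"
        using r by (intro powr_mono2) auto
      then have "2 ^ k * norm (h k t - h (Suc k) t) \<le> S powr (1/r)"
        using r by (simp add: powr_powr)
      then show ?thesis by (simp add: field_simps power_one_over)
    qed
    have "summable (\<lambda>k. h (Suc k) t - h k t)"
      by (rule summable_comparison_test'[where g = "\<lambda>k. S powr (1/r) * (1/2) ^ k" and N = 0])
         (use b in \<open>auto simp: norm_minus_commute intro!: summable_mult summable_geometric\<close>)
    then have "convergent (\<lambda>n. h n t - h 0 t)"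
      unfolding summable_iff_convergent by (simp only: sum_lessThan_telescope[of "\<lambda>k. h k t"])
    then have "convergent (\<lambda>n. (h n t - h 0 t) + h 0 t)"
      by (intro convergent_add convergent_const)
    then show "convergent (\<lambda>k. h k t)" by simp
  qed
  define g where "g = (\<lambda>t. lim (\<lambda>k. h k t))"
  have [measurable]: "g \<in> borel_measurable M" unfolding g_def by (intro borel_measurable_lim_metric) auto
  have lim: "AE t in M. (\<lambda>k. h k t) \<longlonglongrightarrow> g t"
    using conv by eventually_elim (simp add: g_def convergent_LIMSEQ_iff)
  have bnd: "(\<integral>\<^sup>+t. ennreal (norm (h k t - g t) powr r) \<partial>M) \<le> ennreal (c ^ k)" for k
  proof -
    have "(\<integral>\<^sup>+t. ennreal (norm (h k t - g t) powr r) \<partial>M) = (\<integral>\<^sup>+t. liminf (\<lambda>m. ennreal (norm (h k t - h m t) powr r)) \<partial>M)"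
    proof (rule nn_integral_cong_AE, use lim in eventually_elim)
      fix t assume "(\<lambda>k. h k t) \<longlonglongrightarrow> g t"
      then have "(\<lambda>m. norm (h k t - h m t) powr r) \<longlonglongrightarrow> norm (h k t - g t) powr r"
        using r by (intro tendsto_powr2 tendsto_intros) auto
      then have "(\<lambda>m. ennreal (norm (h k t - h m t) powr r)) \<longlonglongrightarrow> ennreal (norm (h k t - g t) powr r)"
        by (intro tendsto_ennrealI)
      then show "ennreal (norm (h k t - g t) powr r) = liminf (\<lambda>m. ennreal (norm (h k t - h m t) powr r))"
        by (intro lim_imp_Liminf[symmetric]) auto
    qed
    also have "\<dots> \<le> liminf (\<lambda>m. \<integral>\<^sup>+t. ennreal (norm (h k t - h m t) powr r) \<partial>M)"
      by (intro nn_integral_liminf) auto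
    also have "\<dots> \<le> limsup (\<lambda>m. \<integral>\<^sup>+t. ennreal (norm (h k t - h m t) powr r) \<partial>M)"
      by (intro Liminf_le_Limsup) auto
    also have "\<dots> \<le> ennreal (c ^ k)"
      by (intro Limsup_bounded) (rule eventually_mono[OF eventually_ge_at_top[of k] nn])
    finally show ?thesis .
  qed
  have Ldg: "Lr_fun M r (\<lambda>t. h k t - g t)" for k
    unfolding Lr_fun_def
  proof (intro conjI integrableI_nonneg)
    show "(\<integral>\<^sup>+ x. ennreal (norm (h k x - g x) powr r) \<partial>M) < \<infinity>"
      using bnd[of k] by (rule le_less_trans) simp
  qed auto
  have "Lr_fun M r g"
    using Lr_fun_diff[OF L[of 0] Ldg[of 0]] r by simp
  moreover have "(\<lambda>k. \<integral>t. norm (h k t - g t) powr r \<partial>M) \<longlonglongrightarrow> 0"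
  proof (rule tendsto_sandwich[OF _ _ tendsto_const])
    show "\<forall>\<^sub>F k in sequentially. (\<integral>t. norm (h k t - g t) powr r \<partial>M) \<le> c ^ k"
    proof (rule always_eventually, rule allI)
      fix k
      have "ennreal (\<integral>t. norm (h k t - g t) powr r \<partial>M) \<le> ennreal (c ^ k)"
        using bnd[of k] Ldg[of k] by (simp add: nn_integral_eq_integral Lr_fun_def)
      then show "(\<integral>t. norm (h k t - g t) powr r \<partial>M) \<le> c ^ k" using c by simp
    qed
    show "(\<lambda>k. c ^ k) \<longlonglongrightarrow> 0" using c by (intro LIMSEQ_power_zero) auto
  qed auto
  ultimately show ?thesis using that lim by blast
qed

text \<open>A bounded sequence in \<open>L\<^sup>r\<close>, \<open>r > 1\<close>, has iterated midpoints of its tails that converge in norm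
  and almost everywhere. Choose \<open>y n\<close> in the \<open>n\<close>-th midpoint set with nearly minimal \<open>\<integral> norm (y n) powr r\<close>.
  The infima increase to a finite limit; for \<open>m \<ge> n\<close> the midpoint of \<open>y n\<close> and \<open>y m\<close> does not lie below the
  \<open>n\<close>-th infimum, so the integrated convexity gap tends to \<open>0\<close>, and uniform convexity makes \<open>y\<close> a Cauchy
  sequence.\<close>
lemma Mazur_midpoints:
  fixes f :: "nat \<Rightarrow> 'x \<Rightarrow> 'a::euclidean_space"
  assumes r: "r > 1" and L: "\<And>n. Lr_fun M r (f n)"
    and B: "\<And>n. (\<integral>t. norm (f n t) powr r \<partial>M) \<le> B"
  obtains h g where "\<And>k. h k \<in> mids f k" "\<And>k. Lr_fun M r (h k)" "Lr_fun M r g" 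
    "AE t in M. (\<lambda>k. h k t) \<longlonglongrightarrow> g t"
    "(\<lambda>k. \<integral>t. norm (h k t - g t) powr r \<partial>M) \<longlonglongrightarrow> 0"
proof -
  define J where "J = (\<lambda>x :: 'x \<Rightarrow> 'a. \<integral>t. norm (x t) powr r \<partial>M)"
  have Lm: "Lr_fun M r x" if "x \<in> mids f n" for x n
    using that by (rule mids_induct_props) (use L r in \<open>auto intro!: Lr_fun_scale Lr_fun_add\<close>)
  have idef: "integrable M (\<lambda>t. powr_deficit r (x t) (y t))" if "Lr_fun M r x" "Lr_fun M r y" for x y
    using that Lr_fun_scale[OF Lr_fun_add[OF that], of "1/2"] r unfolding powr_deficit_def Lr_fun_def
    by (intro Bochner_Integration.integrable_diff integrable_divide Bochner_Integration.integrable_add) auto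
  have Jdef: "(\<integral>t. powr_deficit r (x t) (y t) \<partial>M) = (J x + J y) / 2 - J (\<lambda>t. (1/2) *\<^sub>R (x t + y t))"
    if "Lr_fun M r x" "Lr_fun M r y" for x y
    using that Lr_fun_scale[OF Lr_fun_add[OF that], of "1/2"] r unfolding powr_deficit_def J_def Lr_fun_def
    by simp
  have JB: "J x \<le> B" if "x \<in> mids f n" for x n
  proof -
    have "J x \<le> B \<and> Lr_fun M r x" using that
    proof (rule mids_induct_props)
      fix x y assume *: "J x \<le> B \<and> Lr_fun M r x" "J y \<le> B \<and> Lr_fun M r y"
      have "0 \<le> (\<integral>t. powr_deficit r (x t) (y t) \<partial>M)"
        using r by (intro Bochner_Integration.integral_nonneg) (auto intro: powr_deficit_nonneg)
      then have "J (\<lambda>t. (1/2) *\<^sub>R (x t + y t)) \<le> B" using * Jdef[of x y] by simp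
      then show "J (\<lambda>t. (1/2) *\<^sub>R (x t + y t)) \<le> B \<and> Lr_fun M r (\<lambda>t. (1/2) *\<^sub>R (x t + y t))"
        using * r by (auto intro!: Lr_fun_scale Lr_fun_add)
    qed (use L B in \<open>auto simp: J_def\<close>)
    then show ?thesis ..
  qed
  have J0: "J x \<ge> 0" for x by (simp add: J_def)
  define d where "d = (\<lambda>n. Inf (J ` mids f n))"
  have ne: "mids f n \<noteq> {}" for n using mids.base[of n n f] by auto
  have bb: "bdd_below (J ` mids f n)" for n using J0 by (intro bdd_belowI[of _ 0]) auto
  have dle: "d n \<le> J x" if "x \<in> mids f n" for x n
    unfolding d_def using that bb by (intro cInf_lower) auto
  have "incseq d" unfolding incseq_def d_def
    using mids_mono[of _ _ f] ne bb by (intro allI impI cInf_superset_mono image_mono) auto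
  moreover have "d n \<le> B" for n using dle[OF mids.base[of n n]] JB[OF mids.base[of n n f]] by auto
  ultimately obtain dl where d: "d \<longlonglongrightarrow> dl" "\<And>n. d n \<le> dl"
    using incseq_convergent[of d B] by auto
  have "\<exists>x\<in>mids f n. J x < d n + 1 / (real n + 1)" for n
    using cInf_lessD[of "J ` mids f n" "d n + 1 / (real n + 1)"] ne by (auto simp: d_def)
  then obtain y where y: "\<And>n. y n \<in> mids f n" "\<And>n. J (y n) < d n + 1 / (real n + 1)" by metis
  have Ly: "Lr_fun M r (y n)" for n using Lm[OF y(1)] .
  have cauchy: "\<exists>N. \<forall>m\<ge>N. (\<integral>t. norm (y N t - y m t) powr r \<partial>M) \<le> e" if "e > 0" for e
  proof -
    have B0: "B \<ge> 0" using JB[OF y(1)] J0[of "y 0"] by (meson order_trans)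
    define \<epsilon> where "\<epsilon> = e / (4 * (B + 1))"
    have \<epsilon>: "\<epsilon> > 0" using that B0 by (simp add: \<epsilon>_def)
    obtain C where C: "C \<ge> 0" "\<And>x y :: 'a. norm (x - y) powr r \<le>
       \<epsilon> * (norm x powr r + norm y powr r) + C * powr_deficit r x y"
      using norm_diff_powr_le_deficit[OF r \<epsilon>] by metis
    have "(\<lambda>n. C * ((dl - d n) / 2 + 1 / (real n + 1))) \<longlonglongrightarrow> C * ((dl - dl) / 2 + 0)"
      using LIMSEQ_Suc[OF lim_1_over_n[where ?'a = real]]
      by (intro tendsto_intros d) (simp_all add: add.commute)
    then have "\<forall>\<^sub>F n in sequentially. C * ((dl - d n) / 2 + 1 / (real n + 1)) < e / 2"
      using that by (intro order_tendstoD) auto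
    then obtain N where N: "C * ((dl - d N) / 2 + 1 / (real N + 1)) < e / 2"
      by (auto simp: eventually_sequentially)
    have alg: "(a + b) / 2 - c' \<le> (l - d') / 2 + e'" if "b \<le> l + e'" "d' \<le> c'" "a < d' + e'"
      for a b c' d' e' l :: real using that by (simp add: field_simps)
    show ?thesis
    proof (intro exI allI impI)
      fix m assume "N \<le> m"
      have yN: "y N \<in> mids f N" "y m \<in> mids f N" using y(1) mids_mono[OF \<open>N \<le> m\<close>] by auto
      have "(\<integral>t. norm (y N t - y m t) powr r \<partial>M) \<le>
        (\<integral>t. \<epsilon> * (norm (y N t) powr r + norm (y m t) powr r) + C * powr_deficit r (y N t) (y m t) \<partial>M)"
        using Lr_fun_diff[OF Ly Ly] Ly r idef[OF Ly Ly] C(2) by (intro integral_mono) (auto simp: Lr_fun_def)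
      also have "\<dots> = \<epsilon> * (J (y N) + J (y m)) + C * (\<integral>t. powr_deficit r (y N t) (y m t) \<partial>M)"
        using Ly idef[OF Ly Ly] by (simp add: J_def Lr_fun_def)
      also have "\<dots> \<le> \<epsilon> * (B + B) + C * ((dl - d N) / 2 + 1 / (real N + 1))"
      proof (intro add_mono mult_left_mono JB[OF yN(1)] JB[OF yN(2)])
        have "1 / (real m + 1) \<le> 1 / (real N + 1)" using \<open>N \<le> m\<close> by (intro divide_left_mono) auto
        then have "J (y m) \<le> dl + 1 / (real N + 1)" using y(2)[of m] d(2)[of m] by linarith
        moreover have "d N \<le> J (\<lambda>t. (1/2) *\<^sub>R (y N t + y m t))" using yN by (intro dle mids.mid)
        ultimately show "(\<integral>t. powr_deficit r (y N t) (y m t) \<partial>M) \<le> (dl - d N) / 2 + 1 / (real N + 1)"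
          unfolding Jdef[OF Ly Ly] using y(2)[of N] alg by blast
      qed (use \<epsilon> C in auto)
      also have "\<dots> \<le> e"
      proof -
        have "\<epsilon> * (B + B) \<le> e / 2" using B0 that by (simp add: \<epsilon>_def field_simps)
        then show ?thesis using N by linarith
      qed
      finally show "(\<integral>t. norm (y N t - y m t) powr r \<partial>M) \<le> e" .
    qed
  qed
  define c where "c = 2 powr (- r - 1 :: real)"
  have c: "c > 0" by (simp add: c_def)
  have two: "norm (u - v) powr r \<le> 2 powr (r - 1) * (norm (z - u) powr r + norm (z - v) powr r)" for u v z :: 'a
    using norm_add_powr_le[of r "u - z" "z - v"] r by (simp add: norm_minus_commute)
  have step: "\<exists>N>n. \<forall>k\<ge>N. \<forall>m\<ge>N. (\<integral>t. norm (y k t - y m t) powr r \<partial>M) \<le> e" if e: "e > 0" for e and n :: nat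
  proof -
    obtain N where N: "\<And>m. m \<ge> N \<Longrightarrow> (\<integral>t. norm (y N t - y m t) powr r \<partial>M) \<le> e / 2 powr r"
      using cauchy[of "e / 2 powr r"] e by auto
    show ?thesis
    proof (intro exI[of _ "max N (Suc n)"] conjI allI impI)
      fix k m assume k: "k \<ge> max N (Suc n)" "m \<ge> max N (Suc n)"
      have I: "integrable M (\<lambda>t. norm (y i t - y j t) powr r)" for i j
        using Lr_fun_diff[OF Ly Ly] r by (auto simp: Lr_fun_def)
      have "(\<integral>t. norm (y k t - y m t) powr r \<partial>M) \<le>
        (\<integral>t. 2 powr (r - 1) * (norm (y N t - y k t) powr r + norm (y N t - y m t) powr r) \<partial>M)"
        by (intro integral_mono I integrable_mult_right Bochner_Integration.integrable_add two)
      also have "\<dots> = 2 powr (r - 1) * ((\<integral>t. norm (y N t - y k t) powr r \<partial>M) + (\<integral>t. norm (y N t - y m t) powr r \<partial>M))"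
        using I by simp
      also have "\<dots> \<le> 2 powr (r - 1) * (e / 2 powr r + e / 2 powr r)"
        using k by (intro mult_left_mono add_mono N) auto
      also have "\<dots> = e" by (simp add: powr_diff)
      finally show "(\<integral>t. norm (y k t - y m t) powr r \<partial>M) \<le> e" .
    qed auto
  qed
  \<comment> \<open>indices along which the distances decay at the rate required for completeness\<close>
  define s where "s = rec_nat (SOME N. \<forall>k\<ge>N. \<forall>m\<ge>N. (\<integral>t. norm (y k t - y m t) powr r \<partial>M) \<le> 1)
     (\<lambda>i n. SOME N. N > n \<and> (\<forall>k\<ge>N. \<forall>m\<ge>N. (\<integral>t. norm (y k t - y m t) powr r \<partial>M) \<le> c ^ Suc i))"
  have s0: "\<forall>k\<ge>s 0. \<forall>m\<ge>s 0. (\<integral>t. norm (y k t - y m t) powr r \<partial>M) \<le> 1"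
    unfolding s_def by simp (rule someI_ex, use step[of 1 0] in auto)
  have sS: "s (Suc i) > s i \<and> (\<forall>k\<ge>s (Suc i). \<forall>m\<ge>s (Suc i). (\<integral>t. norm (y k t - y m t) powr r \<partial>M) \<le> c ^ Suc i)" for i
  proof -
    have "\<exists>N. N > s i \<and> (\<forall>k\<ge>N. \<forall>m\<ge>N. (\<integral>t. norm (y k t - y m t) powr r \<partial>M) \<le> c ^ Suc i)"
      using step[of "c ^ Suc i" "s i"] c by auto
    from someI_ex[OF this] show ?thesis by (simp add: s_def)
  qed
  have sm: "strict_mono s" using sS by (simp add: strict_mono_Suc_iff)
  have fast: "(\<integral>t. norm (y (s k) t - y (s m) t) powr r \<partial>M) \<le> c ^ k" if "k \<le> m" for k m
  proof -
    have "s k \<le> s m" using sm that by (simp add: strict_mono_less_eq)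
    then show ?thesis using s0 sS[of "k - 1"] by (cases k) auto
  qed
  obtain g where g: "Lr_fun M r g" "AE t in M. (\<lambda>k. y (s k) t) \<longlonglongrightarrow> g t"
    "(\<lambda>k. \<integral>t. norm (y (s k) t - g t) powr r \<partial>M) \<longlonglongrightarrow> 0"
    using Lr_Cauchy_fast_converges[OF r, of M "\<lambda>k. y (s k)"] Ly fast unfolding c_def by blast
  show ?thesis
  proof (rule that[of "\<lambda>k. y (s k)" g])
    show "y (s k) \<in> mids f k" for k
      using y(1)[of "s k"] mids_mono[of k "s k" f] seq_suble[OF sm, of k] by auto
  qed (use g Ly in auto)
qed

section \<open>Averages of integrable functions on an interval\<close>

lemma AE_lebesgue_onE:
  assumes "AE x in lebesgue_on S. P x" "S \<in> sets lebesgue"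
  obtains N where "negligible N" "\<And>x. x \<in> S \<Longrightarrow> x \<notin> N \<Longrightarrow> P x"
proof -
  have "AE x in lebesgue. x \<in> S \<longrightarrow> P x" using assms by (simp add: AE_restrict_space_iff)
  then obtain N where "\<And>x. x \<in> space lebesgue - N \<Longrightarrow> x \<in> S \<longrightarrow> P x" "N \<in> null_sets lebesgue"
    using AE_E3 by blast
  then show ?thesis using that[of N] by (auto simp: negligible_iff_null_sets)
qed

lemma AE_lebesgue_onI:
  assumes "negligible N" "\<And>x. x \<in> S \<Longrightarrow> x \<notin> N \<Longrightarrow> P x" "S \<in> sets lebesgue"
  shows "AE x in lebesgue_on S. P x"
proof -
  have "AE x in lebesgue. x \<in> S \<longrightarrow> P x"
    using assms by (intro AE_I'[of N]) (auto simp: negligible_iff_null_sets)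
  then show ?thesis using assms by (simp add: AE_restrict_space_iff)
qed

text \<open>Lebesgue's differentiation theorem with one-sided averages, for the extension of \<open>g\<close> by \<open>0\<close>.\<close>
lemma right_average_tendsto:
  fixes g :: "real \<Rightarrow> 'a::euclidean_space"
  assumes "g absolutely_integrable_on {a..b}"
  obtains N where "negligible N"
    "\<And>x d. x \<in> {a..b} \<Longrightarrow> x \<notin> N \<Longrightarrow> (\<And>n. d n > 0) \<Longrightarrow> d \<longlonglongrightarrow> 0 \<Longrightarrow>
       (\<lambda>n. integral {x..x + d n} (\<lambda>x. if x \<in> {a..b} then g x else 0) /\<^sub>R d n) \<longlonglongrightarrow> g x"
proof -
  let ?g = "\<lambda>x. if x \<in> {a..b} then g x else 0"
  have "?g integrable_on cbox c d" for c d
  proof (rule integrable_on_subcbox)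
    show "?g integrable_on UNIV"
      using assms by (subst integrable_restrict_UNIV) (auto simp: absolutely_integrable_on_def)
  qed auto
  then obtain N where N: "negligible N" "\<And>x e. \<lbrakk>x \<notin> N; 0 < e\<rbrakk> \<Longrightarrow> \<exists>d>0. \<forall>h. 0 < h \<and> h < d \<longrightarrow>
      norm (integral (cbox x (x + h *\<^sub>R One)) ?g /\<^sub>R h ^ DIM(real) - ?g x) < e"
    by (rule integrable_ccontinuous_explicit[of ?g]) blast
  show ?thesis
  proof (rule that[OF N(1)])
    fix x and d :: "nat \<Rightarrow> real" assume x: "x \<in> {a..b}" "x \<notin> N" and d: "\<And>n. d n > 0" "d \<longlonglongrightarrow> 0"
    show "(\<lambda>n. integral {x..x + d n} ?g /\<^sub>R d n) \<longlonglongrightarrow> g x"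
    proof (rule LIMSEQ_I)
      fix e :: real assume "0 < e"
      then have "\<exists>\<delta>>0. \<forall>h. 0 < h \<and> h < \<delta> \<longrightarrow> norm (integral {x..x + h} ?g /\<^sub>R h - g x) < e"
        using N(2)[OF x(2), of e] x(1) by simp
      then obtain \<delta> where \<delta>: "\<delta> > 0" "\<And>h. 0 < h \<Longrightarrow> h < \<delta> \<Longrightarrow> norm (integral {x..x + h} ?g /\<^sub>R h - g x) < e"
        by blast
      obtain n0 where "\<And>n. n \<ge> n0 \<Longrightarrow> d n < \<delta>"
        using order_tendstoD(2)[OF d(2) \<delta>(1)] by (auto simp: eventually_sequentially)
      then show "\<exists>n0. \<forall>n\<ge>n0. norm (integral {x..x + d n} ?g /\<^sub>R d n - g x) < e"
        using d \<delta> by blast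
    qed
  qed
qed

lemma AE_nonneg_of_interval_integrals:
  fixes f :: "real \<Rightarrow> real"
  assumes f: "f absolutely_integrable_on {a..b}"
    and I: "\<And>s t. a \<le> s \<Longrightarrow> s \<le> t \<Longrightarrow> t \<le> b \<Longrightarrow> integral {s..t} f \<ge> 0"
  shows "AE x in lebesgue_on {a..b}. f x \<ge> 0"
proof -
  let ?g = "\<lambda>x. if x \<in> {a..b} then f x else 0"
  obtain N where N: "negligible N" "\<And>x d. x \<in> {a..b} \<Longrightarrow> x \<notin> N \<Longrightarrow> (\<And>n. d n > 0) \<Longrightarrow> d \<longlonglongrightarrow> 0 \<Longrightarrow>
       (\<lambda>n. integral {x..x + d n} ?g /\<^sub>R d n) \<longlonglongrightarrow> f x"
    using right_average_tendsto[OF f] by blast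
  show ?thesis
  proof (rule AE_lebesgue_onI[of "insert b N"])
    fix x assume x: "x \<in> {a..b}" "x \<notin> insert b N"
    define d where "d = (\<lambda>n. (b - x) * inverse (real (Suc n)))"
    have d: "d n > 0" "d n \<le> b - x" for n
    proof -
      have "0 < inverse (real (Suc n))" "inverse (real (Suc n)) \<le> 1" 
        by (auto simp: inverse_eq_divide)
      then show "d n > 0" "d n \<le> b - x" using x unfolding d_def by (auto simp: mult_le_cancel_left2)
    qed
    have "d \<longlonglongrightarrow> (b - x) * 0" unfolding d_def by (intro tendsto_intros LIMSEQ_inverse_real_of_nat)
    then have "(\<lambda>n. integral {x..x + d n} ?g /\<^sub>R d n) \<longlonglongrightarrow> f x" using N(2)[of x d] x d by auto
    moreover have "integral {x..x + d n} ?g /\<^sub>R d n \<ge> 0" for n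
    proof -
      have "integral {x..x + d n} ?g = integral {x..x + d n} f"
        using x d(2)[of n] by (intro integral_cong) auto
      also have "\<dots> \<ge> 0" using x d(2)[of n] d(1)[of n] by (intro I) auto
      finally show ?thesis using d(1)[of n] by simp
    qed
    ultimately show "0 \<le> f x" by (intro LIMSEQ_le_const) auto
  qed (use N in auto)
qed

text \<open>Averaging does not increase the \<open>L\<^sup>1\<close> norm. For a primitive \<open>D\<close> of \<open>norm g\<close>, a shift of the
  variable turns the integral of \<open>D (x + h) - D x\<close> over \<open>[a, b]\<close> into the integral of \<open>D\<close> over
  \<open>[b, b + h]\<close>, where \<open>D\<close> is constant, minus its integral over \<open>[a, a + h]\<close>.\<close>
lemma integral_norm_averages_le:
  fixes g :: "real \<Rightarrow> 'a::euclidean_space"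
  assumes g: "g absolutely_integrable_on {a..b}" and ab: "a \<le> b" and h: "h > 0"
  shows "(\<lambda>x. integral {x..x + h} (\<lambda>x. if x \<in> {a..b} then g x else 0)) absolutely_integrable_on {a..b}"
    and "integral {a..b} (\<lambda>x. norm (integral {x..x + h} (\<lambda>x. if x \<in> {a..b} then g x else 0)))
      \<le> h * integral {a..b} (\<lambda>x. norm (g x))"
proof -
  let ?g = "\<lambda>x. if x \<in> {a..b} then g x else 0"
  let ?n = "\<lambda>x. norm (?g x)"
  have gi: "?g absolutely_integrable_on UNIV" using g absolutely_integrable_restrict_UNIV by blast
  have gI: "?g integrable_on {c..d}" and nI: "?n integrable_on {c..d}" for c d
    using gi integrable_on_subcbox[of ?g UNIV c d] integrable_on_subcbox[of ?n UNIV c d]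
    by (auto simp: absolutely_integrable_on_def)
  define G where "G = (\<lambda>x. integral {a..x} ?g)"
  define D where "D = (\<lambda>x. integral {a..x} ?n)"
  have cG: "continuous_on {a..c} G" and cD: "continuous_on {a..c} D" for c
    unfolding G_def D_def by (intro indefinite_integral_continuous_1 gI nI)+
  have Gd: "integral {x..x + h} ?g = G (x + h) - G x" and Dd: "integral {x..x + h} ?n = D (x + h) - D x"
    if "a \<le> x" for x
    unfolding G_def D_def using Henstock_Kurzweil_Integration.integral_combine[of a x "x + h" ?g] Henstock_Kurzweil_Integration.integral_combine[of a x "x + h" ?n] that h gI nI
    by (auto simp: eq_diff_eq add.commute)
  have cGh: "continuous_on {a..b} (\<lambda>x. G (x + h))" and cDh: "continuous_on {a..b} (\<lambda>x. D (x + h))"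
    using h by (auto intro!: continuous_on_compose2[OF cG[of "b + h"]] continuous_on_compose2[OF cD[of "b + h"]] continuous_intros)
  have cont: "continuous_on {a..b} (\<lambda>x. G (x + h) - G x)" by (intro continuous_intros cGh cG)
  show 1: "(\<lambda>x. integral {x..x + h} ?g) absolutely_integrable_on {a..b}"
  proof (rule absolutely_integrable_spike[OF absolutely_integrable_continuous_real[OF cont] negligible_empty])
  qed (use Gd in auto)
  have Dm: "D x \<le> D y" if "x \<le> y" for x y
    unfolding D_def using that nI by (intro integral_subset_le) auto
  have "integral {a..b} (\<lambda>x. norm (integral {x..x + h} ?g)) \<le> integral {a..b} (\<lambda>x. D (x + h) - D x)"
  proof (rule integral_le)
    show "(\<lambda>x. norm (integral {x..x + h} ?g)) integrable_on {a..b}" 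
      using 1 by (simp add: absolutely_integrable_on_def)
    show "(\<lambda>x. D (x + h) - D x) integrable_on {a..b}"
      by (intro integrable_continuous_real continuous_intros cDh cD)
    fix x assume "x \<in> {a..b}"
    have "norm (integral {x..x + h} ?g) \<le> integral {x..x + h} ?n"
      by (intro integral_norm_bound_integral gI nI) auto
    then show "norm (integral {x..x + h} ?g) \<le> D (x + h) - D x"
      using Dd[of x] \<open>x \<in> {a..b}\<close> by simp
  qed
  also have "\<dots> = integral {a..b} (\<lambda>x. D (x + h)) - integral {a..b} D"
    by (intro integral_diff integrable_continuous_real cDh cD)
  also have "integral {a..b} (\<lambda>x. D (x + h)) = integral {a + h..b + h} D"
    using integral_shift_Icc_real[of a b D h] by (simp add: o_def add.commute)
  also have "\<dots> - integral {a..b} D \<le> h * integral {a..b} (\<lambda>x. norm (g x))"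
  proof -
    have iD: "D integrable_on {c..d}" if "a \<le> c" for c d
      using cD[of d] that by (auto intro!: integrable_continuous_real elim: continuous_on_subset)
    have "integral {a..a + h} D + integral {a + h..b + h} D = integral {a..b + h} D"
      using ab h by (intro Henstock_Kurzweil_Integration.integral_combine iD) auto
    moreover have "integral {a..b} D + integral {b..b + h} D = integral {a..b + h} D"
      using ab h by (intro Henstock_Kurzweil_Integration.integral_combine iD) auto
    moreover have "integral {a..a + h} D \<ge> 0"
      by (intro integral_nonneg iD order_refl) (unfold D_def, intro integral_nonneg nI norm_ge_zero)
    moreover have "integral {b..b + h} D \<le> integral {b..b + h} (\<lambda>_. integral {a..b} (\<lambda>x. norm (g x)))"
    proof (intro integral_le iD ab)
      fix x assume x: "x \<in> {b..b + h}"
      have "D x = integral {a..x} (\<lambda>x. if x \<in> {a..b} then norm (g x) else 0)"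
        unfolding D_def by (intro integral_cong) auto
      also have "\<dots> = integral {a..b} (\<lambda>x. norm (g x))"
        using x by (subst integral_restrict_Int) (auto intro!: arg_cong2[where f = integral])
      finally show "D x \<le> integral {a..b} (\<lambda>x. norm (g x))" by simp
    qed auto
    ultimately show ?thesis using h by simp
  qed
  finally show "integral {a..b} (\<lambda>x. norm (integral {x..x + h} ?g)) \<le> h * integral {a..b} (\<lambda>x. norm (g x))" .
qed

section \<open>The chain rule along absolutely continuous curves\<close>

lemma integrable_lebesgue_on_iff:
  fixes f :: "'a::euclidean_space \<Rightarrow> 'b::euclidean_space"
  assumes "S \<in> sets lebesgue"
  shows "integrable (lebesgue_on S) f \<longleftrightarrow> f absolutely_integrable_on S"
  using assms by (simp add: integrable_restrict_space set_integrable_def)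

text \<open>Almost everywhere convergence together with the bound on the norms gives convergence in \<open>L\<^sup>1\<close>,
  by Scheffe's lemma.\<close>
lemma right_averages_tendsto_L1:
  fixes g :: "real \<Rightarrow> 'a::euclidean_space" and a b :: real
  defines "F \<equiv> \<lambda>h x. integral {x..x + h} (\<lambda>x. if x \<in> {a..b} then g x else 0) /\<^sub>R h"
  assumes g: "integrable (lebesgue_on {a..b}) g" and ab: "a \<le> b" and h: "\<And>n. h n > 0" "h \<longlonglongrightarrow> 0"
  shows "\<And>n. integrable (lebesgue_on {a..b}) (F (h n))"
    and "\<And>n. (\<integral>x. norm (F (h n) x) \<partial>lebesgue_on {a..b}) \<le> (\<integral>x. norm (g x) \<partial>lebesgue_on {a..b})"
    and "(\<lambda>n. \<integral>x. norm (F (h n) x - g x) \<partial>lebesgue_on {a..b}) \<longlonglongrightarrow> 0"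
proof -
  let ?g = "\<lambda>x. if x \<in> {a..b} then g x else 0"
  have ga: "g absolutely_integrable_on {a..b}" using g by (simp add: integrable_lebesgue_on_iff)
  note av = integral_norm_averages_le[OF ga ab h(1)]
  show Fi: "integrable (lebesgue_on {a..b}) (F (h n))" for n
    using av(1)[of n] unfolding F_def by (intro integrable_scaleR_right) (simp add: integrable_lebesgue_on_iff)
  show Fn: "(\<integral>x. norm (F (h n) x) \<partial>lebesgue_on {a..b}) \<le> (\<integral>x. norm (g x) \<partial>lebesgue_on {a..b})" for n
  proof -
    have "(\<integral>x. norm (F (h n) x) \<partial>lebesgue_on {a..b}) = (\<integral>x. norm (integral {x..x + h n} ?g) \<partial>lebesgue_on {a..b}) / h n"
      unfolding F_def using h(1)[of n] by (simp add: divide_inverse mult.commute)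
    also have "(\<integral>x. norm (integral {x..x + h n} ?g) \<partial>lebesgue_on {a..b}) = integral {a..b} (\<lambda>x. norm (integral {x..x + h n} ?g))"
      using av(1)[of n] by (intro lebesgue_integral_eq_integral) (auto simp: integrable_lebesgue_on_iff[symmetric])
    also have "\<dots> / h n \<le> integral {a..b} (\<lambda>x. norm (g x))"
      using av(2)[of n] h(1)[of n] by (simp add: pos_divide_le_eq mult.commute)
    also have "\<dots> = (\<integral>x. norm (g x) \<partial>lebesgue_on {a..b})"
      using g by (intro lebesgue_integral_eq_integral[symmetric]) auto
    finally show ?thesis .
  qed
  have AE: "AE x in lebesgue_on {a..b}. (\<lambda>n. F (h n) x) \<longlonglongrightarrow> g x"
  proof -
    obtain N where N: "negligible N" "\<And>x d. x \<in> {a..b} \<Longrightarrow> x \<notin> N \<Longrightarrow> (\<And>n. d n > 0) \<Longrightarrow> d \<longlonglongrightarrow> 0 \<Longrightarrow>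
       (\<lambda>n. integral {x..x + d n} ?g /\<^sub>R d n) \<longlonglongrightarrow> g x"
      using right_average_tendsto[OF ga] by blast
    show ?thesis unfolding F_def by (rule AE_lebesgue_onI[OF N(1)]) (use N(2) h in auto)
  qed
  have "(\<lambda>n. \<integral>\<^sup>+x. norm (F (h n) x - g x) \<partial>lebesgue_on {a..b}) \<longlonglongrightarrow> 0"
  proof (rule Scheffe_lemma2[OF _ g AE])
    show "(\<integral>\<^sup>+ x. ennreal (norm (F (h n) x)) \<partial>lebesgue_on {a..b}) \<le> (\<integral>\<^sup>+ x. ennreal (norm (g x)) \<partial>lebesgue_on {a..b})" for n
      using Fn[of n] Fi[of n] g by (simp add: nn_integral_eq_integral)
  qed (use Fi in auto)
  moreover have "(\<integral>\<^sup>+x. norm (F (h n) x - g x) \<partial>lebesgue_on {a..b}) = ennreal (\<integral>x. norm (F (h n) x - g x) \<partial>lebesgue_on {a..b})" for n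
    using Fi[of n] g by (intro nn_integral_eq_integral) auto
  ultimately show "(\<lambda>n. \<integral>x. norm (F (h n) x - g x) \<partial>lebesgue_on {a..b}) \<longlonglongrightarrow> 0"
    by (simp add: tendsto_ennreal_iff[of _ _ 0, simplified] del: ennreal_0 flip: ennreal_0)
qed

lemma bounded_inner_integrable:
  fixes \<zeta> g :: "'x \<Rightarrow> 'a::euclidean_space"
  assumes "integrable M g" "\<zeta> \<in> borel_measurable M" "AE t in M. norm (\<zeta> t) \<le> C"
  shows "integrable M (\<lambda>t. \<zeta> t \<bullet> g t)"
    and "\<bar>\<integral>t. \<zeta> t \<bullet> g t \<partial>M\<bar> \<le> C * (\<integral>t. norm (g t) \<partial>M)"
proof -
  have [measurable]: "g \<in> borel_measurable M" using assms by auto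
  note [measurable] = assms(2)
  have b: "AE t in M. norm (\<zeta> t \<bullet> g t) \<le> norm (C * norm (g t))"
    using assms(3)
  proof eventually_elim
    fix t assume "norm (\<zeta> t) \<le> C"
    have "\<bar>\<zeta> t \<bullet> g t\<bar> \<le> norm (\<zeta> t) * norm (g t)" by (rule Cauchy_Schwarz_ineq2)
    also have "\<dots> \<le> C * norm (g t)" using \<open>norm (\<zeta> t) \<le> C\<close> by (intro mult_right_mono) auto
    finally show "norm (\<zeta> t \<bullet> g t) \<le> norm (C * norm (g t))" by simp
  qed
  show i: "integrable M (\<lambda>t. \<zeta> t \<bullet> g t)"
    by (rule Bochner_Integration.integrable_bound[OF _ _ b]) (use assms in auto)
  have "\<bar>\<integral>t. \<zeta> t \<bullet> g t \<partial>M\<bar> \<le> (\<integral>t. \<bar>\<zeta> t \<bullet> g t\<bar> \<partial>M)" using integral_norm_bound[of M "\<lambda>t. \<zeta> t \<bullet> g t"] by simp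
  also have "\<dots> \<le> (\<integral>t. C * norm (g t) \<partial>M)"
  proof (rule integral_mono_AE)
    show "AE t in M. \<bar>\<zeta> t \<bullet> g t\<bar> \<le> C * norm (g t)"
      using assms(3)
    proof eventually_elim
      fix t assume "norm (\<zeta> t) \<le> C"
      have "\<bar>\<zeta> t \<bullet> g t\<bar> \<le> norm (\<zeta> t) * norm (g t)" by (rule Cauchy_Schwarz_ineq2)
      also have "\<dots> \<le> C * norm (g t)" using \<open>norm (\<zeta> t) \<le> C\<close> by (intro mult_right_mono) auto
      finally show "\<bar>\<zeta> t \<bullet> g t\<bar> \<le> C * norm (g t)" .
    qed
  qed (use i assms in auto)
  finally show "\<bar>\<integral>t. \<zeta> t \<bullet> g t \<partial>M\<bar> \<le> C * (\<integral>t. norm (g t) \<partial>M)" by simp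
qed

text \<open>No pointwise differentiability of \<open>u\<close> or of \<open>\<Phi> \<circ> u\<close> is used. Insert \<open>z = u (t + h)\<close> into the
  semiconvexity inequality, divide by \<open>h\<close> and integrate over \<open>[a, b]\<close>. The difference quotients of \<open>u\<close> are
  averages of \<open>g\<close> and converge to \<open>g\<close> in \<open>L\<^sup>1\<close>, those of \<open>\<Phi> \<circ> u\<close> integrate to boundary averages, and
  the quadratic error is the modulus of continuity of \<open>u\<close> times a bounded quantity.\<close>
lemma chain_rule_ge:
  fixes u g \<zeta> :: "real \<Rightarrow> 'a::euclidean_space" and \<Phi> :: "'a \<Rightarrow> real"
  assumes ab: "a \<le> b" and g: "integrable (lebesgue_on {a..b}) g"
    and u: "\<And>x. x \<in> {a..b} \<Longrightarrow> u x = u a + integral {a..x} g"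
    and \<Phi>: "continuous_on UNIV \<Phi>"
    and \<zeta>: "\<zeta> \<in> borel_measurable (lebesgue_on {a..b})" "AE t in lebesgue_on {a..b}. norm (\<zeta> t) \<le> C"
    and K: "K \<ge> 0"
    and sub: "AE t in lebesgue_on {a..b}. \<forall>z. \<zeta> t \<bullet> (z - u t) - K * (norm (z - u t))\<^sup>2 \<le> \<Phi> z - \<Phi> (u t)"
  shows "(\<integral>t. \<zeta> t \<bullet> g t \<partial>lebesgue_on {a..b}) \<le> \<Phi> (u b) - \<Phi> (u a)"
proof -
  let ?M = "lebesgue_on {a..b}"
  let ?g = "\<lambda>x. if x \<in> {a..b} then g x else 0"
  define h where "h = (\<lambda>n. inverse (real (Suc n)))"
  have h: "h n > 0" "h n \<le> 1" for n by (auto simp: h_def inverse_eq_divide)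
  have h0: "h \<longlonglongrightarrow> 0" unfolding h_def by (rule LIMSEQ_inverse_real_of_nat)
  define F where "F = (\<lambda>n x. integral {x..x + h n} ?g /\<^sub>R h n)"
  have L1: "\<And>n. integrable ?M (F n)" "\<And>n. (\<integral>x. norm (F n x) \<partial>?M) \<le> (\<integral>x. norm (g x) \<partial>?M)"
    "(\<lambda>n. \<integral>x. norm (F n x - g x) \<partial>?M) \<longlonglongrightarrow> 0"
    unfolding F_def by (rule right_averages_tendsto_L1[OF g ab h(1) h0])+
  have ga: "g absolutely_integrable_on {a..b}" using g by (simp add: integrable_lebesgue_on_iff)
  have gI: "?g integrable_on {c..d}" for c d
    using ga absolutely_integrable_restrict_UNIV[of "{a..b}" g] integrable_on_subcbox[of ?g UNIV c d]
    by (auto simp: absolutely_integrable_on_def)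
  \<comment> \<open>\<open>u\<close>, continued to the right of \<open>b\<close> by its last value\<close>
  define U where "U = (\<lambda>x. u a + integral {a..x} ?g)"
  have Uu: "U x = u x" if "x \<in> {a..b}" for x
  proof -
    have "integral {a..x} ?g = integral {a..x} g" using that by (intro integral_cong) auto
    then show ?thesis using u[OF that] by (simp add: U_def)
  qed
  have Ub: "U x = u b" if "x \<ge> b" for x
  proof -
    have "integral {a..x} ?g = integral {a..b} g"
      using that by (subst integral_restrict_Int) (auto intro!: arg_cong2[where f = integral])
    then show ?thesis using u[of b] ab by (simp add: U_def)
  qed
  have cU: "continuous_on {a..c} U" for c
    unfolding U_def by (intro continuous_intros indefinite_integral_continuous_1 gI)
  have UF: "U (t + h n) - U t = h n *\<^sub>R F n t" if "t \<in> {a..b}" for t n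
    using Henstock_Kurzweil_Integration.integral_combine[of a t "t + h n" ?g] h(1)[of n] that gI
    by (auto simp: U_def F_def algebra_simps)
  define V where "V = (\<lambda>t. \<Phi> (U t))"
  have cV: "continuous_on {a..c} V" for c
    unfolding V_def by (rule continuous_on_compose2[OF \<Phi> cU]) auto
  have iV: "V integrable_on {c..d}" if "a \<le> c" for c d
    using cV[of d] that by (auto intro!: integrable_continuous_real elim: continuous_on_subset)
  have cUh: "continuous_on {a..b} (\<lambda>t. U (t + h n))" and cVh: "continuous_on {a..b} (\<lambda>t. V (t + h n))" for n
    using h(1)[of n] by (auto intro!: continuous_on_compose2[OF cU[of "b + h n"]] continuous_on_compose2[OF cV[of "b + h n"]] continuous_intros)
  have contint: "integrable ?M f" if "continuous_on {a..b} f" for f :: "real \<Rightarrow> real"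
    using absolutely_integrable_continuous_real[OF that] by (simp add: integrable_lebesgue_on_iff)
  define R where "R = (\<lambda>n. \<integral>t. K * norm (U (t + h n) - U t) * norm (F n t) \<partial>?M)"
  define B where "B = (\<lambda>n. \<integral>t. (V (t + h n) - V t) / h n \<partial>?M)"
  have [measurable]: "F n \<in> borel_measurable ?M" for n using L1(1)[of n] by auto
  have mU: "(\<lambda>t. U (t + h n) - U t) \<in> borel_measurable ?M" for n
    by (intro continuous_imp_measurable_on_sets_lebesgue continuous_intros cUh cU) auto
  have iB: "integrable ?M (\<lambda>t. (V (t + h n) - V t) / h n)" for n
    using h(1)[of n] by (intro contint continuous_intros cVh cV) auto
  have Reps: "\<exists>n0. \<forall>n\<ge>n0. (\<forall>t\<in>{a..b}. norm (U (t + h n) - U t) \<le> e)" if "e > 0" for e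
  proof -
    have "uniformly_continuous_on {a..b + 1} U" using cU by (intro compact_uniformly_continuous) auto
    then have "\<exists>d>0. \<forall>y\<in>{a..b+1}. \<forall>x\<in>{a..b+1}. dist x y < d \<longrightarrow> dist (U x) (U y) < e"
      using that unfolding uniformly_continuous_on_def by simp
    then obtain d where d: "d > 0" "\<And>x y. x \<in> {a..b+1} \<Longrightarrow> y \<in> {a..b+1} \<Longrightarrow> dist x y < d \<Longrightarrow> dist (U x) (U y) < e"
      by auto
    obtain n0 where n0: "\<And>n. n \<ge> n0 \<Longrightarrow> h n < d"
      using order_tendstoD(2)[OF h0 d(1)] by (auto simp: eventually_sequentially)
    show ?thesis
    proof (intro exI[of _ n0] allI impI ballI)
      fix n t assume "n \<ge> n0" "t \<in> {a..b}"
      then have "dist (U (t + h n)) (U t) < e" using h[of n] n0[of n] by (intro d(2)) (auto simp: dist_norm)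
      then show "norm (U (t + h n) - U t) \<le> e" by (simp add: dist_norm)
    qed
  qed
  have bU: "\<exists>D. \<forall>t\<in>{a..b}. norm (U (t + h n) - U t) \<le> D" for n
  proof -
    have "compact ((\<lambda>t. U (t + h n) - U t) ` {a..b})"
      by (intro compact_continuous_image continuous_intros cUh cU) auto
    then show ?thesis using compact_imp_bounded bounded_iff by (metis (no_types, lifting) imageI)
  qed
  have iR: "integrable ?M (\<lambda>t. K * norm (U (t + h n) - U t) * norm (F n t))" for n
  proof -
    obtain D where D: "\<And>t. t \<in> {a..b} \<Longrightarrow> norm (U (t + h n) - U t) \<le> D" using bU by blast
    have D0: "D \<ge> 0" using D[of a] ab by (auto intro: order_trans[OF norm_ge_zero])
    show ?thesis
    proof (rule Bochner_Integration.integrable_bound[of _ "\<lambda>t. K * D * norm (F n t)"])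
      show "(\<lambda>t. K * norm (U (t + h n) - U t) * norm (F n t)) \<in> borel_measurable ?M"
        using mU[of n] by measurable
      have "K * norm (U (t + h n) - U t) * norm (F n t) \<le> K * D * norm (F n t)" if "t \<in> {a..b}" for t
        using D[OF that] K by (intro mult_right_mono mult_left_mono) auto
      then show "AE t in ?M. norm (K * norm (U (t + h n) - U t) * norm (F n t)) \<le> norm (K * D * norm (F n t))"
        using K D0 by (intro AE_I2) (simp add: abs_mult)
    qed (use L1(1)[of n] in auto)
  qed
  have "R \<longlonglongrightarrow> 0"
  proof (rule LIMSEQ_I)
    fix e :: real assume e: "e > 0"
    define G where "G = (\<integral>x. norm (g x) \<partial>?M)"
    have G: "G \<ge> 0" by (simp add: G_def)
    define e' where "e' = e / (2 * (K * G + 1))"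
    have KG: "K * G + 1 > 0" using mult_nonneg_nonneg[OF K G] by linarith
    have e': "e' > 0" unfolding e'_def using e KG by (intro divide_pos_pos mult_pos_pos) auto
    have gen: "c * (e / (2 * c)) = e / 2" if "c > 0" for c :: real using that by simp
    have Ke: "K * e' * G < e"
    proof -
      have "K * e' * G \<le> (K * G + 1) * e'" using e' by (simp add: algebra_simps)
      also have "\<dots> = e / 2" unfolding e'_def by (rule gen[OF KG])
      finally show ?thesis using e by simp
    qed
    obtain n0 where n0: "\<And>n t. n \<ge> n0 \<Longrightarrow> t \<in> {a..b} \<Longrightarrow> norm (U (t + h n) - U t) \<le> e'" using Reps[OF e'] by blast
    show "\<exists>n0. \<forall>n\<ge>n0. norm (R n - 0) < e"
    proof (intro exI[of _ n0] allI impI)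
      fix n assume n: "n \<ge> n0"
      have "R n \<le> (\<integral>t. K * e' * norm (F n t) \<partial>?M)" unfolding R_def
        using L1(1)[of n] K n0[OF n] iR[of n] by (intro integral_mono) (auto intro!: mult_right_mono mult_left_mono)
      also have "\<dots> \<le> K * e' * G" using L1(2)[of n] K e' by (auto simp: G_def intro!: mult_left_mono)
      finally have "R n < e" using Ke by simp
      moreover have "R n \<ge> 0" unfolding R_def using K by (intro Bochner_Integration.integral_nonneg) auto
      ultimately show "norm (R n - 0) < e" by simp
    qed
  qed
  have "B \<longlonglongrightarrow> \<Phi> (u b) - \<Phi> (u a)"
  proof -
    have Beq: "B n = \<Phi> (u b) - (integral {a..a + h n} V - integral {a..a} V) / (a + h n - a)" for n
    proof -
      have "B n = integral {a..b} (\<lambda>t. (V (t + h n) - V t) / h n)"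
        unfolding B_def using iB[of n] by (intro lebesgue_integral_eq_integral) auto
      also have "\<dots> = (integral {a..b} (\<lambda>t. V (t + h n)) - integral {a..b} V) / h n"
        using iV[of a b] integrable_continuous_real[OF cVh[of n]] by (simp add: Henstock_Kurzweil_Integration.integral_diff)
      also have "integral {a..b} (\<lambda>t. V (t + h n)) = integral {a + h n..b + h n} V"
        using integral_shift_Icc_real[of a b V "h n"] by (simp add: o_def add.commute)
      also have "integral {a + h n..b + h n} V - integral {a..b} V = integral {b..b + h n} V - integral {a..a + h n} V"
        using Henstock_Kurzweil_Integration.integral_combine[of a "a + h n" "b + h n" V]
          Henstock_Kurzweil_Integration.integral_combine[of a b "b + h n" V] ab h(1)[of n] iV[of a] by simp
      also have "integral {b..b + h n} V = integral {b..b + h n} (\<lambda>_. \<Phi> (u b))"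
        using Ub by (intro integral_cong) (auto simp: V_def)
      also have "\<dots> = h n * \<Phi> (u b)" using h(1)[of n] by simp
      finally show ?thesis using h(1)[of n] by (simp add: diff_divide_distrib)
    qed
    have "((\<lambda>x. integral {a..x} V) has_real_derivative V a) (at a within {a..b + 1})"
      using cV[of "b + 1"] ab by (intro integral_has_real_derivative) auto
    then have "((\<lambda>y. (integral {a..y} V - integral {a..a} V) / (y - a)) \<longlongrightarrow> V a) (at a within {a..b + 1})"
      by (simp add: has_field_derivative_iff)
    note T = this[unfolded tendsto_at_iff_sequentially, rule_format]
    have aa: "(\<lambda>n. a + h n) \<longlonglongrightarrow> a" using tendsto_add[OF tendsto_const[of a] h0] by simp
    have bb: "a + h n \<in> {a..b + 1} - {a}" for n using h[of n] ab by auto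
    have "((\<lambda>y. (integral {a..y} V - integral {a..a} V) / (y - a)) \<circ> (\<lambda>n. a + h n)) \<longlonglongrightarrow> V a"
      by (rule T[OF bb aa])
    then have "(\<lambda>n. \<Phi> (u b) - (integral {a..a + h n} V - integral {a..a} V) / (a + h n - a)) \<longlonglongrightarrow> \<Phi> (u b) - V a"
      by (intro tendsto_intros) (simp add: o_def)
    moreover have "B = (\<lambda>n. \<Phi> (u b) - (integral {a..a + h n} V - integral {a..a} V) / (a + h n - a))"
      by (intro ext Beq)
    moreover have "V a = \<Phi> (u a)" using Uu[of a] ab by (simp add: V_def)
    ultimately show ?thesis by simp
  qed
  moreover have "(\<lambda>n. \<integral>t. \<zeta> t \<bullet> F n t \<partial>?M) \<longlonglongrightarrow> (\<integral>t. \<zeta> t \<bullet> g t \<partial>?M)"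
  proof (rule LIM_zero_cancel, rule Lim_null_comparison)
    show "(\<lambda>n. C * (\<integral>x. norm (F n x - g x) \<partial>?M)) \<longlonglongrightarrow> 0" using L1(3) tendsto_mult_right_zero by blast
    show "\<forall>\<^sub>F n in sequentially. norm ((\<integral>t. \<zeta> t \<bullet> F n t \<partial>?M) - (\<integral>t. \<zeta> t \<bullet> g t \<partial>?M)) \<le> C * (\<integral>x. norm (F n x - g x) \<partial>?M)"
    proof (rule always_eventually, rule allI)
      fix n
      have "(\<integral>t. \<zeta> t \<bullet> F n t \<partial>?M) - (\<integral>t. \<zeta> t \<bullet> g t \<partial>?M) = (\<integral>t. \<zeta> t \<bullet> (F n t - g t) \<partial>?M)"
        using bounded_inner_integrable(1)[OF L1(1)[of n] \<zeta>] bounded_inner_integrable(1)[OF g \<zeta>]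
        by (simp add: inner_diff_right)
      then show "norm ((\<integral>t. \<zeta> t \<bullet> F n t \<partial>?M) - (\<integral>t. \<zeta> t \<bullet> g t \<partial>?M)) \<le> C * (\<integral>x. norm (F n x - g x) \<partial>?M)"
        using bounded_inner_integrable(2)[OF _ \<zeta>, of "\<lambda>t. F n t - g t"] L1(1)[of n] g by simp
    qed
  qed
  moreover have "(\<integral>t. \<zeta> t \<bullet> F n t \<partial>?M) \<le> B n + R n" for n
  proof -
    have "(\<integral>t. \<zeta> t \<bullet> F n t \<partial>?M) \<le> (\<integral>t. (V (t + h n) - V t) / h n + K * norm (U (t + h n) - U t) * norm (F n t) \<partial>?M)"
    proof (rule integral_mono_AE)
      have "AE t in ?M. t \<in> {a..b}" by (intro AE_I2) simp
      with sub show "AE t in ?M. \<zeta> t \<bullet> F n t \<le> (V (t + h n) - V t) / h n + K * norm (U (t + h n) - U t) * norm (F n t)"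
      proof eventually_elim
        fix t assume s: "\<forall>z. \<zeta> t \<bullet> (z - u t) - K * (norm (z - u t))\<^sup>2 \<le> \<Phi> z - \<Phi> (u t)" and t: "t \<in> {a..b}"
        have e: "U (t + h n) - u t = h n *\<^sub>R F n t" using UF[OF t, of n] Uu[OF t] by simp
        have "\<zeta> t \<bullet> (U (t + h n) - u t) - K * (norm (U (t + h n) - u t))\<^sup>2 \<le> V (t + h n) - V t"
          using s[rule_format, of "U (t + h n)"] Uu[OF t] by (simp add: V_def)
        then have "h n * (\<zeta> t \<bullet> F n t) \<le> V (t + h n) - V t + K * (h n * (norm (h n *\<^sub>R F n t) * norm (F n t)))"
          using h(1)[of n] unfolding e by (simp add: power2_eq_square algebra_simps)
        then show "\<zeta> t \<bullet> F n t \<le> (V (t + h n) - V t) / h n + K * norm (U (t + h n) - U t) * norm (F n t)"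
          unfolding UF[OF t] using h(1)[of n] by (simp add: field_simps)
      qed
    qed (use iB[of n] iR[of n] bounded_inner_integrable(1)[OF L1(1)[of n] \<zeta>] in auto)
    also have "\<dots> = B n + R n" unfolding B_def R_def using iB[of n] iR[of n] by simp
    finally show ?thesis .
  qed
  ultimately show ?thesis using \<open>R \<longlonglongrightarrow> 0\<close> 
    by (intro LIMSEQ_le[of "\<lambda>n. \<integral>t. \<zeta> t \<bullet> F n t \<partial>?M" _ "\<lambda>n. B n + R n"]) (auto intro: tendsto_eq_intros)
qed

text \<open>Equality follows by applying the inequality also to the curve \<open>t \<mapsto> u (- t)\<close>.\<close>
lemma chain_rule:
  fixes u g \<zeta> :: "real \<Rightarrow> 'a::euclidean_space" and \<Phi> :: "'a \<Rightarrow> real"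
  assumes ab: "a \<le> b" and g: "integrable (lebesgue_on {a..b}) g"
    and u: "\<And>x. x \<in> {a..b} \<Longrightarrow> u x = u a + integral {a..x} g"
    and \<Phi>: "continuous_on UNIV \<Phi>"
    and \<zeta>: "\<zeta> \<in> borel_measurable (lebesgue_on {a..b})" "AE t in lebesgue_on {a..b}. norm (\<zeta> t) \<le> C"
    and K: "K \<ge> 0"
    and sub: "AE t in lebesgue_on {a..b}. \<forall>z. \<zeta> t \<bullet> (z - u t) - K * (norm (z - u t))\<^sup>2 \<le> \<Phi> z - \<Phi> (u t)"
  shows "(\<integral>t. \<zeta> t \<bullet> g t \<partial>lebesgue_on {a..b}) = \<Phi> (u b) - \<Phi> (u a)"
proof (rule antisym)
  show "(\<integral>t. \<zeta> t \<bullet> g t \<partial>lebesgue_on {a..b}) \<le> \<Phi> (u b) - \<Phi> (u a)"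
    by (rule chain_rule_ge[OF assms])
  have gI: "g integrable_on {a..b}" using g by (simp add: integrable_lebesgue_on_iff absolutely_integrable_on_def)
  have refl: "AE t in lebesgue_on {-b..-a}. P (- t)" if P: "AE t in lebesgue_on {a..b}. P t" for P
  proof -
    obtain N where N: "negligible N" "\<And>t. t \<in> {a..b} \<Longrightarrow> t \<notin> N \<Longrightarrow> P t" using AE_lebesgue_onE[OF P] by auto
    have "negligible (uminus ` N)"
      using N(1) by (intro negligible_differentiable_image_negligible) (auto intro!: differentiable_on_minus differentiable_on_ident)
    then show ?thesis
    proof (rule AE_lebesgue_onI)
      fix t assume "t \<in> {-b..-a}" "t \<notin> uminus ` N"
      then show "P (- t)" using N(2)[of "- t"] by (force simp: image_iff)
    qed simp
  qed
  have fin: "integrable (lebesgue_on {a..b}) \<zeta>"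
    by (rule Bochner_Integration.integrable_bound[of _ "\<lambda>_. C"])
       (use \<zeta> in \<open>auto elim!: eventually_mono simp: integrable_lebesgue_on_iff absolutely_integrable_on_const intro: order_trans[OF _ abs_ge_self]\<close>)
  have r\<zeta>: "integrable (lebesgue_on {-b..-a}) (\<lambda>t. \<zeta> (- t))" using fin by (simp only: integrable_reflect_real)
  moreover have "integrable (lebesgue_on {-b..-a}) (\<lambda>t. g (- t))" using g by (simp only: integrable_reflect_real)
  ultimately have "(\<integral>t. \<zeta> (- t) \<bullet> (- g (- t)) \<partial>lebesgue_on {-b..-a}) \<le> \<Phi> (u (- (- a))) - \<Phi> (u (- (- b)))"
  proof (intro chain_rule_ge[OF _ _ _ \<Phi> _ _ K])
    fix x assume x: "x \<in> {-b..-a}"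
    have "integral {-b..x} (\<lambda>t. - g (- t)) = - integral {-b..x} (\<lambda>t. g (- t))" by simp
    also have "integral {-b..x} (\<lambda>t. g (- t)) = integral {- x..b} g"
      using Henstock_Kurzweil_Integration.integral_reflect_real[of b "- x" g] by simp
    finally show "u (- x) = u (- (- b)) + integral {-b..x} (\<lambda>t. - g (- t))"
      using Henstock_Kurzweil_Integration.integral_combine[of a "- x" b g] gI x u[of "- x"] u[of b] by (auto simp: eq_diff_eq)
  next
    show "AE t in lebesgue_on {-b..-a}. norm (\<zeta> (- t)) \<le> C" by (rule refl[OF \<zeta>(2)])
    show "AE t in lebesgue_on {-b..-a}. \<forall>z. \<zeta> (- t) \<bullet> (z - u (- t)) - K * (norm (z - u (- t)))\<^sup>2 \<le> \<Phi> z - \<Phi> (u (- t))"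
      by (rule refl[OF sub])
  qed (use ab borel_measurable_integrable[OF r\<zeta>] in auto)
  also have "(\<integral>t. \<zeta> (- t) \<bullet> (- g (- t)) \<partial>lebesgue_on {-b..-a}) = - (\<integral>t. \<zeta> t \<bullet> g t \<partial>lebesgue_on {a..b})"
    using Equivalence_Lebesgue_Henstock_Integration.integral_reflect_real[of b a "\<lambda>t. \<zeta> t \<bullet> g t"] by simp
  finally show "\<Phi> (u b) - \<Phi> (u a) \<le> (\<integral>t. \<zeta> t \<bullet> g t \<partial>lebesgue_on {a..b})" by simp
qed

section \<open>Smooth bump functions\<close>

text \<open>The functions \<open>P(1/x) exp(-1/x)\<close>, extended by \<open>0\<close> to \<open>x \<le> 0\<close>; the family is closed under
  differentiation.\<close>
definition flat :: "real poly \<Rightarrow> real \<Rightarrow> real" where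
  "flat P x = (if x > 0 then poly P (1 / x) * exp (- (1 / x)) else 0)"

lemma poly_times_exp_minus_tendsto_0: "((\<lambda>y. poly P y * exp (- y)) \<longlongrightarrow> 0) at_top" for P :: "real poly"
proof -
  have "((\<lambda>y. \<Sum>i\<le>degree P. coeff P i * (y ^ i / exp y)) \<longlongrightarrow> (\<Sum>i\<le>degree P. coeff P i * 0)) at_top"
    by (intro tendsto_intros tendsto_power_div_exp_0)
  then show ?thesis by (simp add: poly_altdef exp_minus sum_distrib_right divide_inverse mult.assoc)
qed

lemma flat_at_right_0: "(flat P \<longlongrightarrow> 0) (at_right 0)"
proof -
  have "((\<lambda>x. poly P (inverse x) * exp (- inverse x)) \<longlongrightarrow> 0) (at_right 0)"
    by (rule filterlim_compose[OF poly_times_exp_minus_tendsto_0 filterlim_inverse_at_top_right])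
  then show ?thesis
    by (rule Lim_transform_eventually)
       (auto simp: eventually_at_right_field flat_def inverse_eq_divide intro!: exI[of _ 1])
qed

lemma flat_deriv:
  "(flat P has_real_derivative flat (pCons 0 (pCons 0 (P - pderiv P))) x) (at x)"
proof -
  let ?Q = "pCons 0 (pCons 0 (P - pderiv P))"
  consider "x > 0" | "x < 0" | "x = 0" by linarith
  then show ?thesis
  proof cases
    case 1
    have "((\<lambda>x. poly P (1 / x) * exp (- (1 / x))) has_real_derivative flat ?Q x) (at x)"
      using 1 by (auto intro!: derivative_eq_intros simp: flat_def power2_eq_square field_simps)
    then show ?thesis
      by (rule has_field_derivative_transform_within_open[where S = "{0<..}"]) (use 1 in \<open>auto simp: flat_def\<close>)
  next
    case 2
    have "((\<lambda>x. 0) has_real_derivative flat ?Q x) (at x)" using 2 by (simp add: flat_def)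
    then show ?thesis
      by (rule has_field_derivative_transform_within_open[where S = "{..<0}"]) (use 2 in \<open>auto simp: flat_def\<close>)
  next
    case 3
    have "((\<lambda>y. flat P y / y) \<longlongrightarrow> 0) (at 0)"
      unfolding filterlim_split_at
    proof (rule filterlim_split_at)
      show "((\<lambda>y. flat P y / y) \<longlongrightarrow> 0) (at_left 0)"
        by (rule Lim_transform_eventually[OF tendsto_const])
           (auto simp: eventually_at_left_field flat_def intro!: exI[of _ "-1"])
      show "((\<lambda>y. flat P y / y) \<longlongrightarrow> 0) (at_right 0)"
        by (rule Lim_transform_eventually[OF flat_at_right_0[of "pCons 0 P"]])
           (auto simp: eventually_at_right_field flat_def intro!: exI[of _ 1])
    qed
    then show ?thesis using 3 by (simp add: has_field_derivative_iff flat_def)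
  qed
qed

text \<open>Sums of products of two such functions, vanishing to the left of \<open>a\<close> and to the right of \<open>b\<close>;
  closed under differentiation again.\<close>
inductive_set bumps :: "real \<Rightarrow> real \<Rightarrow> (real \<Rightarrow> real) set" for a b where
  prod: "(\<lambda>x. c * (flat P (x - a) * flat Q (b - x))) \<in> bumps a b"
| add: "f \<in> bumps a b \<Longrightarrow> g \<in> bumps a b \<Longrightarrow> (\<lambda>x. f x + g x) \<in> bumps a b"

lemma bumps_deriv:
  assumes "f \<in> bumps a b"
  shows "\<exists>f'\<in>bumps a b. \<forall>x. (f has_real_derivative f' x) (at x)"
  using assms
proof induction
  case (prod c P Q)
  let ?D = "\<lambda>P. pCons 0 (pCons 0 (P - pderiv P)) :: real poly"
  let ?f' = "\<lambda>x. c * (flat (?D P) (x - a) * flat Q (b - x)) + (- c) * (flat P (x - a) * flat (?D Q) (b - x))"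
  have "((\<lambda>x. c * (flat P (x - a) * flat Q (b - x))) has_real_derivative ?f' x) (at x)" for x
    by (auto intro!: derivative_eq_intros DERIV_chain2[OF flat_deriv] simp: algebra_simps)
  then show ?case by (intro bexI[of _ ?f'] bumps.intros allI)
next
  case (add f g)
  then obtain f' g' where "f' \<in> bumps a b" "g' \<in> bumps a b"
    "\<And>x. (f has_real_derivative f' x) (at x)" "\<And>x. (g has_real_derivative g' x) (at x)" by blast
  then show ?case by (intro bexI[of _ "\<lambda>x. f' x + g' x"] bumps.intros allI DERIV_add) auto
qed

text \<open>Smoothness as it occurs in \<^const>\<open>test_fun\<close>.\<close>
definition smooth :: "(real \<Rightarrow> real) \<Rightarrow> bool" where
  "smooth f \<longleftrightarrow> (\<forall>k. (deriv ^^ k) f differentiable_on UNIV)"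

lemma smooth_of_derivative:
  assumes "\<And>x. (f has_real_derivative f' x) (at x)" "smooth f'"
  shows "smooth f" "deriv f = f'"
proof -
  show d: "deriv f = f'" using assms(1) by (intro ext DERIV_imp_deriv)
  show "smooth f" unfolding smooth_def
  proof
    fix k
    show "(deriv ^^ k) f differentiable_on UNIV"
    proof (cases k)
      case 0
      then show ?thesis using assms(1) 
        by (auto simp: differentiable_on_def real_differentiable_def intro: differentiable_at_withinI)
    next
      case (Suc j)
      then show ?thesis using assms(2) d by (simp add: smooth_def funpow_Suc_right del: funpow.simps)
    qed
  qed
qed

lemma smooth_coinduct:
  assumes "f \<in> W" "\<And>f. f \<in> W \<Longrightarrow> \<exists>f'\<in>W. \<forall>x. (f has_real_derivative f' x) (at x)"
  shows "smooth f"
proof -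
  have "(deriv ^^ k) f \<in> W" for k
  proof (induction k)
    case (Suc k)
    obtain f' where f': "f' \<in> W" "\<And>x. ((deriv ^^ k) f has_real_derivative f' x) (at x)" using assms(2)[OF Suc] by blast
    have "deriv ((deriv ^^ k) f) = f'" using f'(2) by (intro ext DERIV_imp_deriv)
    then show ?case using f' by simp
  qed (use assms in auto)
  then show ?thesis unfolding smooth_def using assms(2)
    by (fastforce simp: differentiable_on_def real_differentiable_def intro: differentiable_at_withinI)
qed

lemma smooth_bump:
  fixes c \<delta> :: real
  assumes \<delta>: "\<delta> > 0"
  obtains b where "b \<in> bumps (c - \<delta>) (c + \<delta>)" "\<And>x. b x \<ge> 0" "\<And>x. \<bar>x - c\<bar> \<ge> \<delta> \<Longrightarrow> b x = 0"
    "continuous_on UNIV b" "\<And>A B. A \<le> c - \<delta> \<Longrightarrow> c + \<delta> \<le> B \<Longrightarrow> integral {A..B} b = 1"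
proof -
  define f where "f = (\<lambda>x. 1 * (flat 1 (x - (c - \<delta>)) * flat 1 (c + \<delta> - x)))"
  have "f \<in> bumps (c - \<delta>) (c + \<delta>)" unfolding f_def by (rule bumps.prod)
  then obtain f' where "\<And>x. (f has_real_derivative f' x) (at x)" using bumps_deriv by blast
  then have cf: "continuous_on S f" for S by (auto intro!: continuous_at_imp_continuous_on DERIV_isCont)
  have f0: "f x \<ge> 0" for x by (simp add: f_def flat_def)
  have fz: "f x = 0" if "\<bar>x - c\<bar> \<ge> \<delta>" for x using that by (auto simp: f_def flat_def)
  define I where "I = integral {c - \<delta>..c + \<delta>} f"
  have "I > 0"
  proof -
    have "I \<ge> 0" unfolding I_def using f0 by (intro integral_nonneg integrable_continuous_real cf)
    moreover have "I \<noteq> 0"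
    proof
      assume "I = 0"
      then have "f c = 0"
        using integral_eq_0_iff[of "c - \<delta>" "c + \<delta>" f] cf f0 \<delta> unfolding I_def by auto
      then show False using \<delta> by (simp add: f_def flat_def)
    qed
    ultimately show ?thesis by simp
  qed
  have IAB: "integral {A..B} f = I" if "A \<le> c - \<delta>" "c + \<delta> \<le> B" for A B
  proof -
    have "integral {c - \<delta>..c + \<delta>} f = integral {A..B} f"
      by (rule integral_spike_set) (use that fz in \<open>auto intro!: negligible_subset[OF negligible_empty]\<close>)
    then show ?thesis by (simp add: I_def)
  qed
  show ?thesis
  proof (rule that[of "\<lambda>x. (1 / I) * (flat 1 (x - (c - \<delta>)) * flat 1 (c + \<delta> - x))"])
    have eq: "(\<lambda>x. (1 / I) * (flat 1 (x - (c - \<delta>)) * flat 1 (c + \<delta> - x))) = (\<lambda>x. (1 / I) * f x)" by (simp add: f_def)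
    show "(\<lambda>x. (1 / I) * (flat 1 (x - (c - \<delta>)) * flat 1 (c + \<delta> - x))) \<in> bumps (c - \<delta>) (c + \<delta>)" by (rule bumps.prod)
    show "0 \<le> (1 / I) * (flat 1 (x - (c - \<delta>)) * flat 1 (c + \<delta> - x))" for x
      using \<open>I > 0\<close> by (simp add: flat_def)
    show "(1 / I) * (flat 1 (x - (c - \<delta>)) * flat 1 (c + \<delta> - x)) = 0" if "\<bar>x - c\<bar> \<ge> \<delta>" for x
      using fz[OF that] by (simp add: f_def)
    show "continuous_on UNIV (\<lambda>x. (1 / I) * (flat 1 (x - (c - \<delta>)) * flat 1 (c + \<delta> - x)))"
      unfolding eq by (intro continuous_intros cf)
    show "integral {A..B} (\<lambda>x. (1 / I) * (flat 1 (x - (c - \<delta>)) * flat 1 (c + \<delta> - x))) = 1"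
      if "A \<le> c - \<delta>" "c + \<delta> \<le> B" for A B
      unfolding eq using IAB[OF that] \<open>I > 0\<close> by simp
  qed
qed

text \<open>A test function \<open>\<psi>\<close> that rises from \<open>0\<close> to \<open>1\<close> within distance \<open>\<delta>\<close> of \<open>s\<close> and falls back to \<open>0\<close>
  within distance \<open>\<delta>\<close> of \<open>t\<close>; its derivative is the difference of two mollifiers, centred at \<open>s\<close> and \<open>t\<close>.\<close>
definition trapezoid ::
  "real \<Rightarrow> real \<Rightarrow> real \<Rightarrow> real \<Rightarrow> (real \<Rightarrow> real) \<Rightarrow> (real \<Rightarrow> real) \<Rightarrow> (real \<Rightarrow> real) \<Rightarrow> bool" where
  "trapezoid T s t \<delta> \<psi> b1 b2 \<longleftrightarrow> test_fun T \<psi> \<and> deriv \<psi> = (\<lambda>x. b1 x - b2 x) \<and>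
    (\<forall>x. 0 \<le> \<psi> x) \<and> (\<forall>x. \<psi> x \<le> 1) \<and> continuous_on UNIV \<psi> \<and>
    (\<forall>x. x \<le> s - \<delta> \<longrightarrow> \<psi> x = 0) \<and> (\<forall>x. t + \<delta> \<le> x \<longrightarrow> \<psi> x = 0) \<and>
    (\<forall>x. s + \<delta> \<le> x \<longrightarrow> x \<le> t - \<delta> \<longrightarrow> \<psi> x = 1) \<and>
    continuous_on UNIV b1 \<and> (\<forall>x. b1 x \<ge> 0) \<and> (\<forall>x. \<bar>x - s\<bar> \<ge> \<delta> \<longrightarrow> b1 x = 0) \<and> integral {0..T} b1 = 1 \<and>
    continuous_on UNIV b2 \<and> (\<forall>x. b2 x \<ge> 0) \<and> (\<forall>x. \<bar>x - t\<bar> \<ge> \<delta> \<longrightarrow> b2 x = 0) \<and> integral {0..T} b2 = 1"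

lemma test_fun_trapezoid:
  assumes st: "0 < s - \<delta>" "t + \<delta> < T" "\<delta> > 0" "s + \<delta> < t - \<delta>"
  shows "\<exists>\<psi> b1 b2. trapezoid T s t \<delta> \<psi> b1 b2"
proof -
  obtain b1 where b1: "b1 \<in> bumps (s - \<delta>) (s + \<delta>)" "\<And>x. b1 x \<ge> 0" "\<And>x. \<bar>x - s\<bar> \<ge> \<delta> \<Longrightarrow> b1 x = 0"
    "continuous_on UNIV b1" "\<And>A B. A \<le> s - \<delta> \<Longrightarrow> s + \<delta> \<le> B \<Longrightarrow> integral {A..B} b1 = 1"
    using smooth_bump[OF st(3), of s] by blast
  obtain b2 where b2: "b2 \<in> bumps (t - \<delta>) (t + \<delta>)" "\<And>x. b2 x \<ge> 0" "\<And>x. \<bar>x - t\<bar> \<ge> \<delta> \<Longrightarrow> b2 x = 0"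
    "continuous_on UNIV b2" "\<And>A B. A \<le> t - \<delta> \<Longrightarrow> t + \<delta> \<le> B \<Longrightarrow> integral {A..B} b2 = 1"
    using smooth_bump[OF st(3), of t] by blast
  \<comment> \<open>\<open>\<theta>\<close> vanishes near \<open>0\<close>, so the primitive from \<open>0\<close> is smooth on the whole line\<close>
  define \<theta> where "\<theta> = (\<lambda>x. b1 x - b2 x)"
  define \<psi> where "\<psi> = (\<lambda>x. integral {0..x} \<theta>)"
  have c\<theta>: "continuous_on S \<theta>" for S
    unfolding \<theta>_def by (intro continuous_intros continuous_on_subset[OF b1(4)] continuous_on_subset[OF b2(4)]) auto
  have i1: "b1 integrable_on {A..B}" and i2: "b2 integrable_on {A..B}" for A B
    by (intro integrable_continuous_real continuous_on_subset[OF b1(4)] continuous_on_subset[OF b2(4)]; simp)+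
  have \<psi>eq: "\<psi> x = integral {0..x} b1 - integral {0..x} b2" for x
    unfolding \<psi>_def \<theta>_def by (intro Henstock_Kurzweil_Integration.integral_diff i1 i2)
  have i0: "integral {0..x} b1 = 0" if "x \<le> s - \<delta>" for x
  proof -
    have "integral {0..x} b1 = integral {0..x} (\<lambda>_. 0)"
      using b1(3) that by (intro Henstock_Kurzweil_Integration.integral_cong) auto
    then show ?thesis by simp
  qed
  have i0': "integral {0..x} b2 = 0" if "x \<le> t - \<delta>" for x
  proof -
    have "integral {0..x} b2 = integral {0..x} (\<lambda>_. 0)"
      using b2(3) that by (intro Henstock_Kurzweil_Integration.integral_cong) auto
    then show ?thesis by simp
  qed
  have i1': "integral {0..x} b1 = 1" if "s + \<delta> \<le> x" for x using b1(5)[of 0 x] st that by auto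
  have i2': "integral {0..x} b2 = 1" if "t + \<delta> \<le> x" for x using b2(5)[of 0 x] st that by auto
  have le: "integral {0..x} b1 \<le> 1" "integral {0..x} b2 \<le> 1" for x
  proof -
    have "integral {0..x} b1 \<le> integral {0..max x (s + \<delta>)} b1" using b1 by (intro integral_subset_le i1) auto
    then show "integral {0..x} b1 \<le> 1" using i1'[of "max x (s + \<delta>)"] by simp
    have "integral {0..x} b2 \<le> integral {0..max x (t + \<delta>)} b2" using b2 by (intro integral_subset_le i2) auto
    then show "integral {0..x} b2 \<le> 1" using i2'[of "max x (t + \<delta>)"] by simp
  qed
  have ge: "integral {0..x} b1 \<ge> 0" "integral {0..x} b2 \<ge> 0" for x
    using b1 b2 by (auto intro!: integral_nonneg i1 i2)
  have lo: "\<psi> x = 0" if "x \<le> s - \<delta>" for x using that i0[OF that] i0'[of x] st by (simp add: \<psi>eq)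
  have hi: "\<psi> x = 0" if "t + \<delta> \<le> x" for x using that i1'[of x] i2'[of x] st by (simp add: \<psi>eq)
  have der: "(\<psi> has_real_derivative \<theta> x) (at x)" for x
  proof (cases "x > 0")
    case True
    have "(\<psi> has_real_derivative \<theta> x) (at x within {0..x + 1})"
      unfolding \<psi>_def using True by (intro integral_has_real_derivative c\<theta>) auto
    then show ?thesis using True by (simp add: at_within_Icc_at)
  next
    case False
    have z: "\<theta> x = 0" using False st b1(3)[of x] b2(3)[of x] by (auto simp: \<theta>_def)
    have "((\<lambda>x. 0) has_real_derivative \<theta> x) (at x)" unfolding z by simp
    then show ?thesis
      by (rule has_field_derivative_transform_within_open[where S = "{..<s - \<delta>}"]) (use False st lo in auto)
  qed
  have sm: "smooth \<theta>"
  proof (rule smooth_coinduct)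
    let ?W = "{f. \<exists>f1\<in>bumps (s - \<delta>) (s + \<delta>). \<exists>f2\<in>bumps (t - \<delta>) (t + \<delta>). f = (\<lambda>x. f1 x - f2 x)}"
    show "\<theta> \<in> ?W" using b1(1) b2(1) by (auto simp: \<theta>_def)
    show "\<exists>f'\<in>?W. \<forall>x. (f has_real_derivative f' x) (at x)" if "f \<in> ?W" for f
    proof -
      obtain f1 f2 where f: "f1 \<in> bumps (s - \<delta>) (s + \<delta>)" "f2 \<in> bumps (t - \<delta>) (t + \<delta>)" "f = (\<lambda>x. f1 x - f2 x)" using \<open>f \<in> ?W\<close> by blast
      obtain f1' where f1: "f1' \<in> bumps (s - \<delta>) (s + \<delta>)" "\<And>x. (f1 has_real_derivative f1' x) (at x)" using bumps_deriv[OF f(1)] by blast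
      obtain f2' where f2: "f2' \<in> bumps (t - \<delta>) (t + \<delta>)" "\<And>x. (f2 has_real_derivative f2' x) (at x)" using bumps_deriv[OF f(2)] by blast
      show ?thesis unfolding f(3)
        by (intro bexI[of _ "\<lambda>x. f1' x - f2' x"] allI DERIV_diff f1(2) f2(2)) (use f1(1) f2(1) in blast)
    qed
  qed
  show ?thesis
    unfolding trapezoid_def
  proof (rule exI[of _ \<psi>], rule exI[of _ b1], rule exI[of _ b2], intro conjI allI impI)
    have "closure {x. \<psi> x \<noteq> 0} \<subseteq> {s - \<delta>..t + \<delta>}"
    proof (rule closure_minimal)
      show "{x. \<psi> x \<noteq> 0} \<subseteq> {s - \<delta>..t + \<delta>}" using lo hi by (auto simp: not_less[symmetric] intro: less_imp_le)
    qed auto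
    then show "test_fun T \<psi>" 
      using smooth_of_derivative(1)[OF der sm] st by (auto simp: test_fun_def smooth_def)
    show "deriv \<psi> = (\<lambda>x. b1 x - b2 x)" using smooth_of_derivative(2)[OF der sm] by (simp add: \<theta>_def)
    show "\<psi> x = 1" if "s + \<delta> \<le> x" "x \<le> t - \<delta>" for x using i1'[of x] i0'[of x] that by (simp add: \<psi>eq)
    show "0 \<le> \<psi> x" for x
    proof (cases "x \<le> t - \<delta>")
      case True
      then show ?thesis using i0'[of x] ge by (simp add: \<psi>eq)
    next
      case False
      then show ?thesis using i1'[of x] le st by (simp add: \<psi>eq)
    qed
    show "\<psi> x \<le> 1" for x using le(1)[of x] ge(2)[of x] by (simp add: \<psi>eq)
    show "continuous_on UNIV \<psi>" using der by (auto intro!: continuous_at_imp_continuous_on DERIV_isCont)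
    show "integral {0..T} b1 = 1" "integral {0..T} b2 = 1" using st by (auto intro!: b1(5) b2(5))
  qed (use lo hi b1 b2 in auto)
qed

section \<open>Weak derivatives and indefinite integrals\<close>

lemma AE_leb_interval_subset:
  assumes "AE t in leb_interval T. P t" "0 \<le> s" "t \<le> T"
  shows "AE x in lebesgue_on {s..t}. P x"
proof -
  obtain N where N: "negligible N" "\<And>x. x \<in> {0<..<T} \<Longrightarrow> x \<notin> N \<Longrightarrow> P x" using AE_lebesgue_onE[OF assms(1)] by auto
  show ?thesis
    by (rule AE_lebesgue_onI[of "N \<union> {0, T}"]) (use N assms in \<open>auto simp: less_le\<close>)
qed

lemma AE_leb_interval_Icc: "(AE t in lebesgue_on {0..T}. P t) \<Longrightarrow> (AE t in leb_interval T. P t)"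
  by (erule AE_lebesgue_onE) (auto intro: AE_lebesgue_onI)

lemma integrable_leb_interval_iff:
  fixes f :: "real \<Rightarrow> 'a::euclidean_space"
  shows "integrable (leb_interval T) f \<longleftrightarrow> f absolutely_integrable_on {0..T}"
  by (simp add: integrable_lebesgue_on_iff absolutely_integrable_on_Icc_iff_Ioo)

lemma integrable_leb_interval_Icc:
  fixes f :: "real \<Rightarrow> 'a::euclidean_space"
  shows "integrable (leb_interval T) f \<longleftrightarrow> integrable (lebesgue_on {0..T}) f"
  by (simp add: integrable_leb_interval_iff integrable_lebesgue_on_iff)

lemma integral_leb_interval_Icc:
  fixes f :: "real \<Rightarrow> 'a::euclidean_space"
  shows "(\<integral>x. f x \<partial>leb_interval T) = (\<integral>x. f x \<partial>lebesgue_on {0..T})"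
proof (cases "integrable (leb_interval T) f")
  case True
  then have "(\<integral>x. f x \<partial>leb_interval T) = integral {0<..<T} f" "(\<integral>x. f x \<partial>lebesgue_on {0..T}) = integral {0..T} f"
    by (auto intro!: lebesgue_integral_eq_integral simp: integrable_leb_interval_Icc)
  then show ?thesis by (simp add: integral_open_interval_real)
next
  case False
  then show ?thesis by (simp add: not_integrable_integral_eq integrable_leb_interval_Icc)
qed

lemma integrable_leb_interval_subset:
  fixes f :: "real \<Rightarrow> 'a::euclidean_space"
  assumes "integrable (leb_interval T) f" "0 \<le> s" "t \<le> T"
  shows "integrable (lebesgue_on {s..t}) f"
  using assms integrable_subinterval[of 0 T f s t] by (simp add: integrable_leb_interval_Icc)

lemma borel_measurable_leb_interval_subset:
  fixes f :: "real \<Rightarrow> 'a::euclidean_space"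
  assumes "f \<in> borel_measurable (leb_interval T)" "0 \<le> s" "t \<le> T"
  shows "f \<in> borel_measurable (lebesgue_on {s..t})"
proof -
  have "f \<in> borel_measurable (lebesgue_on ({s..t} \<inter> {0<..<T}))"
    using assms(1) by (rule measurable_restrict_mono) auto
  then have 1: "(\<lambda>x. if x \<in> {s..t} \<inter> {0<..<T} then f x else 0) \<in> borel_measurable lebesgue"
    by (subst borel_measurable_if) auto
  have "(\<lambda>x. if x \<in> {s..t} then f x else 0) \<in> borel_measurable lebesgue"
  proof (rule borel_measurable_AE)
    show "(\<lambda>x. if x \<in> {s..t} \<inter> {0<..<T} then f x else 0) \<in> borel_measurable lebesgue"
      by (rule 1)
    show "AE x in lebesgue. (if x \<in> {s..t} \<inter> {0<..<T} then f x else 0) = (if x \<in> {s..t} then f x else 0)"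
      by (rule AE_I'[of "{0, T}"]) (use assms in \<open>auto simp flip: negligible_iff_null_sets\<close>)
  qed
  then show ?thesis by (subst (asm) borel_measurable_if) auto
qed

lemma interval_integral_eq_indicator:
  fixes f :: "real \<Rightarrow> 'a::euclidean_space"
  assumes "integrable (leb_interval T) f" "0 \<le> s" "t \<le> T"
  shows "integral {s..t} f = (\<integral>x. indicator {s..t} x *\<^sub>R f x \<partial>leb_interval T)"
    and "integrable (leb_interval T) (\<lambda>x. indicator {s..t} x *\<^sub>R f x)"
proof -
  show i: "integrable (leb_interval T) (\<lambda>x. indicator {s..t} x *\<^sub>R f x)"
  proof -
    have "integrable (leb_interval T) (\<lambda>x. indicator ({s..t} \<inter> {0<..<T}) x *\<^sub>R f x)"
      using assms(1) by (intro integrable_mult_indicator) (auto simp: sets_restrict_space_iff)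
    then show ?thesis
      by (rule Bochner_Integration.integrable_cong[THEN iffD1, rotated 2]) (auto simp: indicator_def)
  qed
  have "(\<integral>x. indicator {s..t} x *\<^sub>R f x \<partial>leb_interval T) = integral {0..T} (\<lambda>x. indicator {s..t} x *\<^sub>R f x)"
    using i by (simp add: integral_leb_interval_Icc integrable_leb_interval_Icc lebesgue_integral_eq_integral)
  also have "\<dots> = integral {0..T} (\<lambda>x. if x \<in> {s..t} then f x else 0)"
    by (intro Henstock_Kurzweil_Integration.integral_cong) (auto simp: indicator_def)
  also have "\<dots> = integral {s..t} f"
    using assms by (subst integral_restrict_Int) (auto intro!: arg_cong2[where f = integral])
  finally show "integral {s..t} f = (\<integral>x. indicator {s..t} x *\<^sub>R f x \<partial>leb_interval T)" by simp
qed

lemma interval_integral_eq_lebesgue: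
  fixes f :: "real \<Rightarrow> 'a::euclidean_space"
  assumes "integrable (leb_interval T) f" "0 \<le> s" "t \<le> T"
  shows "integral {s..t} f = (\<integral>x. f x \<partial>lebesgue_on {s..t})"
  using integrable_leb_interval_subset[OF assms] by (simp add: lebesgue_integral_eq_integral)

lemma continuous_measurable_leb_interval:
  fixes f :: "real \<Rightarrow> 'a::euclidean_space"
  assumes "continuous_on {0..T} f" shows "f \<in> borel_measurable (leb_interval T)"
  by (rule continuous_imp_measurable_on_sets_lebesgue[OF continuous_on_subset[OF assms]]) auto

lemma continuous_integrable_leb_interval:
  fixes f :: "real \<Rightarrow> 'a::euclidean_space"
  assumes "continuous_on {0..T} f" shows "integrable (leb_interval T) f"
  using absolutely_integrable_continuous_real[OF assms] by (simp add: integrable_leb_interval_iff)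

lemma mollified_value_close:
  fixes u :: "real \<Rightarrow> 'a::euclidean_space"
  assumes u: "continuous_on {0..T} u" and b: "continuous_on UNIV b" "\<And>x. b x \<ge> 0" "integral {0..T} b = 1"
    "\<And>x. \<bar>x - c\<bar> \<ge> \<delta> \<Longrightarrow> b x = 0"
    and close: "\<And>x. x \<in> {0..T} \<Longrightarrow> \<bar>x - c\<bar> < \<delta> \<Longrightarrow> norm (u x - u c) \<le> e"
  shows "norm ((\<integral>x. b x *\<^sub>R u x \<partial>leb_interval T) - u c) \<le> e"
proof -
  have cb: "continuous_on {0..T} b" using b(1) continuous_on_subset by blast
  have I1: "(\<integral>x. b x \<partial>leb_interval T) = 1"
    using cb b(3) by (simp add: integral_leb_interval_Icc lebesgue_integral_eq_integral
        continuous_integrable_leb_interval flip: integrable_leb_interval_Icc)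
  note ib = continuous_integrable_leb_interval[OF cb]
  have ibu: "integrable (leb_interval T) (\<lambda>x. b x *\<^sub>R u x)"
    by (intro continuous_integrable_leb_interval continuous_intros cb u)
  have id: "integrable (leb_interval T) (\<lambda>x. b x *\<^sub>R (u x - u c))"
    by (intro continuous_integrable_leb_interval continuous_intros cb u)
  have "(\<integral>x. b x *\<^sub>R u x \<partial>leb_interval T) - u c = (\<integral>x. b x *\<^sub>R (u x - u c) \<partial>leb_interval T)"
    using I1 ibu ib by (simp add: scaleR_diff_right)
  also have "norm \<dots> \<le> (\<integral>x. e * b x \<partial>leb_interval T)"
  proof (rule order_trans[OF integral_norm_bound integral_mono])
    fix x assume "x \<in> space (leb_interval T)"
    then have "x \<in> {0..T}" by auto
    then show "norm (b x *\<^sub>R (u x - u c)) \<le> e * b x"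
      using close[of x] b(2)[of x] b(4)[of x] by (cases "\<bar>x - c\<bar> < \<delta>") (auto simp: mult.commute[of e] intro: mult_left_mono)
  qed (use integrable_norm[OF id] ib id in auto)
  also have "\<dots> = e" using I1 by simp
  finally show ?thesis .
qed

text \<open>Test with trapezoids of shrinking slopes: the integrals against \<open>\<psi>'\<close> tend to \<open>u s - u t\<close>, those
  against \<open>\<psi>\<close> to the integral over \<open>[s, t]\<close>.\<close>
lemma weak_deriv_increment:
  fixes u g :: "real \<Rightarrow> 'a::euclidean_space"
  assumes wd: "has_weak_deriv T u g" and u: "continuous_on {0..T} u" and g: "L1_fun T g"
    and st: "0 < s" "s < t" "t < T"
  shows "u t - u s = integral {s..t} g"
proof -
  let ?M = "leb_interval T"
  \<comment> \<open>slopes of half-width at most \<open>\<delta>0\<close> stay inside \<open>(0, T)\<close> and do not overlap\<close>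
  define \<delta>0 where "\<delta>0 = min (min s (T - t)) ((t - s) / 2) / 2"
  define \<delta> where "\<delta> = (\<lambda>n. \<delta>0 * inverse (real (Suc n)))"
  have d0: "\<delta>0 > 0" "\<delta>0 < s" "t + \<delta>0 < T" "s + \<delta>0 < t - \<delta>0" using st by (auto simp: \<delta>0_def min_def field_simps)
  have d: "\<delta> n > 0" "\<delta> n \<le> \<delta>0" for n
  proof -
    have "0 < inverse (real (Suc n))" "inverse (real (Suc n)) \<le> 1" by (auto simp: inverse_eq_divide)
    then show "\<delta> n > 0" "\<delta> n \<le> \<delta>0" using d0 unfolding \<delta>_def by (auto simp: mult_le_cancel_left2)
  qed
  have "\<delta> \<longlonglongrightarrow> \<delta>0 * 0" unfolding \<delta>_def by (intro tendsto_intros LIMSEQ_inverse_real_of_nat)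
  then have dlim: "\<delta> \<longlonglongrightarrow> 0" by simp
  have "\<exists>\<psi> b1 b2. trapezoid T s t (\<delta> n) \<psi> b1 b2" for n
    using d[of n] d0 by (intro test_fun_trapezoid) auto
  then obtain \<psi> b1 b2 where Q: "\<And>n. trapezoid T s t (\<delta> n) (\<psi> n) (b1 n) (b2 n)" by metis
  note q = Q[unfolded trapezoid_def]
  have close: "\<exists>n0. \<forall>n\<ge>n0. \<forall>x\<in>{0..T}. \<bar>x - c\<bar> < \<delta> n \<longrightarrow> norm (u x - u c) \<le> e" if "c \<in> {0..T}" "e > 0" for c e
  proof -
    have "\<exists>r>0. \<forall>x\<in>{0..T}. dist x c < r \<longrightarrow> dist (u x) (u c) < e"
      using u that unfolding continuous_on_iff by simp
    then obtain r where r: "r > 0" "\<And>x. x \<in> {0..T} \<Longrightarrow> dist x c < r \<Longrightarrow> dist (u x) (u c) < e"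
      by auto
    obtain n0 where "\<And>n. n \<ge> n0 \<Longrightarrow> \<delta> n < r"
      using order_tendstoD(2)[OF dlim r(1)] by (auto simp: eventually_sequentially)
    then show ?thesis using r by (intro exI[of _ n0]) (force simp: dist_norm intro: less_imp_le)
  qed
  have moll: "(\<lambda>n. \<integral>x. b n x *\<^sub>R u x \<partial>?M) \<longlonglongrightarrow> u c"
    if c: "c \<in> {0..T}" and b: "\<And>n. continuous_on UNIV (b n)" "\<And>n x. b n x \<ge> 0" "\<And>n. integral {0..T} (b n) = 1"
      "\<And>n x. \<bar>x - c\<bar> \<ge> \<delta> n \<Longrightarrow> b n x = 0" for c and b :: "nat \<Rightarrow> real \<Rightarrow> real"
  proof (rule LIMSEQ_I)
    fix r :: real assume "r > 0"
    then have "\<exists>n0. \<forall>n\<ge>n0. \<forall>x\<in>{0..T}. \<bar>x - c\<bar> < \<delta> n \<longrightarrow> norm (u x - u c) \<le> r / 2"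
      using c by (intro close) auto
    then obtain n0 where n0: "\<And>n x. n \<ge> n0 \<Longrightarrow> x \<in> {0..T} \<Longrightarrow> \<bar>x - c\<bar> < \<delta> n \<Longrightarrow> norm (u x - u c) \<le> r / 2"
      by blast
    show "\<exists>n0. \<forall>n\<ge>n0. norm ((\<integral>x. b n x *\<^sub>R u x \<partial>?M) - u c) < r"
    proof (intro exI[of _ n0] allI impI)
      fix n assume "n \<ge> n0"
      then have "norm ((\<integral>x. b n x *\<^sub>R u x \<partial>?M) - u c) \<le> r / 2"
        by (intro mollified_value_close[OF u b(1-3), where \<delta> = "\<delta> n"] b(4) n0)
      then show "norm ((\<integral>x. b n x *\<^sub>R u x \<partial>?M) - u c) < r" using \<open>r > 0\<close> by linarith
    qed
  qed
  have L1: "(\<lambda>n. \<integral>x. b1 n x *\<^sub>R u x \<partial>?M) \<longlonglongrightarrow> u s"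
    by (rule moll) (use q st in auto)
  have L2: "(\<lambda>n. \<integral>x. b2 n x *\<^sub>R u x \<partial>?M) \<longlonglongrightarrow> u t"
    by (rule moll) (use q st in auto)
  have m: "\<psi> n \<in> borel_measurable ?M" for n
    using q[of n] by (intro continuous_measurable_leb_interval) (auto intro: continuous_on_subset)
  note [measurable] = m borel_measurable_integrable[OF g]
  have L3: "(\<lambda>n. \<integral>x. \<psi> n x *\<^sub>R g x \<partial>?M) \<longlonglongrightarrow> (\<integral>x. indicator {s..t} x *\<^sub>R g x \<partial>?M)"
  proof (rule integral_dominated_convergence[where w = "\<lambda>x. norm (g x)"])
    show "AE x in ?M. (\<lambda>n. \<psi> n x *\<^sub>R g x) \<longlonglongrightarrow> indicator {s..t} x *\<^sub>R g x"
    proof (rule AE_lebesgue_onI[of "{s, t}"])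
      fix x assume x: "x \<in> {0<..<T}" "x \<notin> {s, t}"
      define r where "r = min \<bar>x - s\<bar> \<bar>x - t\<bar>"
      have "r > 0" using x by (auto simp: r_def)
      have "\<forall>\<^sub>F n in sequentially. indicator {s..t} x = \<psi> n x"
        using order_tendstoD(2)[OF dlim \<open>r > 0\<close>]
      proof eventually_elim
        fix n assume "\<delta> n < r"
        then consider "x \<le> s - \<delta> n" | "t + \<delta> n \<le> x" | "s + \<delta> n \<le> x" "x \<le> t - \<delta> n"
          using x unfolding r_def by linarith
        then show "indicator {s..t} x = \<psi> n x"
          using q[of n] d[of n] st by cases (auto simp: indicator_def)
      qed
      then have "(\<lambda>n. \<psi> n x) \<longlonglongrightarrow> indicator {s..t} x" by (rule Lim_transform_eventually[OF tendsto_const])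
      then show "(\<lambda>n. \<psi> n x *\<^sub>R g x) \<longlonglongrightarrow> indicator {s..t} x *\<^sub>R g x" by (intro tendsto_intros)
    qed auto
    show "AE x in ?M. norm (\<psi> n x *\<^sub>R g x) \<le> norm (g x)" for n
      using q[of n] by (intro AE_I2) (auto intro!: mult_left_le_one_le)
    show "(\<lambda>x. indicator {s..t} x *\<^sub>R g x) \<in> borel_measurable ?M"
      using interval_integral_eq_indicator(2)[OF g, of s t] st by auto
  qed (use g in auto)
  have eq: "(\<integral>x. b1 n x *\<^sub>R u x \<partial>?M) - (\<integral>x. b2 n x *\<^sub>R u x \<partial>?M) = - (\<integral>x. \<psi> n x *\<^sub>R g x \<partial>?M)" for n
  proof -
    have "integrable ?M (\<lambda>x. b1 n x *\<^sub>R u x)" "integrable ?M (\<lambda>x. b2 n x *\<^sub>R u x)"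
      using q[of n] by (auto intro!: continuous_integrable_leb_interval continuous_intros u intro: continuous_on_subset)
    then have "(\<integral>x. b1 n x *\<^sub>R u x \<partial>?M) - (\<integral>x. b2 n x *\<^sub>R u x \<partial>?M) = (\<integral>x. deriv (\<psi> n) x *\<^sub>R u x \<partial>?M)"
      using q[of n] by (simp add: scaleR_diff_left)
    also have "\<dots> = - (\<integral>x. \<psi> n x *\<^sub>R g x \<partial>?M)"
      using wd q[of n] by (auto simp: has_weak_deriv_def)
    finally show ?thesis .
  qed
  have "u s - u t = - (\<integral>x. indicator {s..t} x *\<^sub>R g x \<partial>?M)"
    by (rule LIMSEQ_unique[OF tendsto_diff[OF L1 L2]]) (unfold eq, intro tendsto_intros L3)
  moreover have "integral {s..t} g = (\<integral>x. indicator {s..t} x *\<^sub>R g x \<partial>?M)"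
    using st by (intro interval_integral_eq_indicator g) auto
  ultimately show ?thesis by (simp add: algebra_simps)
qed

lemma has_weak_deriv_imp_indefinite_integral:
  fixes u g :: "real \<Rightarrow> 'a::euclidean_space"
  assumes wd: "has_weak_deriv T u g" and u: "continuous_on {0..T} u" and g: "L1_fun T g" and T: "T > 0"
    and x: "x \<in> {0..T}"
  shows "u x = u 0 + integral {0..x} g"
proof -
  let ?d = "\<lambda>x. u x - integral {0..x} g"
  have gI: "g integrable_on {0..T}" using g by (simp add: integrable_leb_interval_iff absolutely_integrable_on_def)
  have c: "continuous_on {0..T} ?d" by (intro continuous_intros u indefinite_integral_continuous_1 gI)
  have const: "?d y = ?d (T / 2)" if "y \<in> {0<..<T}" for y
  proof -
    have inc: "?d b = ?d a" if ab: "0 < a" "a < b" "b < T" for a b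
    proof -
      have "integral {0..a} g + integral {a..b} g = integral {0..b} g"
        using ab gI by (intro Henstock_Kurzweil_Integration.integral_combine) (auto intro: integrable_on_subinterval)
      then show ?thesis using weak_deriv_increment[OF wd u g ab] by (simp add: algebra_simps)
    qed
    consider "y = T / 2" | "y < T / 2" | "T / 2 < y" by linarith
    then show ?thesis using inc[of y "T / 2"] inc[of "T / 2" y] that T by cases auto
  qed
  have cl: "closure {0<..<T} = {0..T}" using T by simp
  have "?d y = ?d (T / 2)" if "y \<in> {0..T}" for y
    using continuous_constant_on_closure[of "{0<..<T}" ?d "?d (T / 2)" y] c const that unfolding cl by blast
  from this[OF x] this[of 0] T show ?thesis by (simp add: diff_eq_eq)
qed

lemma AE_eq_of_interval_integrals:
  fixes f g :: "real \<Rightarrow> 'a::euclidean_space"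
  assumes f: "L1_fun T f" and g: "L1_fun T g" 
    and eq: "\<And>x. x \<in> {0..T} \<Longrightarrow> integral {0..x} f = integral {0..x} g"
  shows "AE t in leb_interval T. f t = g t"
proof -
  have fI: "f absolutely_integrable_on {0..T}" and gI: "g absolutely_integrable_on {0..T}"
    using f g by (simp_all add: integrable_leb_interval_iff)
  have z: "integral {s..t} f = integral {s..t} g" if st: "0 \<le> s" "s \<le> t" "t \<le> T" for s t
  proof -
    have "integral {0..s} f + integral {s..t} f = integral {0..t} f" "integral {0..s} g + integral {s..t} g = integral {0..t} g"
      using st fI gI by (auto intro!: Henstock_Kurzweil_Integration.integral_combine 
          intro: integrable_on_subinterval simp: absolutely_integrable_on_def)
    then show ?thesis using eq[of s] eq[of t] st by (metis add_left_cancel atLeastAtMost_iff order_trans)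
  qed
  have "AE t in leb_interval T. (f t - g t) \<bullet> e = 0" if "e \<in> Basis" for e
  proof -
    have sub: "f integrable_on {s..t}" "g integrable_on {s..t}" if "0 \<le> s" "t \<le> T" for s t
      using fI gI that by (auto intro: integrable_on_subinterval simp: absolutely_integrable_on_def)
    have i: "(\<lambda>t. (f t - g t) \<bullet> e) absolutely_integrable_on {0..T}"
      using f g by (simp add: integrable_leb_interval_iff[symmetric])
    have int: "integral {s..t} (\<lambda>t. (f t - g t) \<bullet> e) = 0" if "0 \<le> s" "s \<le> t" "t \<le> T" for s t
    proof -
      have "integral {s..t} (\<lambda>t. (f t - g t) \<bullet> e) = integral {s..t} (\<lambda>t. f t - g t) \<bullet> e"
        using sub[of s t] that by (intro integral_component_eq Henstock_Kurzweil_Integration.integrable_diff)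
      also have "integral {s..t} (\<lambda>t. f t - g t) = 0"
        using sub[of s t] z[of s t] that by (simp add: Henstock_Kurzweil_Integration.integral_diff)
      finally show ?thesis by simp
    qed
    have "AE t in lebesgue_on {0..T}. (f t - g t) \<bullet> e \<ge> 0"
      by (rule AE_nonneg_of_interval_integrals[OF i]) (use int in auto)
    moreover have "AE t in lebesgue_on {0..T}. - ((f t - g t) \<bullet> e) \<ge> 0"
      by (rule AE_nonneg_of_interval_integrals) (use int f g in \<open>auto simp: integrable_leb_interval_iff[symmetric]\<close>)
    ultimately have "AE t in lebesgue_on {0..T}. (f t - g t) \<bullet> e = 0" by eventually_elim simp
    then show ?thesis by (rule AE_leb_interval_Icc)
  qed
  then have "AE t in leb_interval T. \<forall>e\<in>Basis. (f t - g t) \<bullet> e = 0"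
    by (intro AE_finite_allI) auto
  then show ?thesis
  proof eventually_elim
    fix t assume a: "\<forall>e\<in>Basis. (f t - g t) \<bullet> e = 0"
    have "f t - g t = 0" by (rule euclidean_eqI) (use a in simp)
    then show "f t = g t" by simp
  qed
qed

lemma continuous_bounded_Icc:
  fixes f :: "real \<Rightarrow> 'a::real_normed_vector"
  assumes "continuous_on {0..T} f"
  shows "\<exists>B. \<forall>t\<in>{0..T}. norm (f t) \<le> B"
  using compact_imp_bounded[OF compact_continuous_image[OF assms]] by (auto simp: bounded_iff)

lemma test_funD:
  assumes "test_fun T \<psi>"
  shows "\<And>x. (\<psi> has_real_derivative deriv \<psi> x) (at x)" "continuous_on UNIV (deriv \<psi>)" "continuous_on UNIV \<psi>"
    "\<psi> 0 = 0" "\<psi> T = 0"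
proof -
  have d0: "\<psi> differentiable_on UNIV" and d1: "deriv \<psi> differentiable_on UNIV"
    using assms unfolding test_fun_def by (metis funpow_0) (metis assms funpow_0 funpow_simps_right(2) o_apply test_fun_def funpow.simps(2))
  show "(\<psi> has_real_derivative deriv \<psi> x) (at x)" for x
    using d0 by (auto simp: differentiable_on_def DERIV_deriv_iff_real_differentiable)
  show "continuous_on UNIV (deriv \<psi>)" "continuous_on UNIV \<psi>"
    using d0 d1 by (auto intro: differentiable_imp_continuous_on)
  show "\<psi> 0 = 0" "\<psi> T = 0" using assms closure_subset[of "{t. \<psi> t \<noteq> 0}"] by (auto simp: test_fun_def)
qed

text \<open>Integration by parts: the chain rule for \<open>(s, x) \<mapsto> s * (x \<bullet> e)\<close> along the curve
  \<open>t \<mapsto> (\<psi> t, u t)\<close>, whose end points are mapped to \<open>0\<close>.\<close>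
lemma indefinite_integral_has_weak_deriv:
  fixes u g :: "real \<Rightarrow> 'a::euclidean_space"
  assumes T: "T > 0" and g: "L1_fun T g" and u: "\<And>x. x \<in> {0..T} \<Longrightarrow> u x = u 0 + integral {0..x} g"
  shows "has_weak_deriv T u g"
  unfolding has_weak_deriv_def
proof (intro allI impI)
  fix \<psi> assume "test_fun T \<psi>"
  note \<psi> = test_funD[OF this]
  let ?M = "lebesgue_on {0..T}"
  have gI: "g integrable_on {0..T}" using g by (simp add: integrable_leb_interval_iff absolutely_integrable_on_def)
  have "continuous_on {0..T} (\<lambda>x. u 0 + integral {0..x} g)" by (intro continuous_intros indefinite_integral_continuous_1 gI)
  then have cu: "continuous_on {0..T} u" by (rule continuous_on_eq) (rule u[symmetric])
  have c\<psi>: "continuous_on {0..T} \<psi>" "continuous_on {0..T} (deriv \<psi>)" using \<psi> continuous_on_subset by blast+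
  have g': "integrable ?M g" using g by (simp add: integrable_leb_interval_Icc)
  have ci: "integrable ?M f" if "continuous_on {0..T} f" for f :: "real \<Rightarrow> 'c::euclidean_space"
    using continuous_integrable_leb_interval[OF that] by (simp add: integrable_leb_interval_Icc)
  have ip: "integrable ?M (\<lambda>t. deriv \<psi> t *\<^sub>R u t)" by (intro ci continuous_intros c\<psi> cu)
  obtain B where B: "\<And>t. t \<in> {0..T} \<Longrightarrow> norm (\<psi> t) \<le> B"
    using continuous_bounded_Icc[OF c\<psi>(1)] by blast
  have iq: "integrable ?M (\<lambda>t. \<psi> t *\<^sub>R g t)"
  proof (rule Bochner_Integration.integrable_bound[of _ "\<lambda>t. B *\<^sub>R g t"])
    show "(\<lambda>t. \<psi> t *\<^sub>R g t) \<in> borel_measurable ?M" using ci[OF c\<psi>(1)] g' by measurable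
    show "AE t in ?M. norm (\<psi> t *\<^sub>R g t) \<le> norm (B *\<^sub>R g t)"
      using B by (intro AE_I2) (auto intro!: mult_right_mono intro: order_trans[OF _ abs_ge_self])
  qed (use g' in auto)
  have comp: "((\<integral>t. deriv \<psi> t *\<^sub>R u t \<partial>?M) + (\<integral>t. \<psi> t *\<^sub>R g t \<partial>?M)) \<bullet> e = 0" if e: "e \<in> Basis" for e
  proof -
    let ?v = "\<lambda>t. (\<psi> t, u t)" and ?g = "\<lambda>t. (deriv \<psi> t, g t)" and ?\<zeta> = "\<lambda>t. (u t \<bullet> e, \<psi> t *\<^sub>R e)"
    let ?\<Phi> = "\<lambda>z :: real \<times> 'a. fst z * (snd z \<bullet> e)"
    have c\<zeta>: "continuous_on {0..T} ?\<zeta>" by (intro continuous_intros cu c\<psi>)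
    obtain C where C: "\<And>t. t \<in> {0..T} \<Longrightarrow> norm (?\<zeta> t) \<le> C"
      using continuous_bounded_Icc[OF c\<zeta>] by blast
    have "(\<integral>t. ?\<zeta> t \<bullet> ?g t \<partial>?M) = ?\<Phi> (?v T) - ?\<Phi> (?v 0)"
    proof (rule chain_rule[where C = C and K = 1])
      show gi: "integrable ?M ?g"
        using integrable_bounded_linear[OF bounded_linear_Pair[OF bounded_linear_ident bounded_linear_zero] ci[OF c\<psi>(2)]]
          integrable_bounded_linear[OF bounded_linear_Pair[OF bounded_linear_zero bounded_linear_ident] g']
        by (drule_tac Bochner_Integration.integrable_add) auto
      fix x assume x: "x \<in> {0..T}"
      have s: "(deriv \<psi> has_integral \<psi> x - \<psi> 0) {0..x}"
        using x \<psi>(1) by (intro fundamental_theorem_of_calculus)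
          (auto simp: has_real_derivative_iff_has_vector_derivative[symmetric] intro: has_field_derivative_at_within)
      have "(g has_integral (u x - u 0)) {0..x}"
        using x u[OF x] integrable_integral[OF integrable_on_subinterval[OF gI, of 0 x]] by auto
      from has_integral_add[OF has_integral_linear[OF s bounded_linear_Pair[OF bounded_linear_ident bounded_linear_zero]]
        has_integral_linear[OF this bounded_linear_Pair[OF bounded_linear_zero bounded_linear_ident]]]
      have "(?g has_integral (\<psi> x - \<psi> 0, u x - u 0)) {0..x}" by (simp add: o_def)
      then have "integral {0..x} ?g = (\<psi> x - \<psi> 0, u x - u 0)" by (rule integral_unique)
      then show "?v x = ?v 0 + integral {0..x} ?g" by simp
    next
      show "continuous_on UNIV ?\<Phi>" by (intro continuous_intros)
      show "?\<zeta> \<in> borel_measurable ?M" using ci[OF c\<zeta>] by auto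
      show "AE t in ?M. norm (?\<zeta> t) \<le> C" using C by (intro AE_I2) auto
      show "AE t in ?M. \<forall>z. ?\<zeta> t \<bullet> (z - ?v t) - 1 * (norm (z - ?v t))\<^sup>2 \<le> ?\<Phi> z - ?\<Phi> (?v t)"
      proof (intro AE_I2 allI)
        fix t and z :: "real \<times> 'a"
        obtain a b where z: "z = (a, b)" by force
        have "\<bar>(a - \<psi> t) * ((b - u t) \<bullet> e)\<bar> \<le> norm (z - ?v t) * norm (z - ?v t)"
          unfolding abs_mult
        proof (rule mult_mono)
          show "\<bar>a - \<psi> t\<bar> \<le> norm (z - ?v t)" using norm_fst_le[of "a - \<psi> t" "b - u t"] by (simp add: z)
          have "\<bar>(b - u t) \<bullet> e\<bar> \<le> norm (b - u t)" using e by (rule Basis_le_norm)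
          also have "\<dots> \<le> norm (z - ?v t)" using norm_snd_le[of "b - u t" "a - \<psi> t"] by (simp add: z)
          finally show "\<bar>(b - u t) \<bullet> e\<bar> \<le> norm (z - ?v t)" .
        qed auto
        then have "- ((norm (z - ?v t))\<^sup>2) \<le> (a - \<psi> t) * ((b - u t) \<bullet> e)" by (simp add: power2_eq_square)
        moreover have "?\<Phi> z - ?\<Phi> (?v t) - ?\<zeta> t \<bullet> (z - ?v t) = (a - \<psi> t) * ((b - u t) \<bullet> e)"
          by (simp add: z inner_diff_left inner_diff_right algebra_simps inner_commute)
        ultimately show "?\<zeta> t \<bullet> (z - ?v t) - 1 * (norm (z - ?v t))\<^sup>2 \<le> ?\<Phi> z - ?\<Phi> (?v t)" by linarith
      qed
    qed (use T in auto)
    also have "\<dots> = 0" using \<psi> by simp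
    also have "(\<integral>t. ?\<zeta> t \<bullet> ?g t \<partial>?M) = (\<integral>t. (deriv \<psi> t *\<^sub>R u t) \<bullet> e + (\<psi> t *\<^sub>R g t) \<bullet> e \<partial>?M)"
      by (simp add: algebra_simps inner_commute)
    also have "\<dots> = ((\<integral>t. deriv \<psi> t *\<^sub>R u t \<partial>?M) + (\<integral>t. \<psi> t *\<^sub>R g t \<partial>?M)) \<bullet> e"
      unfolding inner_add_left
        integral_inner_left[OF ip, of e, symmetric] integral_inner_left[OF iq, of e, symmetric]
      by (rule Bochner_Integration.integral_add[OF integrable_inner_left integrable_inner_left]) (rule ip, rule iq)
    finally show ?thesis .
  qed
  have "(\<integral>t. deriv \<psi> t *\<^sub>R u t \<partial>?M) + (\<integral>t. \<psi> t *\<^sub>R g t \<partial>?M) = 0"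
    by (rule euclidean_eqI) (simp only: inner_zero_left comp)
  then show "(\<integral>t. deriv \<psi> t *\<^sub>R u t \<partial>leb_interval T) = - (\<integral>t. \<psi> t *\<^sub>R g t \<partial>leb_interval T)"
    unfolding integral_leb_interval_Icc by (rule iffD2[OF eq_neg_iff_add_eq_0])
qed

lemma abs_cont_on_imp_continuous_on:
  assumes "abs_cont_on a b f" shows "continuous_on {a..b} f"
  unfolding continuous_on_iff
proof (intro ballI allI impI)
  fix x e :: real assume x: "x \<in> {a..b}" "e > 0"
  obtain d where d: "d > 0" "\<And>D :: (real \<times> real) set. finite D \<and> (\<forall>(s, t)\<in>D. a \<le> s \<and> s \<le> t \<and> t \<le> b) \<and>
        pairwise (\<lambda>I J. disjnt {fst I<..<snd I} {fst J<..<snd J}) D \<and>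
        (\<Sum>(s, t)\<in>D. t - s) < d \<Longrightarrow> (\<Sum>(s, t)\<in>D. norm (f t - f s)) < e"
    using assms x(2) unfolding abs_cont_on_def by blast
  show "\<exists>d>0. \<forall>y\<in>{a..b}. dist y x < d \<longrightarrow> dist (f y) (f x) < e"
  proof (intro exI[of _ d] conjI ballI impI)
    fix y assume y: "y \<in> {a..b}" "dist y x < d"
    show "dist (f y) (f x) < e"
      using d(2)[of "{(min x y, max x y)}"] x y
      by (cases "x \<le> y") (auto simp: dist_norm norm_minus_commute min_def max_def split: if_splits)
  qed (rule d)
qed

lemma W11_weak_deriv:
  fixes u :: "real \<Rightarrow> 'a::euclidean_space"
  assumes "W11_fun T u" "continuous_on {0..T} u" "T > 0"
  shows "L1_fun T (weak_deriv T u)" "\<And>x. x \<in> {0..T} \<Longrightarrow> u x = u 0 + integral {0..x} (weak_deriv T u)"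
proof -
  have "\<exists>g. L1_fun T g \<and> has_weak_deriv T u g" using assms(1) by (simp add: W11_fun_def)
  then have *: "L1_fun T (weak_deriv T u) \<and> has_weak_deriv T u (weak_deriv T u)"
    unfolding weak_deriv_def by (rule someI_ex)
  then show "L1_fun T (weak_deriv T u)" ..
  show "u x = u 0 + integral {0..x} (weak_deriv T u)" if "x \<in> {0..T}" for x
    using * that assms by (intro has_weak_deriv_imp_indefinite_integral) auto
qed

lemma indefinite_integral_W11:
  fixes u g :: "real \<Rightarrow> 'a::euclidean_space"
  assumes T: "T > 0" and g: "L1_fun T g" and u: "\<And>x. x \<in> {0..T} \<Longrightarrow> u x = u 0 + integral {0..x} g"
  shows "continuous_on {0..T} u" "W11_fun T u" "AE t in leb_interval T. weak_deriv T u t = g t"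
proof -
  have gI: "g integrable_on {0..T}" using g by (simp add: integrable_leb_interval_iff absolutely_integrable_on_def)
  have "continuous_on {0..T} (\<lambda>x. u 0 + integral {0..x} g)" by (intro continuous_intros indefinite_integral_continuous_1 gI)
  then show cu: "continuous_on {0..T} u" by (rule continuous_on_eq) (rule u[symmetric])
  show W: "W11_fun T u"
    using indefinite_integral_has_weak_deriv[OF assms] g continuous_integrable_leb_interval[OF cu] by (auto simp: W11_fun_def)
  show "AE t in leb_interval T. weak_deriv T u t = g t"
    by (rule AE_eq_of_interval_integrals[OF W11_weak_deriv(1)[OF W cu T] g])
       (use W11_weak_deriv(2)[OF W cu T] u in \<open>metis add_left_cancel\<close>)
qed

section \<open>Weak convergence in \<open>L\<^sup>r(0,T)\<close>\<close>

text \<open>This inequality with a free parameter \<open>K\<close> replaces Hoelder's inequality below.\<close>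
lemma norm_le_powr_split:
  fixes x :: "'a::real_normed_vector"
  assumes "K > 0" "r > 1"
  shows "norm x \<le> K + K powr (1 - r) * norm x powr r"
proof (cases "norm x \<le> K")
  case True
  then show ?thesis by (simp add: add_increasing2)
next
  case False
  have "K powr (1 - r) * norm x powr r = norm x * (norm x / K) powr (r - 1)"
    using assms False by (simp add: powr_diff powr_divide)
  moreover have "1 \<le> (norm x / K) powr (r - 1)"
    using assms False by (intro ge_one_powr_ge_zero) auto
  ultimately have "norm x \<le> K powr (1 - r) * norm x powr r" by (simp add: mult_le_cancel_left1)
  then show ?thesis using assms by simp
qed

lemma finite_measure_leb_interval: "finite_measure (leb_interval T)"
  by (rule finite_measureI, cases "0 \<le> T") (auto simp: emeasure_restrict_space)

lemma measure_leb_interval: "T \<ge> 0 \<Longrightarrow> measure (leb_interval T) {0<..<T} = T"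
  by (simp add: measure_restrict_space)

lemma integrable_const_leb [simp]: "integrable (leb_interval T) (\<lambda>_. c :: 'a::euclidean_space)"
proof -
  interpret finite_measure "leb_interval T" by (rule finite_measure_leb_interval)
  show ?thesis by simp
qed

lemma Lp_fun_eq: "Lp_fun r T f \<longleftrightarrow> Lr_fun (leb_interval T) r f"
  by (simp add: Lp_fun_def Lr_fun_def)

lemma Lr_fun_L1:
  assumes f: "Lr_fun (leb_interval T) r f" and r: "r > 1"
  shows "L1_fun T f"
proof (rule Bochner_Integration.integrable_bound[of _ "\<lambda>t. 1 + 1 powr (1 - r) * norm (f t) powr r"])
  show "AE t in leb_interval T. norm (f t) \<le> norm (1 + 1 powr (1 - r) * norm (f t) powr r)"
    using norm_le_powr_split[of 1 r, OF _ r] by (intro AE_I2) auto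
qed (use f in \<open>auto simp: Lr_fun_def\<close>)

lemma L1_norm_le:
  assumes f: "Lr_fun (leb_interval T) r f" and r: "r > 1" and T: "T \<ge> 0" and K: "K > 0"
  shows "(\<integral>t. norm (f t) \<partial>leb_interval T) \<le> K * T + K powr (1 - r) * (\<integral>t. norm (f t) powr r \<partial>leb_interval T)"
proof -
  have "(\<integral>t. norm (f t) \<partial>leb_interval T) \<le> (\<integral>t. K + K powr (1 - r) * norm (f t) powr r \<partial>leb_interval T)"
    using f Lr_fun_L1[OF f r] norm_le_powr_split[OF K r] by (intro integral_mono) (auto simp: Lr_fun_def)
  also have "\<dots> = K * T + K powr (1 - r) * (\<integral>t. norm (f t) powr r \<partial>leb_interval T)"
    using f T by (subst Bochner_Integration.integral_add) (auto simp: Lr_fun_def measure_leb_interval)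
  finally show ?thesis .
qed

lemma Lr_conv_imp_L1_conv:
  assumes d: "\<And>k. Lr_fun (leb_interval T) r (d k)" and r: "r > 1" and T: "T > 0"
    and lim: "(\<lambda>k. \<integral>t. norm (d k t) powr r \<partial>leb_interval T) \<longlonglongrightarrow> 0"
  shows "(\<lambda>k. \<integral>t. norm (d k t) \<partial>leb_interval T) \<longlonglongrightarrow> 0"
proof (rule LIMSEQ_I)
  fix e :: real assume e: "e > 0"
  define K where "K = e / (2 * T)"
  have K: "K > 0" "K * T = e / 2" using e T by (auto simp: K_def)
  have "(\<lambda>k. K powr (1 - r) * (\<integral>t. norm (d k t) powr r \<partial>leb_interval T)) \<longlonglongrightarrow> 0"
    by (rule tendsto_mult_right_zero[OF lim])
  then have "\<forall>\<^sub>F k in sequentially. K powr (1 - r) * (\<integral>t. norm (d k t) powr r \<partial>leb_interval T) < e / 2"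
    using e by (intro order_tendstoD) auto
  then obtain n0 where n0: "\<And>k. k \<ge> n0 \<Longrightarrow> K powr (1 - r) * (\<integral>t. norm (d k t) powr r \<partial>leb_interval T) < e / 2"
    by (auto simp: eventually_sequentially)
  show "\<exists>n0. \<forall>k\<ge>n0. norm ((\<integral>t. norm (d k t) \<partial>leb_interval T) - 0) < e"
  proof (intro exI[of _ n0] allI impI)
    fix k assume "k \<ge> n0"
    have "0 \<le> (\<integral>t. norm (d k t) \<partial>leb_interval T)" by simp
    then show "norm ((\<integral>t. norm (d k t) \<partial>leb_interval T) - 0) < e"
      using L1_norm_le[OF d r _ K(1), of k] T K(2) n0[OF \<open>k \<ge> n0\<close>] by simp
  qed
qed

lemma interval_integral_norm_le:
  fixes f :: "real \<Rightarrow> 'a::euclidean_space"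
  assumes "L1_fun T f" "0 \<le> s" "t \<le> T"
  shows "norm (integral {s..t} f) \<le> (\<integral>x. norm (f x) \<partial>leb_interval T)"
proof -
  note i = interval_integral_eq_indicator[OF assms]
  have "norm (integral {s..t} f) \<le> (\<integral>x. norm (indicator {s..t} x *\<^sub>R f x) \<partial>leb_interval T)"
    unfolding i(1) by (rule integral_norm_bound)
  also have "\<dots> \<le> (\<integral>x. norm (f x) \<partial>leb_interval T)"
    using i(2) assms(1) by (intro integral_mono integrable_norm) (auto simp: indicator_def)
  finally show ?thesis .
qed

lemma L1_conv_interval_integrals:
  fixes h :: "nat \<Rightarrow> real \<Rightarrow> 'a::euclidean_space"
  assumes h: "\<And>k. L1_fun T (h k)" and g: "L1_fun T g" and st: "0 \<le> s" "t \<le> T"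
    and lim: "(\<lambda>k. \<integral>x. norm (h k x - g x) \<partial>leb_interval T) \<longlonglongrightarrow> 0"
  shows "(\<lambda>k. integral {s..t} (h k)) \<longlonglongrightarrow> integral {s..t} g"
proof (rule LIM_zero_cancel, rule Lim_null_comparison[OF always_eventually lim], rule allI)
  fix k
  have "h k integrable_on {s..t}" "g integrable_on {s..t}"
    using integrable_leb_interval_subset[OF h st] integrable_leb_interval_subset[OF g st]
    by (auto intro: integrable_on_lebesgue_on)
  then have "integral {s..t} (h k) - integral {s..t} g = integral {s..t} (\<lambda>x. h k x - g x)"
    by (simp add: Henstock_Kurzweil_Integration.integral_diff)
  then show "norm (integral {s..t} (h k) - integral {s..t} g) \<le> (\<integral>x. norm (h k x - g x) \<partial>leb_interval T)"
    using interval_integral_norm_le[of T "\<lambda>x. h k x - g x" s t] h g st by simp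
qed

lemma mids_interval_integrals:
  fixes f :: "nat \<Rightarrow> real \<Rightarrow> 'a::euclidean_space"
  assumes f: "\<And>n. L1_fun T (f n)" and st: "0 \<le> s" "t \<le> T"
    and lim: "(\<lambda>n. integral {s..t} (f n)) \<longlonglongrightarrow> U"
    and h: "\<And>k. h k \<in> mids f k"
  shows "(\<lambda>k. integral {s..t} (h k)) \<longlonglongrightarrow> U"
proof (rule LIMSEQ_I)
  fix e :: real assume e: "e > 0"
  obtain n0 where n0: "\<And>n. n \<ge> n0 \<Longrightarrow> norm (integral {s..t} (f n) - U) < e" using LIMSEQ_D[OF lim e] by blast
  have key: "L1_fun T y \<and> norm (integral {s..t} y - U) < e" if "y \<in> mids f n0" for y
    using that
  proof induction
    case (mid x y)
    have "x integrable_on {s..t}" "y integrable_on {s..t}"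
      using integrable_leb_interval_subset[OF conjunct1[OF mid.IH(1)] st]
        integrable_leb_interval_subset[OF conjunct1[OF mid.IH(2)] st] by (auto intro: integrable_on_lebesgue_on)
    then have "integral {s..t} (\<lambda>t. (1/2) *\<^sub>R (x t + y t)) = (1/2) *\<^sub>R (integral {s..t} x + integral {s..t} y)"
      by (simp add: Henstock_Kurzweil_Integration.integral_add)
    moreover have "U = (1/2) *\<^sub>R (U + U)" by simp
    ultimately have "integral {s..t} (\<lambda>t. (1/2) *\<^sub>R (x t + y t)) - U =
        (1/2) *\<^sub>R (integral {s..t} x + integral {s..t} y) - (1/2) *\<^sub>R (U + U)" by metis
    also have "\<dots> = (1/2) *\<^sub>R ((integral {s..t} x - U) + (integral {s..t} y - U))"
      by (simp only: scaleR_diff_right[symmetric]) (simp add: algebra_simps)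
    also have "norm \<dots> \<le> (norm (integral {s..t} x - U) + norm (integral {s..t} y - U)) / 2"
      using norm_triangle_ineq[of "integral {s..t} x - U" "integral {s..t} y - U"] by simp
    also have "\<dots> < e" using mid by simp
    finally show ?case using mid by simp
  qed (use f n0 in auto)
  show "\<exists>n0. \<forall>k\<ge>n0. norm (integral {s..t} (h k) - U) < e"
    using key h mids_mono[of n0 _ f] by (intro exI[of _ n0]) blast
qed

lemma mids_AE_bound:
  assumes "\<And>n. AE t in M. norm (f n t) \<le> C" "y \<in> mids f k"
  shows "AE t in M. norm (y t) \<le> (C :: real)"
  using assms(2)
proof induction
  case (mid x y)
  from mid(3,4) show ?case
  proof eventually_elim
    fix t assume "norm (x t) \<le> C" "norm (y t) \<le> C"
    then show "norm ((1/2) *\<^sub>R (x t + y t)) \<le> C" using norm_triangle_ineq[of "x t" "y t"] by simp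
  qed
qed (use assms in auto)

text \<open>The weak limit is the strong limit of iterated midpoints; integrals over \<open>[0, x]\<close> identify it.\<close>
lemma weak_limit_exists:
  fixes f :: "nat \<Rightarrow> real \<Rightarrow> 'a::euclidean_space"
  assumes r: "r > 1" and T: "T > 0" and f: "\<And>n. Lr_fun (leb_interval T) r (f n)"
    and B: "\<And>n. (\<integral>t. norm (f n t) powr r \<partial>leb_interval T) \<le> B"
    and lim: "\<forall>x\<in>{0..T}. (\<lambda>n. integral {0..x} (f n)) \<longlonglongrightarrow> U x"
  shows "\<exists>g h. Lr_fun (leb_interval T) r g \<and> (\<forall>x\<in>{0..T}. integral {0..x} g = U x) \<and>
    (\<forall>k. h k \<in> mids f k) \<and> (\<forall>k. Lr_fun (leb_interval T) r (h k)) \<and>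
    (AE t in leb_interval T. (\<lambda>k. h k t) \<longlonglongrightarrow> g t) \<and>
    (\<lambda>k. \<integral>t. norm (h k t - g t) powr r \<partial>leb_interval T) \<longlonglongrightarrow> 0"
proof -
  obtain h g where h: "\<And>k. h k \<in> mids f k" "\<And>k. Lr_fun (leb_interval T) r (h k)" and g: "Lr_fun (leb_interval T) r g" 
    and lims: "AE t in leb_interval T. (\<lambda>k. h k t) \<longlonglongrightarrow> g t"
    "(\<lambda>k. \<integral>t. norm (h k t - g t) powr r \<partial>leb_interval T) \<longlonglongrightarrow> 0"
    using Mazur_midpoints[OF r, of "leb_interval T" f B, OF f B] by blast
  have d: "Lr_fun (leb_interval T) r (\<lambda>t. h k t - g t)" for k using h g r by (intro Lr_fun_diff) auto
  have "integral {0..x} g = U x" if x: "x \<in> {0..T}" for x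
  proof (rule LIMSEQ_unique)
    show "(\<lambda>k. integral {0..x} (h k)) \<longlonglongrightarrow> integral {0..x} g"
      by (rule L1_conv_interval_integrals[OF Lr_fun_L1[OF h(2) r] Lr_fun_L1[OF g r] _ _ Lr_conv_imp_L1_conv[OF d r T lims(2)]])
         (use x in auto)
    show "(\<lambda>k. integral {0..x} (h k)) \<longlonglongrightarrow> U x"
      by (rule mids_interval_integrals[OF Lr_fun_L1[OF f r] _ _ bspec[OF lim x] h(1)]) (use x in auto)
  qed
  then show ?thesis using g h lims by (intro exI[of _ g] exI[of _ h]) simp
qed

text \<open>Weak convergence without a representation of the dual space. A functional \<open>F\<close> that stays above
  \<open>F g + e\<close> along a subsequence does so on all iterated midpoints of that subsequence. These converge
  strongly to a function with the same interval integrals as \<open>g\<close>, that is, to \<open>g\<close>, which is a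
  contradiction as soon as \<open>F\<close> is continuous for strong convergence. The predicate \<open>P\<close> restricts the class of
  functions on which \<open>F\<close> has to behave well, so that the principle also covers \<open>*\<close>-weak
  convergence.\<close>
context
  fixes r T B :: real and f :: "nat \<Rightarrow> real \<Rightarrow> 'a::euclidean_space" and g :: "real \<Rightarrow> 'a"
  assumes r: "r > 1" and T: "T > 0" and f: "\<And>n. Lr_fun (leb_interval T) r (f n)"
    and B: "\<And>n. (\<integral>t. norm (f n t) powr r \<partial>leb_interval T) \<le> B"
    and g: "Lr_fun (leb_interval T) r g"
    and lim: "\<And>x. x \<in> {0..T} \<Longrightarrow> (\<lambda>n. integral {0..x} (f n)) \<longlonglongrightarrow> integral {0..x} g"
begin

lemma weak_convergence_upper:
  fixes F :: "(real \<Rightarrow> 'a) \<Rightarrow> real"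
  assumes P: "\<And>n. P (f n)" "\<And>x y. P x \<Longrightarrow> P y \<Longrightarrow> P (\<lambda>t. (1/2) *\<^sub>R (x t + y t))"
    and F: "\<And>x y. P x \<Longrightarrow> P y \<Longrightarrow> F (\<lambda>t. (1/2) *\<^sub>R (x t + y t)) \<ge> (F x + F y) / 2"
    and cont: "\<And>h. (\<And>k. P (h k)) \<Longrightarrow> (\<And>k. Lr_fun (leb_interval T) r (h k)) \<Longrightarrow>
       AE t in leb_interval T. (\<lambda>k. h k t) \<longlonglongrightarrow> g t \<Longrightarrow>
       (\<lambda>k. \<integral>t. norm (h k t - g t) powr r \<partial>leb_interval T) \<longlonglongrightarrow> 0 \<Longrightarrow> (\<lambda>k. F (h k)) \<longlonglongrightarrow> F g"
    and e: "e > 0"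
  shows "\<forall>\<^sub>F n in sequentially. F (f n) < F g + e"
proof (rule ccontr)
  assume "\<not> ?thesis"
  then obtain s :: "nat \<Rightarrow> nat" where s: "strict_mono s" "\<And>n. \<not> F (f (s n)) < F g + e"
    using not_eventually_sequentiallyD by blast
  let ?f = "\<lambda>n. f (s n)"
  have lim': "\<forall>x\<in>{0..T}. (\<lambda>n. integral {0..x} (?f n)) \<longlonglongrightarrow> integral {0..x} g"
    using LIMSEQ_subseq_LIMSEQ[OF lim s(1)] by (auto simp: o_def)
  from weak_limit_exists[OF r T, of ?f B "\<lambda>x. integral {0..x} g", OF f B lim']
  obtain g' h where H: "Lr_fun (leb_interval T) r g' \<and> (\<forall>x\<in>{0..T}. integral {0..x} g' = integral {0..x} g) \<and>
    (\<forall>k. h k \<in> mids ?f k) \<and> (\<forall>k. Lr_fun (leb_interval T) r (h k)) \<and>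
    (AE t in leb_interval T. (\<lambda>k. h k t) \<longlonglongrightarrow> g' t) \<and>
    (\<lambda>k. \<integral>t. norm (h k t - g' t) powr r \<partial>leb_interval T) \<longlonglongrightarrow> 0"
    by (elim exE)
  then have g': "Lr_fun (leb_interval T) r g'" "\<And>x. x \<in> {0..T} \<Longrightarrow> integral {0..x} g' = integral {0..x} g"
    and h: "\<And>k. h k \<in> mids ?f k" "\<And>k. Lr_fun (leb_interval T) r (h k)"
    and lims: "AE t in leb_interval T. (\<lambda>k. h k t) \<longlonglongrightarrow> g' t"
      "(\<lambda>k. \<integral>t. norm (h k t - g' t) powr r \<partial>leb_interval T) \<longlonglongrightarrow> 0"
    by blast+
  have ae: "AE t in leb_interval T. g' t = g t"
    by (rule AE_eq_of_interval_integrals[OF Lr_fun_L1[OF g'(1) r] Lr_fun_L1[OF g r] g'(2)])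
  have mP: "P y \<and> F y \<ge> F g + e" if "y \<in> mids ?f k" for y k
    using that
  proof induction
    case (base m)
    then show ?case using P(1) s(2)[of m] by auto
  next
    case (mid x y)
    then show ?case using P(2)[of x y] F[of x y] by auto
  qed
  have "(\<lambda>k. F (h k)) \<longlonglongrightarrow> F g"
  proof (rule cont)
    show "AE t in leb_interval T. (\<lambda>k. h k t) \<longlonglongrightarrow> g t" using lims(1) ae by eventually_elim simp
    have "(\<integral>t. norm (h k t - g' t) powr r \<partial>leb_interval T) = (\<integral>t. norm (h k t - g t) powr r \<partial>leb_interval T)" for k
    proof (rule integral_cong_AE)
      show "AE t in leb_interval T. norm (h k t - g' t) powr r = norm (h k t - g t) powr r"
        using ae by eventually_elim simp
    qed (use Lr_funD(1)[OF h(2)[of k]] Lr_funD(1)[OF g] Lr_funD(1)[OF g'(1)] in \<open>measurable\<close>)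
    then show "(\<lambda>k. \<integral>t. norm (h k t - g t) powr r \<partial>leb_interval T) \<longlonglongrightarrow> 0" using lims(2) by simp
  qed (use mP[OF h(1)] h(2) in auto)
  then have "F g + e \<le> F g" using mP[OF h(1)] by (intro LIMSEQ_le_const) auto
  then show False using e by simp
qed

lemma weak_convergence_principle:
  fixes F :: "(real \<Rightarrow> 'a) \<Rightarrow> real"
  assumes P: "\<And>n. P (f n)" "\<And>x y. P x \<Longrightarrow> P y \<Longrightarrow> P (\<lambda>t. (1/2) *\<^sub>R (x t + y t))"
    and F: "\<And>x y. P x \<Longrightarrow> P y \<Longrightarrow> F (\<lambda>t. (1/2) *\<^sub>R (x t + y t)) = (F x + F y) / 2"
    and cont: "\<And>h. (\<And>k. P (h k)) \<Longrightarrow> (\<And>k. Lr_fun (leb_interval T) r (h k)) \<Longrightarrow>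
       AE t in leb_interval T. (\<lambda>k. h k t) \<longlonglongrightarrow> g t \<Longrightarrow>
       (\<lambda>k. \<integral>t. norm (h k t - g t) powr r \<partial>leb_interval T) \<longlonglongrightarrow> 0 \<Longrightarrow> (\<lambda>k. F (h k)) \<longlonglongrightarrow> F g"
  shows "(\<lambda>n. F (f n)) \<longlonglongrightarrow> F g"
proof (rule LIMSEQ_I)
  fix e :: real assume e: "e > 0"
  have 1: "\<forall>\<^sub>F n in sequentially. F (f n) < F g + e"
    by (rule weak_convergence_upper[where P = P and F = F]) (use P F cont e in auto)
  have 2: "\<forall>\<^sub>F n in sequentially. - F (f n) < - F g + e"
    by (rule weak_convergence_upper[where P = P and F = "\<lambda>f. - F f"])
       (use P F cont e in \<open>auto intro!: tendsto_minus simp: field_simps\<close>)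
  have "\<forall>\<^sub>F n in sequentially. norm (F (f n) - F g) < e"
    using 1 2 by eventually_elim (simp add: abs_less_iff)
  then show "\<exists>n0. \<forall>n\<ge>n0. norm (F (f n) - F g) < e" by (simp add: eventually_sequentially)
qed

lemma Lp_weak_convI:
  shows "Lp_weak_conv r T f g"
  unfolding Lp_weak_conv_def Lp_fun_eq
proof (intro conjI allI impI f g)
  fix F :: "(real \<Rightarrow> 'a) \<Rightarrow> real" assume "Lp_dual r T F"
  then obtain C where add: "\<And>x y. Lr_fun (leb_interval T) r x \<Longrightarrow> Lr_fun (leb_interval T) r y \<Longrightarrow> F (\<lambda>t. x t + y t) = F x + F y"
    and scale: "\<And>c x. Lr_fun (leb_interval T) r x \<Longrightarrow> F (\<lambda>t. c *\<^sub>R x t) = c * F x"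
    and bound: "\<And>x. Lr_fun (leb_interval T) r x \<Longrightarrow> \<bar>F x\<bar> \<le> C * Lp_norm r T x"
    unfolding Lp_dual_def Lp_fun_eq by blast
  show "(\<lambda>n. F (f n)) \<longlonglongrightarrow> F g"
  proof (rule weak_convergence_principle[where P = "Lr_fun (leb_interval T) r"])
    fix h :: "nat \<Rightarrow> real \<Rightarrow> 'a" assume h: "\<And>k. Lr_fun (leb_interval T) r (h k)"
      "(\<lambda>k. \<integral>t. norm (h k t - g t) powr r \<partial>leb_interval T) \<longlonglongrightarrow> 0"
    have "(\<lambda>k. C * (\<integral>t. norm (h k t - g t) powr r \<partial>leb_interval T) powr (1 / r)) \<longlonglongrightarrow> C * 0 powr (1 / r)"
      using r by (intro tendsto_intros tendsto_powr2 h(2)) auto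
    then have lim0: "(\<lambda>k. C * Lp_norm r T (\<lambda>t. h k t - g t)) \<longlonglongrightarrow> 0" by (simp add: Lp_norm_def)
    show "(\<lambda>k. F (h k)) \<longlonglongrightarrow> F g"
    proof (rule LIM_zero_cancel, rule Lim_null_comparison[OF always_eventually lim0], rule allI)
      fix k
      have d: "Lr_fun (leb_interval T) r (\<lambda>t. h k t - g t)" using h g r by (intro Lr_fun_diff) auto
      have "F (\<lambda>t. (h k t - g t) + g t) = F (\<lambda>t. h k t - g t) + F g" by (rule add[OF d g])
      then have "F (h k) - F g = F (\<lambda>t. h k t - g t)" by simp
      then show "norm (F (h k) - F g) \<le> C * Lp_norm r T (\<lambda>t. h k t - g t)" using bound[OF d] by simp
    qed
  next
    fix x y :: "real \<Rightarrow> 'a" assume xy: "Lr_fun (leb_interval T) r x" "Lr_fun (leb_interval T) r y"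
    then have s: "Lr_fun (leb_interval T) r (\<lambda>t. x t + y t)" using r by (intro Lr_fun_add) auto
    then show "Lr_fun (leb_interval T) r (\<lambda>t. (1/2) *\<^sub>R (x t + y t))" by (rule Lr_fun_scale)
    show "F (\<lambda>t. (1/2) *\<^sub>R (x t + y t)) = (F x + F y) / 2" using scale[OF s, of "1/2"] add[OF xy] by simp
  qed (use f in auto)
qed

lemma Linf_weak_star_convI:
  assumes C: "\<And>n. AE t in leb_interval T. norm (f n t) \<le> C" and gC: "AE t in leb_interval T. norm (g t) \<le> C"
  shows "Linf_weak_star_conv T f g"
  unfolding Linf_weak_star_conv_def Linf_fun_def
proof (intro conjI allI impI)
  fix z :: "real \<Rightarrow> 'a" assume z: "L1_fun T z"
  note [measurable] = borel_measurable_integrable[OF z] Lr_funD(1)[OF g]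
  let ?P = "\<lambda>x. x \<in> borel_measurable (leb_interval T) \<and> (AE t in leb_interval T. norm (x t) \<le> C)"
  show "(\<lambda>n. \<integral>t. f n t \<bullet> z t \<partial>leb_interval T) \<longlonglongrightarrow> (\<integral>t. g t \<bullet> z t \<partial>leb_interval T)"
  proof (rule weak_convergence_principle[where P = ?P and F = "\<lambda>x. \<integral>t. x t \<bullet> z t \<partial>leb_interval T"])
    fix h :: "nat \<Rightarrow> real \<Rightarrow> 'a" assume h: "\<And>k. ?P (h k)" "AE t in leb_interval T. (\<lambda>k. h k t) \<longlonglongrightarrow> g t"
    have [measurable]: "h k \<in> borel_measurable (leb_interval T)" for k using h by simp
    show "(\<lambda>k. \<integral>t. h k t \<bullet> z t \<partial>leb_interval T) \<longlonglongrightarrow> (\<integral>t. g t \<bullet> z t \<partial>leb_interval T)"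
    proof (rule integral_dominated_convergence[where w = "\<lambda>t. C * norm (z t)"])
      show "AE t in leb_interval T. (\<lambda>k. h k t \<bullet> z t) \<longlonglongrightarrow> g t \<bullet> z t"
        using h(2) by eventually_elim (intro tendsto_intros)
      fix k
      have "AE t in leb_interval T. norm (h k t) \<le> C" using h by simp
      then show "AE t in leb_interval T. norm (h k t \<bullet> z t) \<le> C * norm (z t)"
      proof eventually_elim
        fix t assume "norm (h k t) \<le> C"
        then have "norm (h k t) * norm (z t) \<le> C * norm (z t)" by (intro mult_right_mono) auto
        then show "norm (h k t \<bullet> z t) \<le> C * norm (z t)" using Cauchy_Schwarz_ineq2[of "h k t" "z t"] by simp
      qed
    qed (use z in auto)
  next
    fix x y :: "real \<Rightarrow> 'a" assume xy: "?P x" "?P y"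
    then have "AE t in leb_interval T. norm (x t) \<le> C" "AE t in leb_interval T. norm (y t) \<le> C" by auto
    then have "AE t in leb_interval T. norm ((1/2) *\<^sub>R (x t + y t)) \<le> C"
    proof eventually_elim
      fix t assume "norm (x t) \<le> C" "norm (y t) \<le> C"
      then show "norm ((1/2) *\<^sub>R (x t + y t)) \<le> C" using norm_triangle_ineq[of "x t" "y t"] by simp
    qed
    then show "?P (\<lambda>t. (1/2) *\<^sub>R (x t + y t))" using xy by auto
    have "integrable (leb_interval T) (\<lambda>t. x t \<bullet> z t)" "integrable (leb_interval T) (\<lambda>t. y t \<bullet> z t)"
      using bounded_inner_integrable(1)[OF z] xy by auto
    then show "(\<integral>t. ((1/2) *\<^sub>R (x t + y t)) \<bullet> z t \<partial>leb_interval T) = ((\<integral>t. x t \<bullet> z t \<partial>leb_interval T) + (\<integral>t. y t \<bullet> z t \<partial>leb_interval T)) / 2"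
      by (simp add: inner_add_left)
  qed (use f C in auto)
qed (use f g C gC in auto)

lemma bounded_test_convergence:
  assumes z: "z \<in> borel_measurable (leb_interval T)" "AE t in leb_interval T. norm (z t) \<le> C"
  shows "(\<lambda>n. \<integral>t. z t \<bullet> f n t \<partial>leb_interval T) \<longlonglongrightarrow> (\<integral>t. z t \<bullet> g t \<partial>leb_interval T)"
proof (rule weak_convergence_principle[where P = "Lr_fun (leb_interval T) r" and F = "\<lambda>x. \<integral>t. z t \<bullet> x t \<partial>leb_interval T"])
  note bi = bounded_inner_integrable[OF _ z]
  fix h :: "nat \<Rightarrow> real \<Rightarrow> 'a" assume h: "\<And>k. Lr_fun (leb_interval T) r (h k)"
    "(\<lambda>k. \<integral>t. norm (h k t - g t) powr r \<partial>leb_interval T) \<longlonglongrightarrow> 0"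
  have d: "Lr_fun (leb_interval T) r (\<lambda>t. h k t - g t)" for k using h g r by (intro Lr_fun_diff) auto
  have lim0: "(\<lambda>k. C * (\<integral>t. norm (h k t - g t) \<partial>leb_interval T)) \<longlonglongrightarrow> 0"
    by (intro tendsto_mult_right_zero Lr_conv_imp_L1_conv[OF d r T h(2)])
  show "(\<lambda>k. \<integral>t. z t \<bullet> h k t \<partial>leb_interval T) \<longlonglongrightarrow> (\<integral>t. z t \<bullet> g t \<partial>leb_interval T)"
  proof (rule LIM_zero_cancel, rule Lim_null_comparison[OF always_eventually lim0], rule allI)
    fix k
    have "(\<integral>t. z t \<bullet> h k t \<partial>leb_interval T) - (\<integral>t. z t \<bullet> g t \<partial>leb_interval T) = (\<integral>t. z t \<bullet> (h k t - g t) \<partial>leb_interval T)"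
      using bi(1)[OF Lr_fun_L1[OF h(1) r]] bi(1)[OF Lr_fun_L1[OF g r]] by (simp add: inner_diff_right)
    then show "norm ((\<integral>t. z t \<bullet> h k t \<partial>leb_interval T) - (\<integral>t. z t \<bullet> g t \<partial>leb_interval T)) \<le> C * (\<integral>t. norm (h k t - g t) \<partial>leb_interval T)"
      using bi(2)[OF Lr_fun_L1[OF d r]] by simp
  qed
next
  note bi = bounded_inner_integrable[OF _ z]
  fix x y :: "real \<Rightarrow> 'a" assume xy: "Lr_fun (leb_interval T) r x" "Lr_fun (leb_interval T) r y"
  then show "Lr_fun (leb_interval T) r (\<lambda>t. (1/2) *\<^sub>R (x t + y t))" using r by (intro Lr_fun_scale Lr_fun_add) auto
  show "(\<integral>t. z t \<bullet> ((1/2) *\<^sub>R (x t + y t)) \<partial>leb_interval T) = ((\<integral>t. z t \<bullet> x t \<partial>leb_interval T) + (\<integral>t. z t \<bullet> y t \<partial>leb_interval T)) / 2"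
    using bi(1)[OF Lr_fun_L1[OF xy(1) r]] bi(1)[OF Lr_fun_L1[OF xy(2) r]] by (simp add: inner_add_right)
qed (use f in auto)

end

lemma interval_integral_norm_split:
  fixes f :: "real \<Rightarrow> 'a::euclidean_space"
  assumes r: "r > 1" and f: "Lr_fun (leb_interval T) r f"
    and st: "0 \<le> s" "s \<le> t" "t \<le> T" and K: "K > 0"
  shows "norm (integral {s..t} f) \<le> K * (t - s) + K powr (1 - r) * integral {s..t} (\<lambda>x. norm (f x) powr r)"
proof -
  note L1 = Lr_fun_L1[OF f r] and n = Lr_funD(2)[OF f]
  note nI = integrable_leb_interval_subset[OF n st(1,3)]
  have "norm (integral {s..t} f) \<le> (\<integral>x. norm (f x) \<partial>lebesgue_on {s..t})"
    using interval_integral_eq_lebesgue[OF L1 st(1,3)] integral_norm_bound by metis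
  also have "\<dots> \<le> (\<integral>x. K + K powr (1 - r) * norm (f x) powr r \<partial>lebesgue_on {s..t})"
    using integrable_leb_interval_subset[OF L1 st(1,3)] nI
      integrable_leb_interval_subset[OF integrable_const_leb st(1,3), of K] norm_le_powr_split[OF K r]
    by (intro integral_mono) auto
  also have "\<dots> = K * (t - s) + K powr (1 - r) * integral {s..t} (\<lambda>x. norm (f x) powr r)"
    using nI integrable_leb_interval_subset[OF integrable_const_leb st(1,3), of K]
      st interval_integral_eq_lebesgue[OF n st(1,3)]
    by (subst Bochner_Integration.integral_add) (auto simp: measure_restrict_space)
  finally show ?thesis .
qed

lemma powr_small_multiple:
  fixes G :: real
  assumes "r > 1" "e > 0"
  obtains K where "K > 0" "K powr (1 - r) * G < e"
proof -
  have "((\<lambda>K. K powr (1 - r) * G) \<longlongrightarrow> 0 * G) at_top"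
    using assms by (intro tendsto_intros tendsto_neg_powr filterlim_ident) auto
  then have "\<forall>\<^sub>F K in at_top. K powr (1 - r) * G < e" using assms by (intro order_tendstoD) auto
  then have "\<forall>\<^sub>F K in at_top. 0 < K \<and> K powr (1 - r) * G < e"
    using eventually_gt_at_top[of "0::real"] by eventually_elim simp
  then show ?thesis using that by (auto dest: eventually_happens)
qed

lemma integral_diff_eq_interval:
  fixes f :: "real \<Rightarrow> 'a::euclidean_space"
  assumes "L1_fun T f" "0 \<le> s" "s \<le> t" "t \<le> T"
  shows "integral {s..t} f = integral {0..t} f - integral {0..s} f"
proof -
  have "f integrable_on {0..T}" using assms(1) by (simp add: integrable_leb_interval_iff absolutely_integrable_on_def)
  then have "integral {0..s} f + integral {s..t} f = integral {0..t} f"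
    using assms by (intro Henstock_Kurzweil_Integration.integral_combine) (auto intro: integrable_on_subinterval)
  then show ?thesis by (simp add: algebra_simps)
qed

text \<open>Indefinite integrals of functions in \<open>L\<^sup>r\<close>, \<open>r > 1\<close>, are absolutely continuous: a bound linear in the
  total length for the part of size at most \<open>K\<close>, and a bound uniform in the intervals for the rest.\<close>
lemma Lr_abs_cont:
  fixes u g :: "real \<Rightarrow> 'a::euclidean_space"
  assumes r: "r > 1" and T: "T > 0" and g: "Lr_fun (leb_interval T) r g"
    and u: "\<And>x. x \<in> {0..T} \<Longrightarrow> u x = u 0 + integral {0..x} g"
  shows "abs_cont_on 0 T u"
  unfolding abs_cont_on_def
proof (intro allI impI)
  fix e :: real assume e: "e > 0"
  define G where "G = (\<integral>t. norm (g t) powr r \<partial>leb_interval T)"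
  have G0: "G \<ge> 0" by (simp add: G_def)
  obtain K where K: "K > 0" "K powr (1 - r) * G < e / 2" using powr_small_multiple[OF r, of "e / 2" G] e by auto
  note gL1 = Lr_fun_L1[OF g r]
  note nL1 = Lr_funD(2)[OF g]
  let ?G = "\<lambda>t. norm (g t) powr r"
  show "\<exists>\<delta>>0. \<forall>D :: (real \<times> real) set.
        finite D \<and> (\<forall>(s, t)\<in>D. 0 \<le> s \<and> s \<le> t \<and> t \<le> T) \<and>
        pairwise (\<lambda>I J. disjnt {fst I<..<snd I} {fst J<..<snd J}) D \<and>
        (\<Sum>(s, t)\<in>D. t - s) < \<delta> \<longrightarrow> (\<Sum>(s, t)\<in>D. norm (u t - u s)) < e"
  proof (intro exI[of _ "e / (2 * K)"] conjI allI impI)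
    show "e / (2 * K) > 0" using e K by simp
    fix D :: "(real \<times> real) set"
    assume D: "finite D \<and> (\<forall>(s, t)\<in>D. 0 \<le> s \<and> s \<le> t \<and> t \<le> T) \<and>
        pairwise (\<lambda>I J. disjnt {fst I<..<snd I} {fst J<..<snd J}) D \<and> (\<Sum>(s, t)\<in>D. t - s) < e / (2 * K)"
    have st: "norm (u t - u s) \<le> K * (t - s) + K powr (1 - r) * (\<integral>x. indicator {s<..<t} x * ?G x \<partial>leb_interval T)"
      and ii: "integrable (leb_interval T) (\<lambda>x. indicator {s<..<t} x * ?G x)"
      if "(s, t) \<in> D" for s t
    proof -
      have b: "0 \<le> s" "s \<le> t" "t \<le> T" using D that by auto
      have "u t - u s = integral {s..t} g"
        using u[of s] u[of t] b integral_diff_eq_interval[OF gL1 b] by simp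
      also have "norm \<dots> \<le> K * (t - s) + K powr (1 - r) * integral {s..t} ?G"
        by (rule interval_integral_norm_split[OF r g b K(1)])
      also have "integral {s..t} ?G = (\<integral>x. indicator {s..t} x *\<^sub>R ?G x \<partial>leb_interval T)"
        by (rule interval_integral_eq_indicator[OF nL1 b(1,3)])
      also have "\<dots> = (\<integral>x. indicator {s<..<t} x * ?G x \<partial>leb_interval T)"
      proof (rule integral_cong_AE)
        show "AE x in leb_interval T. indicator {s..t} x *\<^sub>R ?G x = indicator {s<..<t} x * ?G x"
          by (rule AE_lebesgue_onI[of "{s, t}"]) (auto simp: indicator_def)
        show "(\<lambda>x. indicator {s<..<t} x * ?G x) \<in> borel_measurable (leb_interval T)"
          using b by (intro borel_measurable_times borel_measurable_indicator borel_measurable_integrable[OF nL1]) (auto simp: sets_restrict_space_iff)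
      qed (use interval_integral_eq_indicator(2)[OF nL1 b(1,3)] in auto)
      finally show "norm (u t - u s) \<le> K * (t - s) + K powr (1 - r) * (\<integral>x. indicator {s<..<t} x * ?G x \<partial>leb_interval T)" .
      have "{s<..<t} \<in> sets (leb_interval T)" using b by (auto simp: sets_restrict_space_iff)
      from integrable_mult_indicator[OF this nL1] show "integrable (leb_interval T) (\<lambda>x. indicator {s<..<t} x * ?G x)" by simp
    qed
    have "(\<Sum>(s, t)\<in>D. norm (u t - u s)) \<le> (\<Sum>(s, t)\<in>D. K * (t - s) + K powr (1 - r) * (\<integral>x. indicator {s<..<t} x * ?G x \<partial>leb_interval T))"
      using st by (intro sum_mono) auto
    also have "\<dots> = K * (\<Sum>(s, t)\<in>D. t - s) + K powr (1 - r) * (\<Sum>(s, t)\<in>D. \<integral>x. indicator {s<..<t} x * ?G x \<partial>leb_interval T)"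
      by (simp add: sum.distrib sum_distrib_left case_prod_unfold)
    also have "(\<Sum>(s, t)\<in>D. \<integral>x. indicator {s<..<t} x * ?G x \<partial>leb_interval T) = (\<integral>x. (\<Sum>(s, t)\<in>D. indicator {s<..<t} x * ?G x) \<partial>leb_interval T)"
      using ii by (simp add: case_prod_unfold)
    also have "\<dots> \<le> G" unfolding G_def
    proof (rule integral_mono)
      show "integrable (leb_interval T) (\<lambda>x. \<Sum>(s, t)\<in>D. indicator {s<..<t} x * ?G x)"
        using ii by (auto simp: case_prod_unfold intro!: Bochner_Integration.integrable_sum)
      fix x
      show "(\<Sum>(s, t)\<in>D. indicator {s<..<t} x * ?G x) \<le> ?G x"
      proof (cases "\<exists>I\<in>D. x \<in> {fst I<..<snd I}")
        case True
        then obtain I where I: "I \<in> D" "x \<in> {fst I<..<snd I}" by blast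
        have "x \<notin> {fst J<..<snd J}" if "J \<in> D" "J \<noteq> I" for J
          using D I that unfolding pairwise_def disjnt_def by blast
        then have "(\<Sum>J\<in>D - {I}. indicator {fst J<..<snd J} x * ?G x) = 0" by (intro sum.neutral) (auto simp: indicator_def)
        moreover have "(\<Sum>J\<in>D. indicator {fst J<..<snd J} x * ?G x) =
            indicator {fst I<..<snd I} x * ?G x + (\<Sum>J\<in>D - {I}. indicator {fst J<..<snd J} x * ?G x)"
          using D I by (intro sum.remove) auto
        ultimately show ?thesis using I by (simp add: case_prod_unfold)
      next
        case False
        then have "(\<Sum>J\<in>D. indicator {fst J<..<snd J} x * ?G x) = 0" by (intro sum.neutral) (auto simp: indicator_def)
        then show ?thesis by (simp add: case_prod_unfold)
      qed
    qed (rule nL1)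
    finally have "(\<Sum>(s, t)\<in>D. norm (u t - u s)) \<le> K * (\<Sum>(s, t)\<in>D. t - s) + K powr (1 - r) * G"
      by (simp add: mult_left_mono)
    moreover have "K * (\<Sum>(s, t)\<in>D. t - s) < K * (e / (2 * K))" using D K by (intro mult_strict_left_mono) auto
    ultimately show "(\<Sum>(s, t)\<in>D. norm (u t - u s)) < e" using K by simp
  qed
qed

section \<open>Convex functions and the hypergraph energy\<close>

text \<open>Maximal monotonicity of the subdifferential. The minimiser \<open>z\<close> of \<open>\<phi> + norm (\<cdot> - (x + \<eta>))\<^sup>2 / 2\<close> satisfies
  \<open>x + \<eta> - z \<in> \<partial>\<phi>(z)\<close>, and monotonicity against this pair forces \<open>z = x\<close>.\<close>
lemma monotone_graph_imp_subdifferential: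
  fixes \<phi> :: "'a::euclidean_space \<Rightarrow> real"
  assumes conv: "\<And>x y c. 0 \<le> c \<Longrightarrow> c \<le> 1 \<Longrightarrow> \<phi> ((1 - c) *\<^sub>R x + c *\<^sub>R y) \<le> (1 - c) * \<phi> x + c * \<phi> y"
    and cont: "continuous_on UNIV \<phi>" and nn: "\<And>x. \<phi> x \<ge> 0"
    and mono: "\<And>z \<zeta>. \<zeta> \<in> subdifferential \<phi> z \<Longrightarrow> (\<eta> - \<zeta>) \<bullet> (x - z) \<ge> 0"
  shows "\<eta> \<in> subdifferential \<phi> x"
proof -
  define y where "y = x + \<eta>"
  define F where "F = (\<lambda>z. \<phi> z + (norm (z - y))\<^sup>2 / 2)"
  \<comment> \<open>outside the ball of radius \<open>R\<close> around \<open>y\<close> the quadratic term alone exceeds \<open>F y\<close>\<close>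
  define R where "R = sqrt (2 * F y)"
  have F0: "F y \<ge> 0" by (simp add: F_def nn)
  have cF: "continuous_on UNIV F" unfolding F_def by (intro continuous_intros cont) auto
  have "\<exists>z\<in>cball y R. \<forall>w\<in>cball y R. F z \<le> F w"
    by (intro continuous_attains_inf continuous_on_subset[OF cF]) (use F0 in \<open>auto simp: R_def\<close>)
  then obtain z where z: "z \<in> cball y R" "\<And>w. w \<in> cball y R \<Longrightarrow> F z \<le> F w" by blast
  have min: "F z \<le> F w" for w
  proof (cases "w \<in> cball y R")
    case False
    then have "R < norm (w - y)" by (simp add: dist_norm norm_minus_commute)
    then have "R\<^sup>2 < (norm (w - y))\<^sup>2" using F0 by (intro power_strict_mono) (auto simp: R_def)
    then have "F y < (norm (w - y))\<^sup>2 / 2" using F0 by (simp add: R_def)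
    also have "\<dots> \<le> F w" using nn[of w] by (simp add: F_def)
    finally show ?thesis using z(2)[of y] F0 by (simp add: R_def)
  qed (rule z(2))
  have sub: "y - z \<in> subdifferential \<phi> z"
    unfolding subdifferential_def
  proof (intro CollectI allI)
    fix w
    have le: "0 \<le> \<phi> w - \<phi> z - (y - z) \<bullet> (w - z) + t * ((norm (w - z))\<^sup>2 / 2)" if t: "0 < t" "t \<le> 1" for t
    proof -
      let ?v = "(1 - t) *\<^sub>R z + t *\<^sub>R w"
      have v: "?v - y = (z - y) + t *\<^sub>R (w - z)" by (simp add: algebra_simps)
      have gen: "(norm (A + t *\<^sub>R B))\<^sup>2 = (norm A)\<^sup>2 + 2 * t * (A \<bullet> B) + t\<^sup>2 * (norm B)\<^sup>2" for A B :: 'a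
        unfolding power2_norm_eq_inner
        by (simp add: inner_add_left inner_add_right inner_commute power2_eq_square algebra_simps)
      have "(norm (?v - y))\<^sup>2 = (norm (z - y))\<^sup>2 + 2 * t * ((z - y) \<bullet> (w - z)) + t\<^sup>2 * (norm (w - z))\<^sup>2"
        unfolding v by (rule gen)
      moreover have "\<phi> ?v \<le> (1 - t) * \<phi> z + t * \<phi> w" using t by (intro conv) auto
      ultimately have "0 \<le> t * (\<phi> w - \<phi> z + (z - y) \<bullet> (w - z) + t * ((norm (w - z))\<^sup>2 / 2))"
        using min[of ?v] unfolding F_def by (simp add: power2_eq_square algebra_simps)
      then have "0 \<le> \<phi> w - \<phi> z + (z - y) \<bullet> (w - z) + t * ((norm (w - z))\<^sup>2 / 2)"
        using t by (simp add: zero_le_mult_iff)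
      then show ?thesis by (simp add: inner_diff_left)
    qed
    have "(\<lambda>n. \<phi> w - \<phi> z - (y - z) \<bullet> (w - z) + inverse (real (Suc n)) * ((norm (w - z))\<^sup>2 / 2))
        \<longlonglongrightarrow> \<phi> w - \<phi> z - (y - z) \<bullet> (w - z) + 0 * ((norm (w - z))\<^sup>2 / 2)"
      by (intro tendsto_intros LIMSEQ_inverse_real_of_nat)
    then have "0 \<le> \<phi> w - \<phi> z - (y - z) \<bullet> (w - z) + 0 * ((norm (w - z))\<^sup>2 / 2)"
      by (rule LIMSEQ_le_const) (intro exI allI impI le, auto simp: inverse_eq_divide)
    then show "(y - z) \<bullet> (w - z) \<le> \<phi> w - \<phi> z" by simp
  qed
  have "0 \<le> (\<eta> - (y - z)) \<bullet> (x - z)" by (rule mono[OF sub])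
  then have "(norm (x - z))\<^sup>2 \<le> 0" by (simp add: y_def power2_norm_eq_inner inner_diff_left inner_diff_right algebra_simps inner_commute)
  then have "z = x" by simp
  then show ?thesis using sub by (simp add: y_def)
qed

lemma hyperedge_fun_ge: "i \<in> e \<Longrightarrow> j \<in> e \<Longrightarrow> \<bar>x $ i - x $ j\<bar> \<le> hyperedge_fun e x"
  unfolding hyperedge_fun_def by (intro Max_ge) auto

lemma hyperedge_fun_le:
  assumes "e \<noteq> {}" "\<And>i j. i \<in> e \<Longrightarrow> j \<in> e \<Longrightarrow> \<bar>x $ i - x $ j\<bar> \<le> B"
  shows "hyperedge_fun e x \<le> B"
  unfolding hyperedge_fun_def using assms by (subst Max_le_iff) auto

lemma hyperedge_fun_attained:
  assumes "e \<noteq> {}"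
  obtains i j where "i \<in> e" "j \<in> e" "hyperedge_fun e x = \<bar>x $ i - x $ j\<bar>"
proof -
  have "hyperedge_fun e x \<in> (\<lambda>(i, j). \<bar>x $ i - x $ j\<bar>) ` (e \<times> e)"
    unfolding hyperedge_fun_def using assms by (intro Max_in) auto
  then show ?thesis using that by auto
qed

lemma hyperedge_fun_nonneg: "e \<noteq> {} \<Longrightarrow> 0 \<le> hyperedge_fun e x"
  using hyperedge_fun_attained[of e x] by (metis abs_ge_zero)

lemma hyperedge_fun_add: "e \<noteq> {} \<Longrightarrow> hyperedge_fun e (x + y) \<le> hyperedge_fun e x + hyperedge_fun e y"
  by (rule hyperedge_fun_le) (smt (verit) hyperedge_fun_ge vector_add_component)+

lemma hyperedge_fun_scaleR:
  assumes "e \<noteq> {}" shows "hyperedge_fun e (c *\<^sub>R x) = \<bar>c\<bar> * hyperedge_fun e x"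
proof (rule antisym)
  have eq: "\<bar>(c *\<^sub>R x) $ i - (c *\<^sub>R x) $ j\<bar> = \<bar>c\<bar> * \<bar>x $ i - x $ j\<bar>" for i j
    by (simp add: abs_mult[symmetric] algebra_simps)
  show "hyperedge_fun e (c *\<^sub>R x) \<le> \<bar>c\<bar> * hyperedge_fun e x"
    using assms by (rule hyperedge_fun_le) (unfold eq, auto intro!: mult_left_mono hyperedge_fun_ge)
  obtain i j where ij: "i \<in> e" "j \<in> e" "hyperedge_fun e x = \<bar>x $ i - x $ j\<bar>" using hyperedge_fun_attained[OF assms] .
  show "\<bar>c\<bar> * hyperedge_fun e x \<le> hyperedge_fun e (c *\<^sub>R x)"
    unfolding ij(3) eq[symmetric] using ij by (intro hyperedge_fun_ge)
qed

lemma hyperedge_fun_le_norm: "e \<noteq> {} \<Longrightarrow> hyperedge_fun e x \<le> 2 * norm x"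
  by (rule hyperedge_fun_le) (use component_le_norm_cart[of x] in \<open>smt (verit)\<close>)+

lemma continuous_on_hyperedge_fun: "e \<noteq> {} \<Longrightarrow> continuous_on S (hyperedge_fun e)"
proof -
  assume e: "e \<noteq> {}"
  have "2-lipschitz_on S (hyperedge_fun e)"
  proof (rule lipschitz_onI)
    fix x y
    have 1: "hyperedge_fun e x \<le> hyperedge_fun e y + hyperedge_fun e (x - y)"
      using hyperedge_fun_add[OF e, of y "x - y"] by simp
    have 2: "hyperedge_fun e y \<le> hyperedge_fun e x + hyperedge_fun e (y - x)"
      using hyperedge_fun_add[OF e, of x "y - x"] by simp
    show "dist (hyperedge_fun e x) (hyperedge_fun e y) \<le> 2 * dist x y"
      using 1 2 hyperedge_fun_le_norm[OF e, of "x - y"] hyperedge_fun_le_norm[OF e, of "y - x"]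
      by (simp add: dist_norm norm_minus_commute abs_le_iff)
  qed simp
  then show ?thesis by (rule lipschitz_on_continuous_on)
qed

lemma hyperedge_fun_vec: "hyperedge_fun e (x + vec c) = hyperedge_fun e x"
  by (simp add: hyperedge_fun_def)

text \<open>A connected weighted hypergraph with its energy \<open>\<phi>\<close> and its Laplacian \<open>\<L>\<close>.\<close>
locale hypergraph =
  fixes E :: "'n::finite set set" and w :: "'n set \<Rightarrow> real" and p :: real
  assumes wh: "weighted_hypergraph E w" and connected: "hypergraph_connected E" and p1: "p \<ge> 1"
begin

abbreviation \<phi> :: "real ^ 'n \<Rightarrow> real" where "\<phi> \<equiv> hypergraph_energy E w p"

abbreviation \<L> :: "real ^ 'n \<Rightarrow> (real ^ 'n) set" where "\<L> \<equiv> hypergraph_Laplacian E w p"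

lemma edge: "e \<in> E \<Longrightarrow> e \<noteq> {}" "e \<in> E \<Longrightarrow> w e > 0"
  using wh by (auto simp: weighted_hypergraph_def)

lemma weight_nonneg: "e \<in> E \<Longrightarrow> 0 \<le> w e"
  using edge(2)[of e] by simp

lemma energy_nonneg: "\<phi> x \<ge> 0"
  unfolding hypergraph_energy_def using p1 by (intro mult_nonneg_nonneg sum_nonneg weight_nonneg) auto

lemma energy_scaleR: "c \<ge> 0 \<Longrightarrow> \<phi> (c *\<^sub>R x) = c powr p * \<phi> x"
proof -
  assume c: "c \<ge> 0"
  have "(\<Sum>e\<in>E. w e * hyperedge_fun e (c *\<^sub>R x) powr p) = (\<Sum>e\<in>E. c powr p * (w e * hyperedge_fun e x powr p))"
    using edge hyperedge_fun_nonneg c by (intro sum.cong) (auto simp: hyperedge_fun_scaleR powr_mult)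
  then show ?thesis by (simp add: hypergraph_energy_def sum_distrib_left[symmetric])
qed

lemma energy_zero [simp]: "\<phi> 0 = 0"
  using energy_scaleR[of 0 0] p1 by simp

lemma energy_convex:
  assumes "0 \<le> c" "c \<le> 1"
  shows "\<phi> ((1 - c) *\<^sub>R x + c *\<^sub>R y) \<le> (1 - c) * \<phi> x + c * \<phi> y"
proof -
  let ?S = "\<lambda>x. \<Sum>e\<in>E. w e * hyperedge_fun e x powr p"
  have "?S ((1 - c) *\<^sub>R x + c *\<^sub>R y) \<le> (\<Sum>e\<in>E. (1 - c) * (w e * hyperedge_fun e x powr p) + c * (w e * hyperedge_fun e y powr p))"
  proof (rule sum_mono)
    fix e assume e: "e \<in> E"
    let ?f = "hyperedge_fun e"
    have "?f ((1 - c) *\<^sub>R x + c *\<^sub>R y) \<le> (1 - c) * ?f x + c * ?f y"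
      using hyperedge_fun_add[OF edge(1)[OF e], of "(1 - c) *\<^sub>R x" "c *\<^sub>R y"] assms
      by (simp add: hyperedge_fun_scaleR[OF edge(1)[OF e]])
    then have "?f ((1 - c) *\<^sub>R x + c *\<^sub>R y) powr p \<le> ((1 - c) * ?f x + c * ?f y) powr p"
      using p1 hyperedge_fun_nonneg[OF edge(1)[OF e]] by (intro powr_mono2) auto
    also have "\<dots> \<le> (1 - c) * ?f x powr p + c * ?f y powr p"
      using p1 assms hyperedge_fun_nonneg[OF edge(1)[OF e]] by (intro powr_convex_combination_le) auto
    finally have "w e * ?f ((1 - c) *\<^sub>R x + c *\<^sub>R y) powr p \<le> w e * ((1 - c) * ?f x powr p + c * ?f y powr p)"
      using edge(2)[OF e] by (intro mult_left_mono) auto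
    then show "w e * ?f ((1 - c) *\<^sub>R x + c *\<^sub>R y) powr p \<le> (1 - c) * (w e * ?f x powr p) + c * (w e * ?f y powr p)"
      by (simp add: algebra_simps)
  qed
  also have "\<dots> = (1 - c) * ?S x + c * ?S y" by (simp add: sum.distrib sum_distrib_left)
  finally have "1 / p * ?S ((1 - c) *\<^sub>R x + c *\<^sub>R y) \<le> 1 / p * ((1 - c) * ?S x + c * ?S y)"
    using p1 by (intro mult_left_mono) auto
  moreover have "r * ((1 - c) * X + c * Y) = (1 - c) * (r * X) + c * (r * Y)" for r X Y :: real
    by (simp add: algebra_simps)
  ultimately show ?thesis unfolding hypergraph_energy_def by (simp only:)
qed

lemma continuous_on_energy: "continuous_on S \<phi>"
proof -
  have "continuous_on S (\<lambda>x. hyperedge_fun e x powr p)" if "e \<in> E" for e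
    using p1 hyperedge_fun_nonneg[OF edge(1)[OF that]]
    by (intro continuous_on_powr' continuous_on_hyperedge_fun continuous_intros edge that) auto
  then show ?thesis
    unfolding hypergraph_energy_def by (intro continuous_on_mult continuous_on_const continuous_on_sum) auto
qed

lemma energy_vec: "\<phi> (x + vec c) = \<phi> x"
  by (simp add: hypergraph_energy_def hyperedge_fun_vec)

lemma energy_le_norm: "\<exists>K\<ge>0. \<forall>z. \<phi> z \<le> K * norm z powr p"
proof (intro exI conjI allI)
  let ?K = "1 / p * (\<Sum>e\<in>E. w e * 2 powr p)"
  show "0 \<le> ?K" using p1 by (intro mult_nonneg_nonneg sum_nonneg weight_nonneg) auto
  fix z
  have "(\<Sum>e\<in>E. w e * hyperedge_fun e z powr p) \<le> (\<Sum>e\<in>E. w e * 2 powr p * norm z powr p)"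
  proof (rule sum_mono)
    fix e assume e: "e \<in> E"
    have "hyperedge_fun e z powr p \<le> (2 * norm z) powr p"
      using p1 hyperedge_fun_nonneg[OF edge(1)[OF e]] hyperedge_fun_le_norm[OF edge(1)[OF e]] by (intro powr_mono2) auto
    then show "w e * hyperedge_fun e z powr p \<le> w e * 2 powr p * norm z powr p"
      using edge(2)[OF e] by (simp add: powr_mult mult_left_mono)
  qed
  then have "1 / p * (\<Sum>e\<in>E. w e * hyperedge_fun e z powr p) \<le> 1 / p * (\<Sum>e\<in>E. w e * 2 powr p * norm z powr p)"
    using p1 by (intro mult_left_mono) auto
  then show "\<phi> z \<le> ?K * norm z powr p" unfolding hypergraph_energy_def by (simp add: sum_distrib_right)
qed

lemma energy_eq_0_imp_constant:
  assumes "\<phi> x = 0" shows "x $ i = x $ j"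
proof -
  have "(\<Sum>e\<in>E. w e * hyperedge_fun e x powr p) = 0" using assms p1 by (simp add: hypergraph_energy_def)
  then have z: "hyperedge_fun e x = 0" if "e \<in> E" for e
    using that edge(2)[OF that] by (subst (asm) sum_nonneg_eq_0_iff) (auto intro!: mult_nonneg_nonneg weight_nonneg)
  have "\<exists>(n::nat) (v :: nat \<Rightarrow> 'n) (e :: nat \<Rightarrow> 'n set). v 0 = i \<and> v n = j \<and>
        (\<forall>l\<in>{1..n}. e l \<in> E \<and> v (l - 1) \<in> e l \<and> v l \<in> e l)"
    using connected unfolding hypergraph_connected_def by blast
  then obtain n and v :: "nat \<Rightarrow> 'n" and e where v: "v 0 = i" "v n = j"
    "\<And>l. l \<in> {1..n} \<Longrightarrow> e l \<in> E \<and> v (l - 1) \<in> e l \<and> v l \<in> e l"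
    by blast
  have key: "l \<le> n \<Longrightarrow> x $ v l = x $ v 0" for l
  proof (induction l)
    case (Suc l)
    have "e (Suc l) \<in> E \<and> v l \<in> e (Suc l) \<and> v (Suc l) \<in> e (Suc l)" using v(3)[of "Suc l"] Suc by auto
    then have "\<bar>x $ v (Suc l) - x $ v l\<bar> \<le> 0" using hyperedge_fun_ge[of "v (Suc l)" "e (Suc l)" "v l" x] z[of "e (Suc l)"] by auto
    then show ?case using Suc by auto
  qed auto
  show ?thesis using key[of n] v(1,2) by simp
qed

text \<open>Both sides are homogeneous of degree \<open>p\<close>. On the unit sphere the right-hand side is positive, because
  vectors of energy \<open>0\<close> are constant by connectedness, and those of zero sum then vanish.\<close>
lemma energy_coercive:
  "\<exists>c>0. \<forall>x. c * norm x powr p \<le> \<phi> x + \<bar>\<Sum>i\<in>UNIV. x $ i\<bar> powr p"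
proof -
  let ?F = "\<lambda>x :: real ^ 'n. \<phi> x + \<bar>\<Sum>i\<in>UNIV. x $ i\<bar> powr p"
  have cF: "continuous_on (sphere 0 1) ?F"
    using p1 by (intro continuous_intros continuous_on_energy continuous_on_powr') auto
  have ne: "sphere (0 :: real ^ 'n) 1 \<noteq> {}" by simp
  obtain y where y: "y \<in> sphere 0 1" "\<And>x. x \<in> sphere 0 1 \<Longrightarrow> ?F y \<le> ?F x"
    using continuous_attains_inf[OF compact_sphere ne cF] by blast
  have "?F y > 0"
  proof (rule ccontr)
    assume "\<not> ?F y > 0"
    then have F: "\<phi> y = 0" "\<bar>\<Sum>i\<in>UNIV. y $ i\<bar> powr p = 0"
      using energy_nonneg[of y] powr_ge_zero[of "\<bar>\<Sum>i\<in>UNIV. y $ i\<bar>" p] by linarith+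
    have "y $ i = 0" for i
    proof -
      have "(\<Sum>j\<in>UNIV. y $ j) = (\<Sum>j\<in>(UNIV :: 'n set). y $ i)"
        using energy_eq_0_imp_constant[OF F(1)] by (intro sum.cong) auto
      then show ?thesis using F(2) by simp
    qed
    then have "y = 0" by (simp add: vec_eq_iff)
    then show False using y(1) by simp
  qed
  moreover have "?F y * norm x powr p \<le> ?F x" for x
  proof (cases "x = 0")
    case False
    define s where "s = norm x"
    have s: "s > 0" using False by (simp add: s_def)
    define x' where "x' = x /\<^sub>R s"
    have x: "x = s *\<^sub>R x'" using s by (simp add: x'_def)
    have "x' \<in> sphere 0 1" using s by (simp add: x'_def s_def)
    then have "?F y * s powr p \<le> ?F x' * s powr p" by (intro mult_right_mono y) auto
    also have "\<dots> = ?F x"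
    proof -
      have "(\<Sum>i\<in>UNIV. x $ i) = s * (\<Sum>i\<in>UNIV. x' $ i)" by (subst x) (simp add: sum_distrib_left)
      moreover have "\<phi> x = s powr p * \<phi> x'" using s by (subst x) (simp add: energy_scaleR)
      ultimately show ?thesis using s by (simp add: abs_mult powr_mult algebra_simps)
    qed
    finally show ?thesis by (simp add: s_def)
  qed (use energy_nonneg in simp)
  ultimately show ?thesis by blast
qed

text \<open>The energy is invariant under adding constants to all components.\<close>
lemma Laplacian_sum_zero:
  assumes "\<eta> \<in> \<L> x" shows "(\<Sum>i\<in>UNIV. \<eta> $ i) = 0"
proof -
  have "\<eta> \<bullet> vec c \<le> 0" for c
    using assms[unfolded hypergraph_Laplacian_def subdifferential_def, simplified, rule_format, of "x + vec c"]
    by (simp add: energy_vec)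
  from this[of 1] this[of "- 1"] show ?thesis
    by (simp add: inner_vec_def sum_negf)
qed

lemma Laplacian_inner_ge:
  assumes "\<eta> \<in> \<L> x" shows "\<phi> x \<le> \<eta> \<bullet> x"
  using assms[unfolded hypergraph_Laplacian_def subdifferential_def, simplified, rule_format, of 0] by simp

text \<open>Test the subgradient inequality at \<open>x + z\<close>, where \<open>z\<close> has the direction of \<open>\<eta>\<close> and the norm
  \<open>(1 + \<phi> x) powr (1 / p)\<close>.\<close>
lemma Laplacian_bound:
  "\<exists>C\<ge>0. \<forall>x \<eta>. \<eta> \<in> \<L> x \<longrightarrow> norm \<eta> \<le> C * (1 + \<phi> x) powr ((p - 1) / p)"
proof -
  obtain K where K: "K \<ge> 0" "\<And>z. \<phi> z \<le> K * norm z powr p" using energy_le_norm by blast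
  have "norm \<eta> \<le> (2 powr p * (1 + K)) * (1 + \<phi> x) powr ((p - 1) / p)"
    if \<eta>: "\<eta> \<in> \<L> x" for x \<eta>
  proof (cases "\<eta> = 0")
    case False
    define s where "s = (1 + \<phi> x) powr (1 / p)"
    have s: "s > 0" "s powr p = 1 + \<phi> x" using p1 energy_nonneg[of x] by (auto simp: s_def powr_powr)
    define z where "z = (s / norm \<eta>) *\<^sub>R \<eta>"
    have z: "norm z = s" "\<eta> \<bullet> z = s * norm \<eta>" using False s by (auto simp: z_def power2_norm_eq_inner[symmetric] power2_eq_square)
    have "\<eta> \<bullet> z \<le> \<phi> (x + z) - \<phi> x"
      using \<eta>[unfolded hypergraph_Laplacian_def subdifferential_def, simplified, rule_format, of "x + z"] by simp
    also have "\<dots> \<le> \<phi> (x + z)" using energy_nonneg by simp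
    also have "\<phi> (x + z) = \<phi> ((1 - 1/2) *\<^sub>R (2 *\<^sub>R x) + (1/2) *\<^sub>R (2 *\<^sub>R z))" by simp
    also have "\<dots> \<le> (1 - 1/2) * \<phi> (2 *\<^sub>R x) + 1/2 * \<phi> (2 *\<^sub>R z)" by (rule energy_convex) auto
    also have "\<dots> = 2 powr p * (\<phi> x + \<phi> z) / 2" by (simp add: energy_scaleR algebra_simps)
    also have "\<dots> \<le> 2 powr p * (\<phi> x + \<phi> z)" using energy_nonneg[of x] energy_nonneg[of z] by simp
    also have "\<dots> \<le> 2 powr p * (s powr p + K * s powr p)"
      using K(2)[of z] s z by (intro mult_left_mono add_mono) auto
    finally have *: "s * norm \<eta> \<le> 2 powr p * (s powr p + K * s powr p)" using z by simp
    have sp: "s powr p = s * s powr (p - 1)" using s(1) by (simp add: powr_diff)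
    have "s * norm \<eta> \<le> s * (2 powr p * (1 + K) * s powr (p - 1))"
      using * unfolding sp by (simp add: algebra_simps)
    then have "norm \<eta> \<le> 2 powr p * (1 + K) * s powr (p - 1)" using s by simp
    also have "s powr (p - 1) = (1 + \<phi> x) powr ((p - 1) / p)" by (simp add: s_def powr_powr)
    finally show ?thesis .
  qed (use K in auto)
  then show ?thesis using K by (intro exI[of _ "2 powr p * (1 + K)"]) auto
qed

end

section \<open>The free energy\<close>

text \<open>The vector \<open>norm x powr (q - 2) *\<^sub>R x\<close> is a subgradient of \<open>norm x powr q / q\<close>, by Young's inequality.\<close>
lemma norm_powr_gradient_ineq:
  fixes x z :: "'a::real_inner"
  assumes q: "q > 2"
  shows "(norm x powr (q - 2) *\<^sub>R x) \<bullet> (z - x) \<le> (norm z powr q - norm x powr q) / q"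
proof -
  define q' where "q' = q / (q - 1)"
  have q': "q' > 1" "1 / q' + 1 / q = 1" using q by (auto simp: q'_def field_simps)
  have e1: "norm x powr (q - 2) * (norm x)\<^sup>2 = norm x powr q"
    using q by (cases "x = 0") (auto simp: powr_diff powr_numeral)
  have e2: "norm x powr (q - 2) * norm x = norm x powr (q - 1)"
    using q by (cases "x = 0") (auto simp: powr_diff powr_numeral power2_eq_square)
  have "norm x powr (q - 2) * (x \<bullet> z) \<le> norm x powr (q - 2) * (norm x * norm z)"
    by (intro mult_left_mono norm_cauchy_schwarz) auto
  also have "\<dots> = norm x powr (q - 1) * norm z" using e2 by simp
  also have "\<dots> \<le> (norm x powr (q - 1)) powr q' / q' + norm z powr q / q"
    using q q' by (intro Youngs_inequality) auto
  also have "(norm x powr (q - 1)) powr q' = norm x powr q" using q by (simp add: powr_powr q'_def)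
  finally have *: "norm x powr (q - 2) * (x \<bullet> z) \<le> norm x powr q / q' + norm z powr q / q" .
  have "1 / q' = 1 - 1 / q" using q' by simp
  then have "norm x powr q / q' = norm x powr q - norm x powr q / q"
    by (metis (no_types, opaque_lifting) right_diff_distrib mult_1_right times_divide_eq_right)
  then show ?thesis using * e1 by (simp add: inner_diff_right power2_norm_eq_inner[symmetric] right_diff_distrib diff_divide_distrib)
qed

lemma lipschitz_gradient_lower_bound:
  fixes k :: "'a::euclidean_space \<Rightarrow> real"
  assumes L: "L-lipschitz_on UNIV \<pi>" and k: "\<And>x. GDERIV k x :> \<pi> x"
  shows "\<pi> x \<bullet> (z - x) - L * (norm (z - x))\<^sup>2 \<le> k z - k x"
proof -
  let ?l = "\<lambda>t. x + t *\<^sub>R (z - x)"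
  have "((\<lambda>t. k (?l t)) has_real_derivative \<pi> (?l t) \<bullet> (z - x)) (at t)" for t
  proof -
    have 1: "(k has_derivative (\<lambda>h. h \<bullet> \<pi> (?l t))) (at (?l t))" using k by (simp add: gderiv_def)
    have 2: "(?l has_derivative (\<lambda>h. h *\<^sub>R (z - x))) (at t)" by (auto intro!: derivative_eq_intros)
    show ?thesis using has_derivative_compose[OF 2 1]
      by (simp add: has_field_derivative_def inner_commute mult.commute[of "(z - x) \<bullet> \<pi> (?l t)"] o_def mult_commute_abs)
  qed
  then obtain t where t: "0 < t" "t < 1" "k (?l 1) - k (?l 0) = (1 - 0) * (\<pi> (?l t) \<bullet> (z - x))"
    using MVT2[of 0 1 "\<lambda>t. k (?l t)" "\<lambda>t. \<pi> (?l t) \<bullet> (z - x)"] by auto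
  then have eq: "k z - k x = \<pi> (?l t) \<bullet> (z - x)" by simp
  have "norm (\<pi> x - \<pi> (?l t)) \<le> L * norm (x - ?l t)"
    using lipschitz_onD[OF L, of x "?l t"] by (simp add: dist_norm)
  also have "\<dots> \<le> L * norm (z - x)"
    using t lipschitz_on_nonneg[OF L] by (intro mult_left_mono) (auto intro: mult_left_le_one_le)
  finally have "norm (\<pi> x - \<pi> (?l t)) * norm (z - x) \<le> L * norm (z - x) * norm (z - x)" by (intro mult_right_mono) auto
  then have "(\<pi> x - \<pi> (?l t)) \<bullet> (z - x) \<le> L * (norm (z - x))\<^sup>2"
    using norm_cauchy_schwarz[of "\<pi> x - \<pi> (?l t)" "z - x"] by (simp add: power2_eq_square mult.assoc)
  then show ?thesis unfolding eq by (simp add: inner_diff_left)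
qed

lemma superquadratic_eventually_large:
  fixes a q A B L M :: real
  assumes "a > 0" "q > 2" "A \<ge> 0" "L \<ge> 0"
  obtains R where "R \<ge> 0" "\<And>y. y > R \<Longrightarrow> a / q * y powr q - A * y - L * y\<^sup>2 - B > M"
proof -
  define c where "c = a / q"
  have c: "c > 0" using assms by (simp add: c_def)
  \<comment> \<open>beyond \<open>R\<close> the factor \<open>c * y powr (q - 2)\<close> dominates the sum of all coefficients\<close>
  define R where "R = max 1 (((A + L + \<bar>B\<bar> + \<bar>M\<bar> + 1) / c) powr (1 / (q - 2)))"
  show ?thesis
  proof (rule that[of R])
    fix y assume y: "y > R"
    then have y1: "y > 1" by (simp add: R_def)
    have "((A + L + \<bar>B\<bar> + \<bar>M\<bar> + 1) / c) = (((A + L + \<bar>B\<bar> + \<bar>M\<bar> + 1) / c) powr (1 / (q - 2))) powr (q - 2)"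
      using assms c by (simp add: powr_powr)
    also have "\<dots> \<le> y powr (q - 2)" using y assms by (intro powr_mono2) (auto simp: R_def)
    finally have "A + L + \<bar>B\<bar> + \<bar>M\<bar> + 1 \<le> c * y powr (q - 2)" using c by (simp add: pos_divide_le_eq mult.commute)
    then have "(A + L + \<bar>B\<bar> + \<bar>M\<bar> + 1) * y\<^sup>2 \<le> c * y powr (q - 2) * y\<^sup>2" by (intro mult_right_mono) auto
    also have "\<dots> = c * y powr q" using y1 by (simp add: powr_diff powr_numeral)
    finally have *: "(A + L + \<bar>B\<bar> + \<bar>M\<bar> + 1) * y\<^sup>2 \<le> c * y powr q" .
    have y2: "y \<le> y\<^sup>2" "1 \<le> y\<^sup>2" using y1 self_le_power[of y 2] one_le_power[of y 2] by auto
    have "A * y \<le> A * y\<^sup>2" "(\<bar>B\<bar> + \<bar>M\<bar> + 1) * 1 \<le> (\<bar>B\<bar> + \<bar>M\<bar> + 1) * y\<^sup>2" 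
      using mult_left_mono[OF y2(1) assms(3)] mult_left_mono[OF y2(2), of "\<bar>B\<bar> + \<bar>M\<bar> + 1"] by auto
    then show "a / q * y powr q - A * y - L * y\<^sup>2 - B > M" using * by (simp add: c_def[symmetric] algebra_simps)
  qed (simp add: R_def)
qed

text \<open>The data of the system. The Lipschitz constant \<open>L\<close> of \<open>\<pi>\<close> bounds the nonconvexity of \<open>k\<close>.\<close>
locale potential = hypergraph E w p
  for E :: "'n::finite set set" and w p +
  fixes a q L :: real and \<pi> :: "real ^ 'n \<Rightarrow> real ^ 'n" and k :: "real ^ 'n \<Rightarrow> real"
  assumes a: "a > 0" and q: "q > 2" and L: "L-lipschitz_on UNIV \<pi>" and k: "\<And>x. GDERIV k x :> \<pi> x"
begin

text \<open>The single-valued part of the second inclusion.\<close>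
definition lower :: "real ^ 'n \<Rightarrow> real ^ 'n" where
  "lower x = (a * norm x powr (q - 2)) *\<^sub>R x + \<pi> x"

text \<open>The free energy, whose generalised gradient at \<open>x\<close> is \<open>\<L> x + lower x\<close>.\<close>
definition \<Phi> :: "real ^ 'n \<Rightarrow> real" where
  "\<Phi> x = \<phi> x + a / q * norm x powr q + k x"

lemma continuous_on_lower: "continuous_on S lower"
  unfolding lower_def using q lipschitz_on_continuous_on[OF L]
  by (intro continuous_intros) (auto intro: continuous_on_subset)

lemma continuous_on_k: "continuous_on S k"
proof -
  have "isCont k x" for x using k[of x] by (auto simp: gderiv_def intro: has_derivative_continuous)
  then show ?thesis by (simp add: continuous_at_imp_continuous_on)
qed

lemma continuous_on_\<Phi>: "continuous_on S \<Phi>"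
  unfolding \<Phi>_def using q by (intro continuous_intros continuous_on_energy continuous_on_k) auto

text \<open>This inequality is what the chain rule requires; it treats the energy, the power of the norm and
  \<open>k\<close> at once.\<close>
lemma \<Phi>_semiconvex:
  assumes "\<xi> \<in> \<L> x"
  shows "(\<xi> + lower x) \<bullet> (z - x) - L * (norm (z - x))\<^sup>2 \<le> \<Phi> z - \<Phi> x"
proof -
  have 1: "\<xi> \<bullet> (z - x) \<le> \<phi> z - \<phi> x" using assms by (simp add: hypergraph_Laplacian_def subdifferential_def)
  have "a * ((norm x powr (q - 2) *\<^sub>R x) \<bullet> (z - x)) \<le> a * ((norm z powr q - norm x powr q) / q)"
    using a norm_powr_gradient_ineq[OF q, of x z] by (intro mult_left_mono) auto
  then have 2: "((a * norm x powr (q - 2)) *\<^sub>R x) \<bullet> (z - x) \<le> a / q * norm z powr q - a / q * norm x powr q"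
    by (simp add: right_diff_distrib diff_divide_distrib)
  show ?thesis using 1 2 lipschitz_gradient_lower_bound[OF L k, of x z]
    by (simp add: \<Phi>_def lower_def inner_add_left)
qed

lemma \<Phi>_sublevel_bounded: "\<exists>R. \<forall>x. \<Phi> x \<le> M \<longrightarrow> norm x \<le> R"
proof -
  obtain R where R: "\<And>y. y > R \<Longrightarrow> a / q * y powr q - norm (\<pi> 0) * y - L * y\<^sup>2 - (- k 0) > M"
    using superquadratic_eventually_large[OF a q norm_ge_zero[of "\<pi> 0"] lipschitz_on_nonneg[OF L]] by metis
  have "norm x \<le> R" if "\<Phi> x \<le> M" for x
  proof (rule ccontr)
    assume "\<not> norm x \<le> R"
    then have *: "a / q * norm x powr q - norm (\<pi> 0) * norm x - L * (norm x)\<^sup>2 - (- k 0) > M" by (intro R) auto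
    have "\<pi> 0 \<bullet> x - L * (norm x)\<^sup>2 \<le> k x - k 0"
      using lipschitz_gradient_lower_bound[OF L k, of 0 x] by simp
    moreover have "- (norm (\<pi> 0) * norm x) \<le> \<pi> 0 \<bullet> x" using Cauchy_Schwarz_ineq2[of "\<pi> 0" x] by linarith
    ultimately show False using * that energy_nonneg[of x] unfolding \<Phi>_def by linarith
  qed
  then show ?thesis by blast
qed

lemma \<Phi>_bounded_below: "\<exists>m. \<forall>x. m \<le> \<Phi> x"
proof -
  obtain R where R: "\<And>x. \<Phi> x \<le> \<Phi> 0 \<Longrightarrow> norm x \<le> R" using \<Phi>_sublevel_bounded[of "\<Phi> 0"] by blast
  have "\<exists>y\<in>cball 0 R. \<forall>x\<in>cball 0 R. \<Phi> y \<le> \<Phi> x"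
    using R[of 0] by (intro continuous_attains_inf continuous_on_\<Phi>) auto
  then obtain y where y': "\<And>x. x \<in> cball 0 R \<Longrightarrow> \<Phi> y \<le> \<Phi> x" by blast
  have y: "\<Phi> y \<le> \<Phi> x" if "norm x \<le> R" for x using y'[of x] that by simp
  have "\<Phi> y \<le> \<Phi> x" for x
  proof (cases "norm x \<le> R")
    case False
    then have "\<not> \<Phi> x \<le> \<Phi> 0" using R[of x] by auto
    moreover have "\<Phi> y \<le> \<Phi> 0" using y[of 0] R[of 0] by simp
    ultimately show ?thesis by linarith
  qed (rule y)
  then show ?thesis by blast
qed

end

section \<open>Energy estimates\<close>

context potential
begin

text \<open>Exponents of the spaces containing \<open>u'\<close> and \<open>\<mu>\<close>. For \<open>p = 1\<close> both functions are bounded uniformly in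
  \<open>\<tau>\<close>; any exponent above \<open>1\<close> serves, and \<open>2\<close> is taken.\<close>
definition r\<^sub>v :: real where "r\<^sub>v = (if p = 1 then 2 else p / (p - 1))"
definition r\<^sub>\<mu> :: real where "r\<^sub>\<mu> = (if p = 1 then 2 else max p (p / (p - 1)))"

lemma exponents_gt_1: "r\<^sub>v > 1" "r\<^sub>\<mu> > 1"
  using p1 by (auto simp: r\<^sub>v_def r\<^sub>\<mu>_def less_max_iff_disj)

lemma Laplacian_locally_bounded:
  "\<exists>C\<ge>0. \<forall>x \<xi>. norm x \<le> R \<longrightarrow> \<xi> \<in> \<L> x \<longrightarrow> norm \<xi> \<le> C"
proof -
  obtain C where C: "C \<ge> 0" "\<And>x \<xi>. \<xi> \<in> \<L> x \<Longrightarrow> norm \<xi> \<le> C * (1 + \<phi> x) powr ((p - 1) / p)"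
    using Laplacian_bound by blast
  obtain K where K: "K \<ge> 0" "\<And>z. \<phi> z \<le> K * norm z powr p" using energy_le_norm by blast
  show ?thesis
  proof (intro exI[of _ "C * (1 + K * \<bar>R\<bar> powr p) powr ((p - 1) / p)"] conjI allI impI)
    fix x \<xi> assume x: "norm x \<le> R" and \<xi>: "\<xi> \<in> \<L> x"
    have "\<phi> x \<le> K * norm x powr p" by (rule K)
    also have "\<dots> \<le> K * \<bar>R\<bar> powr p" using x p1 K by (intro mult_left_mono powr_mono2) auto
    finally have "(1 + \<phi> x) powr ((p - 1) / p) \<le> (1 + K * \<bar>R\<bar> powr p) powr ((p - 1) / p)"
      using p1 energy_nonneg[of x] by (intro powr_mono2) auto
    then show "norm \<xi> \<le> C * (1 + K * \<bar>R\<bar> powr p) powr ((p - 1) / p)"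
      using C(2)[OF \<xi>] mult_left_mono[OF _ C(1)] by (meson order_trans)
  qed (use C in auto)
qed

lemma lower_locally_bounded: "\<exists>C\<ge>0. \<forall>x. norm x \<le> R \<longrightarrow> norm (lower x) \<le> C"
proof -
  have "compact (lower ` cball 0 R)" by (intro compact_continuous_image continuous_on_lower) auto
  from compact_imp_bounded[OF this] obtain C where C: "\<forall>y\<in>lower ` cball 0 R. norm y \<le> C"
    unfolding bounded_iff by blast
  have "norm (lower x) \<le> max 0 C" if "norm x \<le> R" for x
    using bspec[OF C, of "lower x"] that by (simp add: le_max_iff_disj)
  then show ?thesis by (intro exI[of _ "max 0 C"]) auto
qed

text \<open>The inclusion \<open>- v \<in> \<L> x\<close> controls \<open>v\<close> by the energy of \<open>x\<close>. The vector \<open>x\<close> itself is controlled in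
  two ways: by coercivity, since its sum is bounded, and by \<open>norm v + D\<close>; the first gives the exponent
  \<open>p\<close>, the second \<open>p / (p - 1)\<close>.\<close>
lemma growth_bounds:
  assumes D: "D \<ge> 0"
  obtains A C where "A \<ge> 0" 
    "\<And>x v. - v \<in> \<L> x \<Longrightarrow> norm x \<le> norm v + D \<Longrightarrow> \<bar>\<Sum>i\<in>UNIV. x $ i\<bar> \<le> D \<Longrightarrow>
       norm v powr r\<^sub>v \<le> A * (1 + \<phi> x) \<and> norm x powr r\<^sub>\<mu> \<le> A * (1 + \<phi> x)"
    "\<And>x v. - v \<in> \<L> x \<Longrightarrow> norm x \<le> norm v + D \<Longrightarrow> p = 1 \<Longrightarrow> norm v \<le> C \<and> norm x \<le> C"
proof -
  obtain C1 where C1: "C1 \<ge> 0" "\<And>x \<xi>. \<xi> \<in> \<L> x \<Longrightarrow> norm \<xi> \<le> C1 * (1 + \<phi> x) powr ((p - 1) / p)"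
    using Laplacian_bound by blast
  obtain c where c: "c > 0" "\<And>x. c * norm x powr p \<le> \<phi> x + \<bar>\<Sum>i\<in>UNIV. x $ i\<bar> powr p" using energy_coercive by blast
  have e1: "1 \<le> 1 + \<phi> x" for x using energy_nonneg[of x] by simp
  have bd: "norm v \<le> C1 + D \<and> norm x \<le> C1 + D"
    if "- v \<in> \<L> x" "norm x \<le> norm v + D" "p = 1" for x v
  proof -
    have "norm v \<le> C1" using C1(2)[OF that(1)] that(3) e1[of x] by simp
    then show ?thesis using that D by simp
  qed
  show ?thesis
  proof (cases "p = 1")
    case True
    show ?thesis
    proof (rule that[of "(C1 + D) powr 2" "C1 + D"])
      fix x v assume *: "- v \<in> \<L> x" "norm x \<le> norm v + D"
      have "y powr 2 \<le> (C1 + D) powr 2 * (1 + \<phi> x)" if "0 \<le> y" "y \<le> C1 + D" for y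
      proof -
        have "y powr 2 \<le> (C1 + D) powr 2" using that by (intro powr_mono2) auto
        also have "\<dots> \<le> (C1 + D) powr 2 * (1 + \<phi> x)" using e1[of x] by (simp add: mult_le_cancel_left1)
        finally show ?thesis .
      qed
      moreover have "r\<^sub>v = 2" "r\<^sub>\<mu> = 2" unfolding r\<^sub>v_def r\<^sub>\<mu>_def using True by simp_all
      ultimately show "norm v powr r\<^sub>v \<le> (C1 + D) powr 2 * (1 + \<phi> x) \<and> norm x powr r\<^sub>\<mu> \<le> (C1 + D) powr 2 * (1 + \<phi> x)"
        using bd[OF * True] by (metis norm_ge_zero)
    qed (use bd in auto)
  next
    case False
    define s where "s = p / (p - 1)"
    have s: "s > 1" "(p - 1) / p * s = 1" using p1 False by (auto simp: s_def)
    define A1 where "A1 = C1 powr s"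
    define A2 where "A2 = (1 + D powr p) / c"
    define A3 where "A3 = 2 powr (s - 1) * (A1 + D powr s)"
    have A: "A1 \<ge> 0" "A2 \<ge> 0" "A3 \<ge> 0" using c by (auto simp: A1_def A2_def A3_def)
    show ?thesis
    proof (rule that[of "A1 + A2 + A3" 0])
      fix x v assume *: "- v \<in> \<L> x" "norm x \<le> norm v + D" "\<bar>\<Sum>i\<in>UNIV. x $ i\<bar> \<le> D"
      note e = e1[of x]
      have "norm v powr s \<le> (C1 * (1 + \<phi> x) powr ((p - 1) / p)) powr s"
        using C1(2)[OF *(1)] s by (intro powr_mono2) auto
      also have "\<dots> = A1 * (1 + \<phi> x)"
        using C1(1) e s(2) by (simp add: powr_mult powr_powr A1_def)
      finally have v: "norm v powr s \<le> A1 * (1 + \<phi> x)" .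
      have "c * norm x powr p \<le> \<phi> x + D powr p"
        using c(2)[of x] *(3) p1 powr_mono2[of p "\<bar>\<Sum>i\<in>UNIV. x $ i\<bar>" D] by auto
      also have "\<dots> \<le> (1 + D powr p) * (1 + \<phi> x)" using energy_nonneg[of x] by (simp add: algebra_simps)
      finally have x1: "norm x powr p \<le> A2 * (1 + \<phi> x)" using c(1) by (simp add: A2_def field_simps)
      have "norm x powr s \<le> norm (norm v + D) powr s" using *(2) s by (intro powr_mono2) auto
      also have "\<dots> \<le> 2 powr (s - 1) * (norm (norm v) powr s + norm D powr s)"
        using s by (intro norm_add_powr_le) auto
      also have "\<dots> \<le> 2 powr (s - 1) * (A1 * (1 + \<phi> x) + D powr s * (1 + \<phi> x))"
        using v e D by (intro mult_left_mono add_mono) (auto simp: mult_le_cancel_left1)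
      also have "\<dots> = A3 * (1 + \<phi> x)" by (simp add: A3_def algebra_simps)
      finally have x2: "norm x powr s \<le> A3 * (1 + \<phi> x)" .
      have le: "A1 * (1 + \<phi> x) \<le> (A1 + A2 + A3) * (1 + \<phi> x)" "A2 * (1 + \<phi> x) \<le> (A1 + A2 + A3) * (1 + \<phi> x)"
        "A3 * (1 + \<phi> x) \<le> (A1 + A2 + A3) * (1 + \<phi> x)"
        using A e by (auto intro!: mult_right_mono)
      have "norm x powr max p s \<le> (A1 + A2 + A3) * (1 + \<phi> x)"
        using x1 x2 le by (cases "p \<le> s") (auto simp: max_def)
      then show "norm v powr r\<^sub>v \<le> (A1 + A2 + A3) * (1 + \<phi> x) \<and> norm x powr r\<^sub>\<mu> \<le> (A1 + A2 + A3) * (1 + \<phi> x)"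
        using v le False by (simp add: r\<^sub>v_def r\<^sub>\<mu>_def s_def[symmetric])
    qed (use A False in auto)
  qed
qed

text \<open>The system with an explicit function \<open>v\<close> in the place of the weak derivative of \<open>u\<close>.\<close>
definition flow :: "real \<Rightarrow> real ^ 'n \<Rightarrow> real \<Rightarrow> (real \<Rightarrow> real ^ 'n) \<Rightarrow> (real \<Rightarrow> real ^ 'n) \<Rightarrow> (real \<Rightarrow> real ^ 'n) \<Rightarrow> bool" where
  "flow T u\<^sub>0 \<tau> u v \<mu> \<longleftrightarrow> L1_fun T v \<and> L1_fun T \<mu> \<and> u 0 = u\<^sub>0 \<and>
     (\<forall>x\<in>{0..T}. u x = u 0 + integral {0..x} v) \<and>
     (AE t in leb_interval T. - v t \<in> \<L> (\<mu> t)) \<and>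
     (AE t in leb_interval T. \<mu> t - \<tau> *\<^sub>R v t - lower (u t) \<in> \<L> (u t))"

lemma is_solution_imp_flow:
  assumes "is_solution E w p a q \<pi> T u\<^sub>0 \<tau> u \<mu>" "T > 0"
  shows "flow T u\<^sub>0 \<tau> u (weak_deriv T u) \<mu>"
proof -
  let ?v = "weak_deriv T u"
  have W: "W11_fun T u" and c: "continuous_on {0..T} u" and \<mu>: "L1_fun T \<mu>" and "u 0 = u\<^sub>0"
    and i1: "AE t in leb_interval T. 0 \<in> (\<lambda>\<eta>. ?v t + \<eta>) ` \<L> (\<mu> t)"
    and i2: "AE t in leb_interval T. \<mu> t \<in> (\<lambda>\<xi>. \<tau> *\<^sub>R ?v t + \<xi> + (a * norm (u t) powr (q - 2)) *\<^sub>R u t + \<pi> (u t))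
                ` \<L> (u t)"
    using assms abs_cont_on_imp_continuous_on unfolding is_solution_def by blast+
  have "AE t in leb_interval T. - ?v t \<in> \<L> (\<mu> t)"
    using i1
  proof eventually_elim
    fix t assume "0 \<in> (\<lambda>\<eta>. ?v t + \<eta>) ` \<L> (\<mu> t)"
    then obtain \<eta> where "\<eta> \<in> \<L> (\<mu> t)" "?v t + \<eta> = 0" by force
    then show "- ?v t \<in> \<L> (\<mu> t)" by (simp add: minus_unique)
  qed
  moreover have "AE t in leb_interval T. \<mu> t - \<tau> *\<^sub>R ?v t - lower (u t) \<in> \<L> (u t)"
    using i2 by eventually_elim (auto simp: lower_def)
  ultimately show ?thesis
    unfolding flow_def using W11_weak_deriv[OF W c assms(2)] \<mu> \<open>u 0 = u\<^sub>0\<close> by blast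
qed

lemma flow_imp_is_solution:
  assumes f: "flow T u\<^sub>0 \<tau> u v \<mu>" and T: "T > 0" and ac: "abs_cont_on 0 T u"
  shows "is_solution E w p a q \<pi> T u\<^sub>0 \<tau> u \<mu>" "AE t in leb_interval T. weak_deriv T u t = v t"
proof -
  have v: "L1_fun T v" and u: "\<And>x. x \<in> {0..T} \<Longrightarrow> u x = u 0 + integral {0..x} v"
    and i1: "AE t in leb_interval T. - v t \<in> \<L> (\<mu> t)"
    and i2: "AE t in leb_interval T. \<mu> t - \<tau> *\<^sub>R v t - lower (u t) \<in> \<L> (u t)"
    using f unfolding flow_def by blast+
  show ae: "AE t in leb_interval T. weak_deriv T u t = v t" by (rule indefinite_integral_W11(3)[OF T v u])
  have "AE t in leb_interval T. 0 \<in> (\<lambda>\<eta>. weak_deriv T u t + \<eta>) ` \<L> (\<mu> t)"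
    using i1 ae by eventually_elim (auto intro!: image_eqI[rotated])
  moreover have "AE t in leb_interval T. \<mu> t \<in> (\<lambda>\<xi>. \<tau> *\<^sub>R weak_deriv T u t + \<xi> + (a * norm (u t) powr (q - 2)) *\<^sub>R u t + \<pi> (u t))
                ` \<L> (u t)"
    using i2 ae by eventually_elim (auto intro!: image_eqI[rotated] simp: lower_def)
  ultimately show "is_solution E w p a q \<pi> T u\<^sub>0 \<tau> u \<mu>"
    unfolding is_solution_def using f ac indefinite_integral_W11(2)[OF T v u] by (auto simp: flow_def)
qed

lemma gradient_bounded:
  assumes u: "continuous_on {0..T} u"
    and \<zeta>: "AE t in leb_interval T. \<zeta> t - lower (u t) \<in> \<L> (u t)"
  shows "\<exists>C. AE t in leb_interval T. norm (\<zeta> t) \<le> C"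
proof -
  obtain R where R: "\<And>t. t \<in> {0..T} \<Longrightarrow> norm (u t) \<le> R" using continuous_bounded_Icc[OF u] by blast
  obtain C1 where C1: "\<And>x \<xi>. norm x \<le> R \<Longrightarrow> \<xi> \<in> \<L> x \<Longrightarrow> norm \<xi> \<le> C1"
    using Laplacian_locally_bounded by blast
  obtain C2 where C2: "\<And>x. norm x \<le> R \<Longrightarrow> norm (lower x) \<le> C2" using lower_locally_bounded by blast
  have "AE t in leb_interval T. t \<in> {0..T}" by (intro AE_I2) auto
  with \<zeta> have "AE t in leb_interval T. norm (\<zeta> t) \<le> C1 + C2"
  proof eventually_elim
    fix t assume *: "\<zeta> t - lower (u t) \<in> \<L> (u t)" "t \<in> {0..T}"
    have "norm (\<zeta> t) \<le> norm (\<zeta> t - lower (u t)) + norm (lower (u t))" using norm_triangle_ineq[of "\<zeta> t - lower (u t)" "lower (u t)"] by simp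
    also have "\<dots> \<le> C1 + C2" using C1[OF R[OF *(2)] *(1)] C2[OF R[OF *(2)]] by simp
    finally show "norm (\<zeta> t) \<le> C1 + C2" .
  qed
  then show ?thesis by blast
qed

text \<open>The chain rule for the free energy; \<open>\<zeta>\<close> is \<open>\<mu> - \<tau> u'\<close> for a solution.\<close>
lemma energy_identity:
  assumes T: "T > 0" and v: "L1_fun T v" and u: "\<And>x. x \<in> {0..T} \<Longrightarrow> u x = u 0 + integral {0..x} v"
    and m: "\<zeta> \<in> borel_measurable (leb_interval T)"
    and \<zeta>: "AE t in leb_interval T. \<zeta> t - lower (u t) \<in> \<L> (u t)"
    and st: "0 \<le> s" "s \<le> t" "t \<le> T"
  shows "(\<integral>x. \<zeta> x \<bullet> v x \<partial>lebesgue_on {s..t}) = \<Phi> (u t) - \<Phi> (u s)"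
proof -
  have cu: "continuous_on {0..T} u" by (rule indefinite_integral_W11(1)[OF T v u])
  obtain C where C: "AE t in leb_interval T. norm (\<zeta> t) \<le> C" using gradient_bounded[OF cu \<zeta>] by blast
  have vI: "v integrable_on {0..T}" using v by (simp add: integrable_leb_interval_iff absolutely_integrable_on_def)
  show ?thesis
  proof (rule chain_rule[where C = C and K = L])
    show "u x = u s + integral {s..x} v" if x: "x \<in> {s..t}" for x
    proof -
      have "integral {0..s} v + integral {s..x} v = integral {0..x} v"
        using x st vI by (intro Henstock_Kurzweil_Integration.integral_combine) (auto intro: integrable_on_subinterval)
      then show ?thesis using u[of s] u[of x] x st by (auto simp: algebra_simps)
    qed
    show "AE x in lebesgue_on {s..t}. norm (\<zeta> x) \<le> C" by (rule AE_leb_interval_subset[OF C st(1,3)])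
    show "AE x in lebesgue_on {s..t}. \<forall>z. \<zeta> x \<bullet> (z - u x) - L * (norm (z - u x))\<^sup>2 \<le> \<Phi> z - \<Phi> (u x)"
      using AE_leb_interval_subset[OF \<zeta> st(1,3)]
    proof eventually_elim
      fix x assume "\<zeta> x - lower (u x) \<in> \<L> (u x)"
      from \<Phi>_semiconvex[OF this] show "\<forall>z. \<zeta> x \<bullet> (z - u x) - L * (norm (z - u x))\<^sup>2 \<le> \<Phi> z - \<Phi> (u x)" by simp
    qed
  qed (use st v m integrable_leb_interval_subset borel_measurable_leb_interval_subset continuous_on_\<Phi> lipschitz_on_nonneg[OF L] in auto)
qed

text \<open>For \<open>\<tau> > 0\<close> the function \<open>v\<close> is bounded (not uniformly in \<open>\<tau>\<close>): since \<open>\<mu> \<bullet> v \<le> - \<phi> \<mu> \<le> 0\<close>, the term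
  \<open>\<tau> * (norm v)\<^sup>2\<close> is at most \<open>norm (\<mu> - \<tau> v) * norm v\<close>, and \<open>\<mu> - \<tau> v\<close> is a bounded gradient. This makes
  all the integrals below finite.\<close>
lemma flow_energy:
  assumes f: "flow T u\<^sub>0 \<tau> u v \<mu>" and T: "T > 0" and \<tau>: "\<tau> > 0"
  shows "\<And>s t. 0 \<le> s \<Longrightarrow> s \<le> t \<Longrightarrow> t \<le> T \<Longrightarrow> \<Phi> (u t) - \<Phi> (u s) \<le> (\<integral>x. \<mu> x \<bullet> v x \<partial>lebesgue_on {s..t})"
    and "integrable (leb_interval T) (\<lambda>t. \<mu> t \<bullet> v t)"
    and "integrable (leb_interval T) (\<lambda>t. \<phi> (\<mu> t))"
    and "\<And>t. t \<in> {0..T} \<Longrightarrow> \<Phi> (u t) \<le> \<Phi> u\<^sub>0"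
    and "(\<integral>t. \<phi> (\<mu> t) \<partial>leb_interval T) \<le> \<Phi> u\<^sub>0 - \<Phi> (u T)"
proof -
  let ?M = "leb_interval T"
  have v: "L1_fun T v" and \<mu>: "L1_fun T \<mu>" and u0: "u 0 = u\<^sub>0" and u: "\<And>x. x \<in> {0..T} \<Longrightarrow> u x = u 0 + integral {0..x} v"
    and i1: "AE t in ?M. - v t \<in> \<L> (\<mu> t)"
    and i2: "AE t in ?M. \<mu> t - \<tau> *\<^sub>R v t - lower (u t) \<in> \<L> (u t)"
    using f unfolding flow_def by blast+
  have [measurable]: "v \<in> borel_measurable ?M" "\<mu> \<in> borel_measurable ?M" using v \<mu> by auto
  let ?\<zeta> = "\<lambda>t. \<mu> t - \<tau> *\<^sub>R v t"
  have m: "?\<zeta> \<in> borel_measurable ?M" by measurable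
  have cu: "continuous_on {0..T} u" by (rule indefinite_integral_W11(1)[OF T v u])
  obtain C where C: "AE t in ?M. norm (?\<zeta> t) \<le> C" using gradient_bounded[OF cu i2] by blast
  have le: "AE t in ?M. \<phi> (\<mu> t) \<le> - (\<mu> t \<bullet> v t)"
    using i1
  proof eventually_elim
    fix t assume "- v t \<in> \<L> (\<mu> t)"
    from Laplacian_inner_ge[OF this] show "\<phi> (\<mu> t) \<le> - (\<mu> t \<bullet> v t)" by (simp add: inner_commute)
  qed
  have vC: "AE t in ?M. norm (v t) \<le> C / \<tau>"
    using le C
  proof eventually_elim
    fix t assume *: "\<phi> (\<mu> t) \<le> - (\<mu> t \<bullet> v t)" "norm (?\<zeta> t) \<le> C"
    have "\<mu> t \<bullet> v t = ?\<zeta> t \<bullet> v t + \<tau> * (norm (v t))\<^sup>2"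
      by (simp add: inner_diff_left power2_norm_eq_inner)
    moreover have "- (norm (?\<zeta> t) * norm (v t)) \<le> ?\<zeta> t \<bullet> v t" using Cauchy_Schwarz_ineq2[of "?\<zeta> t" "v t"] by linarith
    ultimately have "\<tau> * norm (v t) * norm (v t) \<le> norm (?\<zeta> t) * norm (v t)"
      using *(1) energy_nonneg[of "\<mu> t"] by (simp add: power2_eq_square)
    then have "\<tau> * norm (v t) \<le> C" using *(2) by (cases "v t = 0") (auto intro: order_trans[OF norm_ge_zero])
    then show "norm (v t) \<le> C / \<tau>" using \<tau> by (simp add: field_simps)
  qed
  have iv2: "integrable ?M (\<lambda>t. v t \<bullet> v t)" by (rule bounded_inner_integrable(1)[OF v _ vC]) measurable
  have i\<zeta>: "integrable ?M (\<lambda>t. ?\<zeta> t \<bullet> v t)" by (rule bounded_inner_integrable(1)[OF v m C])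
  have eq: "\<mu> t \<bullet> v t = ?\<zeta> t \<bullet> v t + \<tau> * (v t \<bullet> v t)" for t by (simp add: inner_diff_left)
  show i\<mu>: "integrable ?M (\<lambda>t. \<mu> t \<bullet> v t)" unfolding eq using iv2 i\<zeta> by (intro Bochner_Integration.integrable_add) auto
  show 1: "\<Phi> (u t) - \<Phi> (u s) \<le> (\<integral>x. \<mu> x \<bullet> v x \<partial>lebesgue_on {s..t})" if st: "0 \<le> s" "s \<le> t" "t \<le> T" for s t
  proof -
    have "(\<integral>x. ?\<zeta> x \<bullet> v x \<partial>lebesgue_on {s..t}) = \<Phi> (u t) - \<Phi> (u s)"
      by (rule energy_identity[OF T v u m i2 st])
    moreover have "(\<integral>x. ?\<zeta> x \<bullet> v x \<partial>lebesgue_on {s..t}) \<le> (\<integral>x. \<mu> x \<bullet> v x \<partial>lebesgue_on {s..t})"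
      using integrable_leb_interval_subset[OF i\<zeta> st(1,3)] integrable_leb_interval_subset[OF i\<mu> st(1,3)] \<tau>
      by (intro integral_mono) (auto simp: inner_diff_left)
    ultimately show ?thesis by simp
  qed
  have m\<phi>: "(\<lambda>t. \<phi> (\<mu> t)) \<in> borel_measurable ?M"
    using borel_measurable_continuous_onI[OF continuous_on_energy] by (rule measurable_compose[rotated]) measurable
  show i\<phi>: "integrable ?M (\<lambda>t. \<phi> (\<mu> t))"
  proof (rule Bochner_Integration.integrable_bound[OF i\<mu> m\<phi>])
    show "AE t in ?M. norm (\<phi> (\<mu> t)) \<le> norm (\<mu> t \<bullet> v t)"
      using le
    proof eventually_elim
      fix t assume "\<phi> (\<mu> t) \<le> - (\<mu> t \<bullet> v t)"
      then show "norm (\<phi> (\<mu> t)) \<le> norm (\<mu> t \<bullet> v t)" using energy_nonneg[of "\<mu> t"] by simp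
    qed
  qed
  show "\<Phi> (u t) \<le> \<Phi> u\<^sub>0" if t: "t \<in> {0..T}" for t
  proof -
    have "(\<integral>x. \<mu> x \<bullet> v x \<partial>lebesgue_on {0..t}) \<le> (\<integral>x. 0 \<partial>lebesgue_on {0..t})"
    proof (rule integral_mono_AE)
      show "AE x in lebesgue_on {0..t}. \<mu> x \<bullet> v x \<le> 0"
        using AE_leb_interval_subset[OF le order_refl, of t] t
        by (auto elim!: eventually_mono intro: order_trans[OF _ ] dest: order_trans[OF energy_nonneg])
    qed (use integrable_leb_interval_subset[OF i\<mu>, of 0 t] t in auto)
    then show ?thesis using 1[of 0 t] t u0 by simp
  qed
  have "(\<integral>t. \<phi> (\<mu> t) \<partial>?M) \<le> (\<integral>t. - (\<mu> t \<bullet> v t) \<partial>?M)" using i\<phi> i\<mu> le by (intro integral_mono_AE) auto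
  also have "\<dots> = - (\<integral>t. \<mu> t \<bullet> v t \<partial>lebesgue_on {0..T})" by (simp add: integral_leb_interval_Icc)
  also have "\<dots> \<le> \<Phi> u\<^sub>0 - \<Phi> (u T)" using 1[of 0 T] T u0 by simp
  finally show "(\<integral>t. \<phi> (\<mu> t) \<partial>?M) \<le> \<Phi> u\<^sub>0 - \<Phi> (u T)" .
qed

lemma flow_uniform_bounds:
  assumes T: "T > 0"
  obtains R B C where "\<And>\<tau> u v \<mu>. 0 < \<tau> \<Longrightarrow> \<tau> < 1 \<Longrightarrow> flow T u\<^sub>0 \<tau> u v \<mu> \<Longrightarrow>
     (\<forall>t\<in>{0..T}. norm (u t) \<le> R) \<and>
     Lr_fun (leb_interval T) r\<^sub>v v \<and> (\<integral>t. norm (v t) powr r\<^sub>v \<partial>leb_interval T) \<le> B \<and>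
     Lr_fun (leb_interval T) r\<^sub>\<mu> \<mu> \<and> (\<integral>t. norm (\<mu> t) powr r\<^sub>\<mu> \<partial>leb_interval T) \<le> B \<and>
     (p = 1 \<longrightarrow> (AE t in leb_interval T. norm (v t) \<le> C) \<and> (AE t in leb_interval T. norm (\<mu> t) \<le> C))"
proof -
  let ?M = "leb_interval T"
  obtain R where R: "\<And>x. \<Phi> x \<le> \<Phi> u\<^sub>0 \<Longrightarrow> norm x \<le> R" using \<Phi>_sublevel_bounded[of "\<Phi> u\<^sub>0"] by blast
  obtain m where m: "\<And>x. m \<le> \<Phi> x" using \<Phi>_bounded_below by blast
  obtain C1 where C1: "C1 \<ge> 0" "\<And>x \<xi>. norm x \<le> R \<Longrightarrow> \<xi> \<in> \<L> x \<Longrightarrow> norm \<xi> \<le> C1"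
    using Laplacian_locally_bounded by blast
  obtain C2 where C2: "C2 \<ge> 0" "\<And>x. norm x \<le> R \<Longrightarrow> norm (lower x) \<le> C2" using lower_locally_bounded by blast
  \<comment> \<open>covers the subgradient at \<open>u\<close> and the lower order terms, as well as the sum of the components of \<open>\<mu>\<close>\<close>
  define D where "D = C1 + C2 + real CARD('n) * C2"
  have D: "D \<ge> 0" using C1 C2 by (simp add: D_def)
  obtain A C where A: "A \<ge> 0" 
    "\<And>x v. - v \<in> \<L> x \<Longrightarrow> norm x \<le> norm v + D \<Longrightarrow> \<bar>\<Sum>i\<in>UNIV. x $ i\<bar> \<le> D \<Longrightarrow>
       norm v powr r\<^sub>v \<le> A * (1 + \<phi> x) \<and> norm x powr r\<^sub>\<mu> \<le> A * (1 + \<phi> x)"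
    "\<And>x v. - v \<in> \<L> x \<Longrightarrow> norm x \<le> norm v + D \<Longrightarrow> p = 1 \<Longrightarrow> norm v \<le> C \<and> norm x \<le> C"
    using growth_bounds[OF D] by metis
  define W where "W = \<Phi> u\<^sub>0 - m"
  show ?thesis
  proof (rule that[of R "A * (T + W)" C])
    fix \<tau> u v \<mu> assume \<tau>: "0 < \<tau>" "\<tau> < 1" and f: "flow T u\<^sub>0 \<tau> u v \<mu>"
    have v: "L1_fun T v" and \<mu>: "L1_fun T \<mu>"
      and i1: "AE t in ?M. - v t \<in> \<L> (\<mu> t)"
      and i2: "AE t in ?M. \<mu> t - \<tau> *\<^sub>R v t - lower (u t) \<in> \<L> (u t)"
      using f unfolding flow_def by blast+
    have [measurable]: "v \<in> borel_measurable ?M" "\<mu> \<in> borel_measurable ?M" using v \<mu> by auto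
    note en = flow_energy[OF f T \<tau>(1)]
    have uR: "norm (u t) \<le> R" if "t \<in> {0..T}" for t using en(4)[OF that] by (rule R)
    have W: "(\<integral>t. \<phi> (\<mu> t) \<partial>?M) \<le> W" using en(5) m[of "u T"] by (simp add: W_def)
    have "AE t in ?M. t \<in> {0..T}" by (intro AE_I2) auto
    with i1 i2 have ae: "AE t in ?M. - v t \<in> \<L> (\<mu> t) \<and>
       norm (\<mu> t) \<le> norm (v t) + D \<and> \<bar>\<Sum>i\<in>UNIV. \<mu> t $ i\<bar> \<le> D"
    proof eventually_elim
      fix t assume *: "- v t \<in> \<L> (\<mu> t)"
        "\<mu> t - \<tau> *\<^sub>R v t - lower (u t) \<in> \<L> (u t)" "t \<in> {0..T}"
      let ?\<xi> = "\<mu> t - \<tau> *\<^sub>R v t - lower (u t)"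
      have b: "norm ?\<xi> \<le> C1" "norm (lower (u t)) \<le> C2" using C1(2)[OF uR[OF *(3)] *(2)] C2(2)[OF uR[OF *(3)]] by auto
      have "norm (\<tau> *\<^sub>R v t + ?\<xi> + lower (u t)) \<le> norm (\<tau> *\<^sub>R v t) + norm ?\<xi> + norm (lower (u t))"
        by (intro norm_triangle_le add_mono norm_triangle_ineq order_refl)
      then have "norm (\<mu> t) \<le> norm (\<tau> *\<^sub>R v t) + norm ?\<xi> + norm (lower (u t))" by simp
      moreover have "norm (\<tau> *\<^sub>R v t) \<le> norm (v t)" using \<tau> by (simp add: mult_left_le_one_le)
      moreover have "0 \<le> real CARD('n) * C2" using C2 by simp
      ultimately have 1: "norm (\<mu> t) \<le> norm (v t) + D" using b by (simp add: D_def)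
      have "(\<Sum>i\<in>UNIV. ?\<xi> $ i) = 0" "(\<Sum>i\<in>UNIV. (- v t) $ i) = 0" by (rule Laplacian_sum_zero[OF *(2)], rule Laplacian_sum_zero[OF *(1)])
      then have "(\<Sum>i\<in>UNIV. \<mu> t $ i) = (\<Sum>i\<in>UNIV. lower (u t) $ i)"
        by (simp add: sum_subtractf sum_negf sum_distrib_left[symmetric])
      also have "\<bar>\<dots>\<bar> \<le> (\<Sum>i\<in>(UNIV::'n set). C2)"
        using component_le_norm_cart[of "lower (u t)"] b(2) by (intro order_trans[OF sum_abs] sum_mono) (meson order_trans)
      also have "\<dots> \<le> D" using C1 C2 by (simp add: D_def)
      finally show "- v t \<in> \<L> (\<mu> t) \<and> norm (\<mu> t) \<le> norm (v t) + D \<and> \<bar>\<Sum>i\<in>UNIV. \<mu> t $ i\<bar> \<le> D"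
        using * 1 by simp
    qed
    have ib: "integrable ?M (\<lambda>t. A * (1 + \<phi> (\<mu> t)))" using en(3) by simp
    have bint: "(\<integral>t. A * (1 + \<phi> (\<mu> t)) \<partial>?M) \<le> A * (T + W)"
    proof -
      have "(\<integral>t. A * (1 + \<phi> (\<mu> t)) \<partial>?M) = A * (\<integral>t. 1 + \<phi> (\<mu> t) \<partial>?M)" by simp
      also have "(\<integral>t. 1 + \<phi> (\<mu> t) \<partial>?M) = T + (\<integral>t. \<phi> (\<mu> t) \<partial>?M)"
        using en(3) T by (subst Bochner_Integration.integral_add) (auto simp: measure_leb_interval)
      also have "A * (T + (\<integral>t. \<phi> (\<mu> t) \<partial>?M)) \<le> A * (T + W)" using W A(1) by (intro mult_left_mono) auto
      finally show ?thesis .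
    qed
    have 1: "AE t in ?M. norm (v t) powr r\<^sub>v \<le> A * (1 + \<phi> (\<mu> t))" using ae by eventually_elim (use A(2) in blast)
    have 2: "AE t in ?M. norm (\<mu> t) powr r\<^sub>\<mu> \<le> A * (1 + \<phi> (\<mu> t))" using ae by eventually_elim (use A(2) in blast)
    have gen: "Lr_fun ?M r g \<and> (\<integral>t. norm (g t) powr r \<partial>?M) \<le> A * (T + W)"
      if g: "g \<in> borel_measurable ?M" "AE t in ?M. norm (g t) powr r \<le> A * (1 + \<phi> (\<mu> t))" for g :: "real \<Rightarrow> real ^ 'n" and r
    proof -
      note [measurable] = g(1)
      have i: "integrable ?M (\<lambda>t. norm (g t) powr r)"
      proof (rule Bochner_Integration.integrable_bound[OF ib])
        show "AE t in ?M. norm (norm (g t) powr r) \<le> norm (A * (1 + \<phi> (\<mu> t)))"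
          using g(2) by eventually_elim (simp add: order_trans[OF _ abs_ge_self])
      qed measurable
      then have "(\<integral>t. norm (g t) powr r \<partial>?M) \<le> (\<integral>t. A * (1 + \<phi> (\<mu> t)) \<partial>?M)" using ib g(2) by (intro integral_mono_AE)
      then show ?thesis using i bint g(1) by (simp add: Lr_fun_def)
    qed
    have 3: "(AE t in ?M. norm (v t) \<le> C) \<and> (AE t in ?M. norm (\<mu> t) \<le> C)" if "p = 1"
    proof -
      have "AE t in ?M. norm (v t) \<le> C \<and> norm (\<mu> t) \<le> C" using ae by eventually_elim (use A(3)[OF _ _ that] in blast)
      then show ?thesis by simp
    qed
    show "(\<forall>t\<in>{0..T}. norm (u t) \<le> R) \<and>
     Lr_fun ?M r\<^sub>v v \<and> (\<integral>t. norm (v t) powr r\<^sub>v \<partial>?M) \<le> A * (T + W) \<and>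
     Lr_fun ?M r\<^sub>\<mu> \<mu> \<and> (\<integral>t. norm (\<mu> t) powr r\<^sub>\<mu> \<partial>?M) \<le> A * (T + W) \<and>
     (p = 1 \<longrightarrow> (AE t in ?M. norm (v t) \<le> C) \<and> (AE t in ?M. norm (\<mu> t) \<le> C))"
      using uR gen[OF _ 1] gen[OF _ 2] 3 by auto
  qed
qed

end

section \<open>Passage to the limit in the inclusions\<close>

lemma equicontinuity:
  fixes B :: real
  assumes r: "r > 1" and e: "e > 0"
  shows "\<exists>d>0. \<forall>(f :: real \<Rightarrow> 'a::euclidean_space) s t. Lr_fun (leb_interval T) r f \<longrightarrow>
     (\<integral>t. norm (f t) powr r \<partial>leb_interval T) \<le> B \<longrightarrow> 0 \<le> s \<longrightarrow> s \<le> t \<longrightarrow> t \<le> T \<longrightarrow> t - s < d \<longrightarrow>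
     norm (integral {s..t} f) < e"
proof -
  obtain K where K: "K > 0" "K powr (1 - r) * B < e / 2" using powr_small_multiple[OF r, of "e / 2" B] e by auto
  show ?thesis
  proof (intro exI[of _ "e / (2 * K)"] conjI allI impI)
    show "e / (2 * K) > 0" using e K by simp
    fix f :: "real \<Rightarrow> 'a" and s t
    assume *: "Lr_fun (leb_interval T) r f" "(\<integral>t. norm (f t) powr r \<partial>leb_interval T) \<le> B" "0 \<le> s" "s \<le> t" "t \<le> T" "t - s < e / (2 * K)"
    have "K * (t - s) < K * (e / (2 * K))" using * K by (intro mult_strict_left_mono) auto
    also have "\<dots> = e / 2" using K by simp
    finally have 1: "K * (t - s) < e / 2" .
    have "integral {s..t} (\<lambda>x. norm (f x) powr r) \<le> B"
      using interval_integral_norm_le[OF Lr_funD(2)[OF *(1)] *(3,5)] *(2) by simp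
    then have "K powr (1 - r) * integral {s..t} (\<lambda>x. norm (f x) powr r) \<le> K powr (1 - r) * B"
      by (intro mult_left_mono) auto
    then show "norm (integral {s..t} f) < e"
      using interval_integral_norm_split[OF r *(1,3-5) K(1)] 1 K(2) by linarith
  qed
qed

text \<open>A closed condition that holds almost everywhere for each parameter holds almost everywhere for all
  parameters simultaneously, by separability of the parameter set.\<close>
lemma AE_ball_dense:
  fixes G :: "'z::euclidean_space \<Rightarrow> 'x \<Rightarrow> real"
  assumes c: "\<And>t. continuous_on UNIV (\<lambda>z. G z t)" and ae: "\<And>z. z \<in> S \<Longrightarrow> AE t in M. G z t \<ge> 0"
  shows "AE t in M. \<forall>z\<in>S. G z t \<ge> 0"
proof -
  obtain D where D: "countable D" "D \<subseteq> S" "S \<subseteq> closure D" using separable[of S] by blast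
  have "AE t in M. \<forall>z\<in>D. G z t \<ge> 0" using D ae by (subst AE_ball_countable) auto
  then show ?thesis
  proof eventually_elim
    fix t assume "\<forall>z\<in>D. G z t \<ge> 0"
    moreover have "closed {z. G z t \<ge> 0}" by (intro closed_Collect_le continuous_intros c)
    ultimately have "closure D \<subseteq> {z. G z t \<ge> 0}" by (intro closure_minimal) auto
    then show "\<forall>z\<in>S. G z t \<ge> 0" using D by auto
  qed
qed

lemma AE_nonneg_leb_interval:
  fixes f :: "real \<Rightarrow> real"
  assumes f: "L1_fun T f"
    and I: "\<And>s t. 0 \<le> s \<Longrightarrow> s \<le> t \<Longrightarrow> t \<le> T \<Longrightarrow> (\<integral>x. f x \<partial>lebesgue_on {s..t}) \<ge> 0"
  shows "AE t in leb_interval T. f t \<ge> 0"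
proof (rule AE_leb_interval_Icc[OF AE_nonneg_of_interval_integrals])
  show "f absolutely_integrable_on {0..T}" using f by (simp add: integrable_leb_interval_iff)
  show "0 \<le> integral {s..t} f" if "0 \<le> s" "s \<le> t" "t \<le> T" for s t
    using I[OF that] interval_integral_eq_lebesgue[OF f that(1,3)] by simp
qed

lemma indicator_bounded_measurable:
  fixes v :: "real \<Rightarrow> 'a::euclidean_space"
  assumes v: "continuous_on {0..T} v" and st: "0 \<le> s" "t \<le> T"
  shows "(\<lambda>x. indicator {s..t} x *\<^sub>R v x) \<in> borel_measurable (leb_interval T)"
    and "\<exists>C. AE x in leb_interval T. norm (indicator {s..t} x *\<^sub>R v x) \<le> C"
proof -
  show "(\<lambda>x. indicator {s..t} x *\<^sub>R v x) \<in> borel_measurable (leb_interval T)"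
    using interval_integral_eq_indicator(2)[OF continuous_integrable_leb_interval[OF v] st] by auto
  obtain C where C: "\<And>x. x \<in> {0..T} \<Longrightarrow> norm (v x) \<le> C" using continuous_bounded_Icc[OF v] by blast
  have "AE x in leb_interval T. norm (indicator {s..t} x *\<^sub>R v x) \<le> C"
  proof (rule AE_I2)
    fix x assume "x \<in> space (leb_interval T)"
    then have "norm (v x) \<le> C" using C[of x] by auto
    then show "norm (indicator {s..t} x *\<^sub>R v x) \<le> C" using order_trans[OF norm_ge_zero \<open>norm (v x) \<le> C\<close>] by (auto simp: indicator_def)
  qed
  then show "\<exists>C. AE x in leb_interval T. norm (indicator {s..t} x *\<^sub>R v x) \<le> C" by blast
qed

lemma lebesgue_on_eq_indicator:
  fixes f :: "real \<Rightarrow> 'a::euclidean_space"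
  assumes "L1_fun T f" "0 \<le> s" "t \<le> T"
  shows "(\<integral>x. f x \<partial>lebesgue_on {s..t}) = (\<integral>x. indicator {s..t} x *\<^sub>R f x \<partial>leb_interval T)"
  using interval_integral_eq_indicator(1)[OF assms] interval_integral_eq_lebesgue[OF assms] by simp

context potential
begin

text \<open>Pass to the limit, over every interval, in the subgradient inequality of \<open>\<phi>\<close> at \<open>u n\<close> with a fixed
  comparison vector \<open>z\<close>. Products of \<open>\<mu> n\<close> with \<open>u n\<close> converge as one factor does so weakly and the other
  uniformly; the term with the factor \<open>\<tau> n\<close> vanishes.\<close>
lemma limit_second_inclusion:
  assumes T: "T > 0"
    and fl: "\<And>n. flow T u\<^sub>0 (\<tau> n) (u n) (v n) (\<mu> n)" and \<tau>: "\<And>n. 0 < \<tau> n" "\<tau> \<longlonglongrightarrow> 0"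
    and R: "\<And>n t. t \<in> {0..T} \<Longrightarrow> norm (u n t) \<le> R"
    and v: "\<And>n. Lr_fun (leb_interval T) r\<^sub>v (v n)" "\<And>n. (\<integral>t. norm (v n t) powr r\<^sub>v \<partial>leb_interval T) \<le> B"
    and \<mu>: "\<And>n. Lr_fun (leb_interval T) r\<^sub>\<mu> (\<mu> n)" "\<And>n. (\<integral>t. norm (\<mu> n t) powr r\<^sub>\<mu> \<partial>leb_interval T) \<le> B"
    and ul: "uniform_limit {0..T} u ul sequentially"
    and \<mu>l: "Lr_fun (leb_interval T) r\<^sub>\<mu> \<mu>l" "\<And>x. x \<in> {0..T} \<Longrightarrow> (\<lambda>n. integral {0..x} (\<mu> n)) \<longlonglongrightarrow> integral {0..x} \<mu>l"
  shows "AE t in leb_interval T. \<mu>l t - lower (ul t) \<in> \<L> (ul t)"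
proof -
  let ?M = "leb_interval T"
  have cu: "continuous_on {0..T} (u n)" for n
    using indefinite_integral_W11(1)[OF T, of "v n" "u n"] fl[of n] unfolding flow_def by blast
  have cul: "continuous_on {0..T} ul" using uniform_limit_theorem[OF _ ul] cu by simp
  have pw: "(\<lambda>n. u n t) \<longlonglongrightarrow> ul t" if "t \<in> {0..T}" for t using tendsto_uniform_limitI[OF ul that] .
  have vL1: "L1_fun T (v n)" and \<mu>L1: "L1_fun T (\<mu> n)" and \<mu>lL1: "L1_fun T \<mu>l" for n
    using Lr_fun_L1 v \<mu> \<mu>l exponents_gt_1 by blast+
  have nb: "(\<integral>t. norm (v n t) \<partial>?M) \<le> T + B" "(\<integral>t. norm (\<mu> n t) \<partial>?M) \<le> T + B" for n
    using L1_norm_le[OF v(1) exponents_gt_1(1) _ zero_less_one, of n] L1_norm_le[OF \<mu>(1) exponents_gt_1(2) _ zero_less_one, of n] v(2)[of n] \<mu>(2)[of n] T by auto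
  have TB: "T + B \<ge> 0" using nb(1)[of 0] by (meson Bochner_Integration.integral_nonneg norm_ge_zero order_trans)
  let ?G = "\<lambda>z t. \<phi> z - \<phi> (ul t) - (\<mu>l t - lower (ul t)) \<bullet> (z - ul t)"
  have "AE t in ?M. ?G z t \<ge> 0" for z
  proof -
    let ?H = "\<lambda>x. \<phi> z - \<phi> x + lower x \<bullet> (z - x)"
    have cH: "continuous_on S ?H" for S by (intro continuous_intros continuous_on_energy continuous_on_lower)
    have iH: "integrable ?M (\<lambda>t. ?H (y t))" if "continuous_on {0..T} y" for y
      by (rule continuous_integrable_leb_interval) (rule continuous_on_compose2[OF cH that], auto)
    have izc: "integrable ?M (\<lambda>t. f t \<bullet> (z - y t))" if f: "L1_fun T f" and y: "continuous_on {0..T} y" for f y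
    proof -
      have c: "continuous_on {0..T} (\<lambda>t. z - y t)" by (intro continuous_intros y)
      obtain C where "\<And>t. t \<in> {0..T} \<Longrightarrow> norm (z - y t) \<le> C" using continuous_bounded_Icc[OF c] by blast
      then have "integrable ?M (\<lambda>t. (z - y t) \<bullet> f t)"
        by (intro bounded_inner_integrable(1)[OF f continuous_measurable_leb_interval[OF c], of C] AE_I2) auto
      then show ?thesis by (simp add: inner_commute)
    qed
    have G_eq: "?G z t = ?H (ul t) - \<mu>l t \<bullet> (z - ul t)" for t by (simp add: inner_diff_left)
    have iG: "L1_fun T (?G z)" unfolding G_eq by (intro Bochner_Integration.integrable_diff iH cul izc \<mu>lL1)
    show ?thesis
    proof (rule AE_nonneg_leb_interval[OF iG])
      fix s t assume st: "0 \<le> s" "s \<le> t" "t \<le> T"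
      let ?I = "\<lambda>f. \<integral>x. indicator {s..t} x *\<^sub>R f x \<partial>?M"
      have I1: "(\<lambda>n. ?I (\<lambda>x. ?H (u n x))) \<longlonglongrightarrow> ?I (\<lambda>x. ?H (ul x))"
      proof -
        have "compact (?H ` cball 0 R)" by (intro compact_continuous_image cH) auto
        from compact_imp_bounded[OF this] obtain D where D: "\<forall>y\<in>?H ` cball 0 R. norm y \<le> D" unfolding bounded_iff by blast
        show ?thesis
        proof (rule integral_dominated_convergence[where w = "\<lambda>_. \<bar>D\<bar>"])
          show "AE x in ?M. (\<lambda>n. indicator {s..t} x *\<^sub>R ?H (u n x)) \<longlonglongrightarrow> indicator {s..t} x *\<^sub>R ?H (ul x)"
          proof (rule AE_I2)
            fix x assume "x \<in> space ?M"
            then have "(\<lambda>n. u n x) \<longlonglongrightarrow> ul x" by (intro pw) auto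
            then have "(\<lambda>n. ?H (u n x)) \<longlonglongrightarrow> ?H (ul x)"
              using continuous_on_tendsto_compose[OF cH[of UNIV]] by auto
            then show "(\<lambda>n. indicator {s..t} x *\<^sub>R ?H (u n x)) \<longlonglongrightarrow> indicator {s..t} x *\<^sub>R ?H (ul x)" by (rule tendsto_scaleR[OF tendsto_const])
          qed
          show "AE x in ?M. norm (indicator {s..t} x *\<^sub>R ?H (u n x)) \<le> \<bar>D\<bar>" for n
          proof (rule AE_I2)
            fix x assume "x \<in> space ?M"
            then have "norm (?H (u n x)) \<le> D" using R[of x n] by (intro bspec[OF D]) auto
            then show "norm (indicator {s..t} x *\<^sub>R ?H (u n x)) \<le> \<bar>D\<bar>" by (auto simp: indicator_def)
          qed
        qed (use interval_integral_eq_indicator(2)[OF iH[OF cu] st(1,3)] interval_integral_eq_indicator(2)[OF iH[OF cul] st(1,3)] in auto)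
      qed
      have I2: "(\<lambda>n. ?I (\<lambda>x. \<mu> n x \<bullet> (z - ul x))) \<longlonglongrightarrow> ?I (\<lambda>x. \<mu>l x \<bullet> (z - ul x))"
      proof -
        have c: "continuous_on {0..T} (\<lambda>x. z - ul x)" by (intro continuous_intros cul)
        obtain C where C: "AE x in ?M. norm (indicator {s..t} x *\<^sub>R (z - ul x)) \<le> C"
          using indicator_bounded_measurable(2)[OF c st(1,3)] by blast
        have "(\<lambda>n. \<integral>x. (indicator {s..t} x *\<^sub>R (z - ul x)) \<bullet> \<mu> n x \<partial>?M) \<longlonglongrightarrow> (\<integral>x. (indicator {s..t} x *\<^sub>R (z - ul x)) \<bullet> \<mu>l x \<partial>?M)"
          by (rule bounded_test_convergence[OF exponents_gt_1(2) T \<mu> \<mu>l indicator_bounded_measurable(1)[OF c st(1,3)] C])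
        then show ?thesis by (simp add: inner_commute)
      qed
      have I3: "(\<lambda>n. ?I (\<lambda>x. \<mu> n x \<bullet> (z - u n x)) - ?I (\<lambda>x. \<mu> n x \<bullet> (z - ul x))) \<longlonglongrightarrow> 0"
      proof (rule LIMSEQ_I)
        fix e :: real assume e: "e > 0"
        define d where "d = e / (T + B + 1)"
        have d: "d > 0" using e TB by (simp add: d_def)
        have de: "d * (T + B) < e" using e TB by (simp add: d_def field_simps)
        obtain n0 where n0: "\<And>n x. n \<ge> n0 \<Longrightarrow> x \<in> {0..T} \<Longrightarrow> norm (u n x - ul x) < d"
          using ul d unfolding uniform_limit_iff eventually_sequentially dist_norm by blast
        show "\<exists>n0. \<forall>n\<ge>n0. norm (?I (\<lambda>x. \<mu> n x \<bullet> (z - u n x)) - ?I (\<lambda>x. \<mu> n x \<bullet> (z - ul x)) - 0) < e"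
        proof (intro exI[of _ n0] allI impI)
          fix n assume n: "n \<ge> n0"
          note i1 = interval_integral_eq_indicator(2)[OF izc[OF \<mu>L1[of n] cu[of n]] st(1,3)]
          note i2 = interval_integral_eq_indicator(2)[OF izc[OF \<mu>L1[of n] cul] st(1,3)]
          have "?I (\<lambda>x. \<mu> n x \<bullet> (z - u n x)) - ?I (\<lambda>x. \<mu> n x \<bullet> (z - ul x)) = (\<integral>x. indicator {s..t} x *\<^sub>R (\<mu> n x \<bullet> (z - u n x)) - indicator {s..t} x *\<^sub>R (\<mu> n x \<bullet> (z - ul x)) \<partial>?M)"
            by (rule Bochner_Integration.integral_diff[OF i1 i2, symmetric])
          also have "norm \<dots> \<le> (\<integral>x. d * norm (\<mu> n x) \<partial>?M)"
          proof (rule order_trans[OF integral_norm_bound integral_mono])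
            show "integrable ?M (\<lambda>x. norm (indicator {s..t} x *\<^sub>R (\<mu> n x \<bullet> (z - u n x)) - indicator {s..t} x *\<^sub>R (\<mu> n x \<bullet> (z - ul x))))"
              by (intro integrable_norm Bochner_Integration.integrable_diff i1 i2)
            fix x assume "x \<in> space ?M"
            then have x: "norm (u n x - ul x) \<le> d" using n0[OF n, of x] by auto
            have "\<bar>\<mu> n x \<bullet> (ul x - u n x)\<bar> \<le> norm (\<mu> n x) * norm (ul x - u n x)" by (rule Cauchy_Schwarz_ineq2)
            also have "\<dots> \<le> norm (\<mu> n x) * d" using x by (intro mult_left_mono) (auto simp: norm_minus_commute)
            finally show "norm (indicator {s..t} x *\<^sub>R (\<mu> n x \<bullet> (z - u n x)) - indicator {s..t} x *\<^sub>R (\<mu> n x \<bullet> (z - ul x))) \<le> d * norm (\<mu> n x)"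
              using d by (auto simp: indicator_def inner_diff_right[symmetric] mult.commute)
          qed (use \<mu>L1[of n] in auto)
          also have "\<dots> \<le> d * (T + B)" using nb(2)[of n] d by (simp add: mult_left_mono)
          finally show "norm (?I (\<lambda>x. \<mu> n x \<bullet> (z - u n x)) - ?I (\<lambda>x. \<mu> n x \<bullet> (z - ul x)) - 0) < e" using de by simp
        qed
      qed
      have I4: "(\<lambda>n. \<tau> n * ?I (\<lambda>x. v n x \<bullet> (z - u n x))) \<longlonglongrightarrow> 0"
      proof (rule Lim_null_comparison)
        show "(\<lambda>n. \<tau> n * ((norm z + R) * (T + B))) \<longlonglongrightarrow> 0" by (rule tendsto_mult_left_zero[OF \<tau>(2)])
        show "\<forall>\<^sub>F n in sequentially. norm (\<tau> n * ?I (\<lambda>x. v n x \<bullet> (z - u n x))) \<le> \<tau> n * ((norm z + R) * (T + B))"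
        proof (rule always_eventually, rule allI)
          fix n
          have R0: "norm z + R \<ge> 0" using R[of 0 n] T norm_ge_zero[of "u n 0"] by (smt (verit) atLeastAtMost_iff norm_ge_zero)
          note i1 = interval_integral_eq_indicator(2)[OF izc[OF vL1[of n] cu[of n]] st(1,3)]
          have "norm (?I (\<lambda>x. v n x \<bullet> (z - u n x))) \<le> (\<integral>x. (norm z + R) * norm (v n x) \<partial>?M)"
          proof (rule order_trans[OF integral_norm_bound integral_mono])
            fix x assume "x \<in> space ?M"
            then have x: "norm (z - u n x) \<le> norm z + R" using R[of x n] norm_triangle_ineq4[of z "u n x"] by auto
            have "\<bar>v n x \<bullet> (z - u n x)\<bar> \<le> norm (v n x) * norm (z - u n x)" by (rule Cauchy_Schwarz_ineq2)
            also have "\<dots> \<le> norm (v n x) * (norm z + R)" using x by (intro mult_left_mono) auto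
            finally show "norm (indicator {s..t} x *\<^sub>R (v n x \<bullet> (z - u n x))) \<le> (norm z + R) * norm (v n x)"
              using R0 by (auto simp: indicator_def mult.commute)
          qed (use integrable_norm[OF i1] vL1[of n] in auto)
          also have "\<dots> \<le> (norm z + R) * (T + B)" using nb(1)[of n] R0 by (simp add: mult_left_mono)
          finally show "norm (\<tau> n * ?I (\<lambda>x. v n x \<bullet> (z - u n x))) \<le> \<tau> n * ((norm z + R) * (T + B))"
            using \<tau>(1)[of n] by (simp add: abs_mult mult_left_mono)
        qed
      qed
      have nn: "0 \<le> ?I (\<lambda>x. ?H (u n x)) - ?I (\<lambda>x. \<mu> n x \<bullet> (z - u n x)) + \<tau> n * ?I (\<lambda>x. v n x \<bullet> (z - u n x))" for n
      proof -
        note j1 = interval_integral_eq_indicator(2)[OF iH[OF cu[of n]] st(1,3)]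
        note j2 = interval_integral_eq_indicator(2)[OF izc[OF \<mu>L1[of n] cu[of n]] st(1,3)]
        note j3 = integrable_mult_right[OF interval_integral_eq_indicator(2)[OF izc[OF vL1[of n] cu[of n]] st(1,3)], of "\<tau> n"]
        have "AE t in ?M. \<mu> n t - \<tau> n *\<^sub>R v n t - lower (u n t) \<in> \<L> (u n t)"
          using fl[of n] by (simp add: flow_def)
        then have "AE x in ?M. 0 \<le> indicator {s..t} x *\<^sub>R ?H (u n x) - indicator {s..t} x *\<^sub>R (\<mu> n x \<bullet> (z - u n x)) + \<tau> n * (indicator {s..t} x *\<^sub>R (v n x \<bullet> (z - u n x)))"
        proof eventually_elim
          fix x assume "\<mu> n x - \<tau> n *\<^sub>R v n x - lower (u n x) \<in> \<L> (u n x)"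
          then have "(\<mu> n x - \<tau> n *\<^sub>R v n x - lower (u n x)) \<bullet> (z - u n x) \<le> \<phi> z - \<phi> (u n x)"
            by (simp add: hypergraph_Laplacian_def subdifferential_def)
          then have "0 \<le> ?H (u n x) - \<mu> n x \<bullet> (z - u n x) + \<tau> n * (v n x \<bullet> (z - u n x))"
            by (simp add: inner_diff_left[of _ _ "z - u n x"])
          then show "0 \<le> indicator {s..t} x *\<^sub>R ?H (u n x) - indicator {s..t} x *\<^sub>R (\<mu> n x \<bullet> (z - u n x)) + \<tau> n * (indicator {s..t} x *\<^sub>R (v n x \<bullet> (z - u n x)))"
            by (cases "x \<in> {s..t}") simp_all
        qed
        then have "0 \<le> (\<integral>x. indicator {s..t} x *\<^sub>R ?H (u n x) - indicator {s..t} x *\<^sub>R (\<mu> n x \<bullet> (z - u n x)) + \<tau> n * (indicator {s..t} x *\<^sub>R (v n x \<bullet> (z - u n x))) \<partial>?M)"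
          by (rule integral_nonneg_AE)
        also have "\<dots> = (?I (\<lambda>x. ?H (u n x)) - ?I (\<lambda>x. \<mu> n x \<bullet> (z - u n x))) + (\<integral>x. \<tau> n * (indicator {s..t} x *\<^sub>R (v n x \<bullet> (z - u n x))) \<partial>?M)"
          unfolding Bochner_Integration.integral_diff[OF j1 j2, symmetric]
          by (rule Bochner_Integration.integral_add[OF Bochner_Integration.integrable_diff[OF j1 j2] j3])
        also have "(\<integral>x. \<tau> n * (indicator {s..t} x *\<^sub>R (v n x \<bullet> (z - u n x))) \<partial>?M) = \<tau> n * ?I (\<lambda>x. v n x \<bullet> (z - u n x))"
          by (rule integral_mult_right_zero)
        finally show ?thesis .
      qed
      have "(\<lambda>n. ?I (\<lambda>x. ?H (u n x)) - (?I (\<lambda>x. \<mu> n x \<bullet> (z - ul x)) + (?I (\<lambda>x. \<mu> n x \<bullet> (z - u n x)) - ?I (\<lambda>x. \<mu> n x \<bullet> (z - ul x)))) + \<tau> n * ?I (\<lambda>x. v n x \<bullet> (z - u n x)))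
         \<longlonglongrightarrow> ?I (\<lambda>x. ?H (ul x)) - (?I (\<lambda>x. \<mu>l x \<bullet> (z - ul x)) + 0) + 0"
        by (intro tendsto_add tendsto_diff I1 I2 I3 I4)
      then have "0 \<le> ?I (\<lambda>x. ?H (ul x)) - (?I (\<lambda>x. \<mu>l x \<bullet> (z - ul x)) + 0) + 0"
        by (rule LIMSEQ_le_const) (use nn in auto)
      also have "\<dots> = ?I (?G z)"
      proof -
        note j1 = interval_integral_eq_indicator(2)[OF iH[OF cul] st(1,3)]
        note j2 = interval_integral_eq_indicator(2)[OF izc[OF \<mu>lL1 cul] st(1,3)]
        show ?thesis
          unfolding G_eq scaleR_diff_right[of "indicator {s..t} _" "?H (ul _)"]
          using Bochner_Integration.integral_diff[OF j1 j2] by simp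
      qed
      also have "\<dots> = (\<integral>x. ?G z x \<partial>lebesgue_on {s..t})" by (rule lebesgue_on_eq_indicator[OF iG st(1,3), symmetric])
      finally show "0 \<le> (\<integral>x. ?G z x \<partial>lebesgue_on {s..t})" .
    qed
  qed
  then have "AE t in ?M. \<forall>z\<in>UNIV. ?G z t \<ge> 0"
    by (intro AE_ball_dense continuous_intros continuous_on_energy) auto
  then show ?thesis
    by eventually_elim (auto simp: hypergraph_Laplacian_def subdifferential_def)
qed

text \<open>Minty's argument. For a point \<open>(z, \<zeta>)\<close> of the graph of \<open>\<L>\<close>, the integral of
  \<open>(- v n - \<zeta>) \<bullet> (\<mu> n - z)\<close> over any interval is nonnegative. Its only nonlinear term is
  \<open>- \<mu> n \<bullet> v n\<close>, whose integral is at most the decrease of the free energy of \<open>u n\<close>. In the limit this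
  decrease equals the integral of \<open>- \<mu>l \<bullet> vl\<close> by the energy identity for the limit, which is available
  since the second inclusion is known with \<open>\<tau> = 0\<close>. Maximal monotonicity concludes.\<close>
lemma limit_first_inclusion:
  assumes T: "T > 0"
    and fl: "\<And>n. flow T u\<^sub>0 (\<tau> n) (u n) (v n) (\<mu> n)" and \<tau>: "\<And>n. 0 < \<tau> n"
    and ul: "\<And>t. t \<in> {0..T} \<Longrightarrow> (\<lambda>n. u n t) \<longlonglongrightarrow> ul t"
    and vl: "L1_fun T vl" "\<And>x. x \<in> {0..T} \<Longrightarrow> ul x = ul 0 + integral {0..x} vl"
    and \<mu>l: "L1_fun T \<mu>l" "\<And>x. x \<in> {0..T} \<Longrightarrow> (\<lambda>n. integral {0..x} (\<mu> n)) \<longlonglongrightarrow> integral {0..x} \<mu>l"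
    and incl: "AE t in leb_interval T. \<mu>l t - lower (ul t) \<in> \<L> (ul t)"
  shows "AE t in leb_interval T. - vl t \<in> \<L> (\<mu>l t)"
proof -
  let ?M = "leb_interval T"
  let ?S = "{(z, \<zeta>). \<zeta> \<in> \<L> z}"
  let ?G = "\<lambda>y t. (- vl t - snd y) \<bullet> (\<mu>l t - fst y)"
  have cul: "continuous_on {0..T} ul" by (rule indefinite_integral_W11(1)[OF T vl])
  have m\<mu>: "\<mu>l \<in> borel_measurable ?M" using \<mu>l by auto
  obtain C where C: "AE t in ?M. norm (\<mu>l t) \<le> C" using gradient_bounded[OF cul incl] by blast
  have i\<mu>v: "integrable ?M (\<lambda>t. \<mu>l t \<bullet> vl t)" by (rule bounded_inner_integrable(1)[OF vl(1) m\<mu> C])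
  have vL1: "L1_fun T (v n)" and \<mu>L1: "L1_fun T (\<mu> n)" and un: "\<And>x. x \<in> {0..T} \<Longrightarrow> u n x = u n 0 + integral {0..x} (v n)" for n
    using fl[of n] unfolding flow_def by blast+
  have expand: "(- x - \<zeta>) \<bullet> (y - z) = - (y \<bullet> x) + (z \<bullet> x - \<zeta> \<bullet> y) + \<zeta> \<bullet> z" for x y z \<zeta> :: "real ^ 'n"
    by (simp add: inner_diff_left inner_diff_right inner_commute algebra_simps)
  have intexp: "(\<integral>x. - (g x \<bullet> f x) + (z \<bullet> f x - \<zeta> \<bullet> g x) + \<zeta> \<bullet> z \<partial>lebesgue_on {s..t}) =
      - (\<integral>x. g x \<bullet> f x \<partial>lebesgue_on {s..t}) + (z \<bullet> integral {s..t} f - \<zeta> \<bullet> integral {s..t} g) + (t - s) * (\<zeta> \<bullet> z)"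
    if f: "L1_fun T f" and g: "L1_fun T g" and fg: "integrable ?M (\<lambda>x. g x \<bullet> f x)" and st: "0 \<le> s" "s \<le> t" "t \<le> T"
    for f g :: "real \<Rightarrow> real ^ 'n" and z \<zeta> s t
  proof -
    let ?N = "lebesgue_on {s..t}"
    have i: "integrable ?N f" "integrable ?N g" "integrable ?N (\<lambda>x. g x \<bullet> f x)" "integrable ?N (\<lambda>_. \<zeta> \<bullet> z)"
      using integrable_leb_interval_subset[OF _ st(1,3)] f g fg integrable_const_leb by blast+
    have "(\<integral>x. - (g x \<bullet> f x) + (z \<bullet> f x - \<zeta> \<bullet> g x) + \<zeta> \<bullet> z \<partial>?N) =
      (\<integral>x. - (g x \<bullet> f x) + (z \<bullet> f x - \<zeta> \<bullet> g x) \<partial>?N) + (\<integral>x. \<zeta> \<bullet> z \<partial>?N)"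
      using i by (intro Bochner_Integration.integral_add) auto
    also have "(\<integral>x. - (g x \<bullet> f x) + (z \<bullet> f x - \<zeta> \<bullet> g x) \<partial>?N) = (\<integral>x. - (g x \<bullet> f x) \<partial>?N) + (\<integral>x. z \<bullet> f x - \<zeta> \<bullet> g x \<partial>?N)"
      using i by (intro Bochner_Integration.integral_add) auto
    also have "(\<integral>x. z \<bullet> f x - \<zeta> \<bullet> g x \<partial>?N) = (\<integral>x. z \<bullet> f x \<partial>?N) - (\<integral>x. \<zeta> \<bullet> g x \<partial>?N)"
      using i by (intro Bochner_Integration.integral_diff) auto
    also have "(\<integral>x. z \<bullet> f x \<partial>?N) = z \<bullet> integral {s..t} f" 
      using i interval_integral_eq_lebesgue[OF f st(1,3)] by simp
    also have "(\<integral>x. \<zeta> \<bullet> g x \<partial>?N) = \<zeta> \<bullet> integral {s..t} g" 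
      using i interval_integral_eq_lebesgue[OF g st(1,3)] by simp
    also have "(\<integral>x. \<zeta> \<bullet> z \<partial>?N) = (t - s) * (\<zeta> \<bullet> z)" using st by (simp add: measure_restrict_space)
    finally show ?thesis by simp
  qed
  have G: "AE t in ?M. ?G y t \<ge> 0" if "y \<in> ?S" for y
  proof -
    obtain z \<zeta> where y: "y = (z, \<zeta>)" by (cases y)
    have \<zeta>: "\<zeta> \<in> \<L> z" using that by (simp add: y)
    have iG: "L1_fun T (\<lambda>t. (- vl t - \<zeta>) \<bullet> (\<mu>l t - z))"
      unfolding expand using i\<mu>v vl(1) \<mu>l(1) by auto
    have "AE t in ?M. (- vl t - \<zeta>) \<bullet> (\<mu>l t - z) \<ge> 0"
    proof (rule AE_nonneg_leb_interval[OF iG])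
      fix s t assume st: "0 \<le> s" "s \<le> t" "t \<le> T"
      have nn: "0 \<le> \<Phi> (u n s) - \<Phi> (u n t) + (z \<bullet> (u n t - u n s) - \<zeta> \<bullet> (integral {0..t} (\<mu> n) - integral {0..s} (\<mu> n))) + (t - s) * (\<zeta> \<bullet> z)" for n
      proof -
        note en = flow_energy[OF fl[of n] T \<tau>[of n]]
        have "AE x in ?M. - v n x \<in> \<L> (\<mu> n x)" using fl[of n] by (simp add: flow_def)
        from AE_leb_interval_subset[OF this st(1,3)]
        have "AE x in lebesgue_on {s..t}. 0 \<le> (- v n x - \<zeta>) \<bullet> (\<mu> n x - z)"
        proof eventually_elim
          fix x assume "- v n x \<in> \<L> (\<mu> n x)"
          then have "(- v n x) \<bullet> (z - \<mu> n x) \<le> \<phi> z - \<phi> (\<mu> n x)" "\<zeta> \<bullet> (\<mu> n x - z) \<le> \<phi> (\<mu> n x) - \<phi> z"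
            using \<zeta> by (auto simp: hypergraph_Laplacian_def subdifferential_def)
          then show "0 \<le> (- v n x - \<zeta>) \<bullet> (\<mu> n x - z)" by (simp add: inner_diff_left inner_diff_right)
        qed
        then have "0 \<le> (\<integral>x. (- v n x - \<zeta>) \<bullet> (\<mu> n x - z) \<partial>lebesgue_on {s..t})" by (rule integral_nonneg_AE)
        also have "\<dots> = - (\<integral>x. \<mu> n x \<bullet> v n x \<partial>lebesgue_on {s..t}) + (z \<bullet> integral {s..t} (v n) - \<zeta> \<bullet> integral {s..t} (\<mu> n)) + (t - s) * (\<zeta> \<bullet> z)"
          unfolding expand by (rule intexp[OF vL1 \<mu>L1 en(2) st])
        also have "\<dots> \<le> (\<Phi> (u n s) - \<Phi> (u n t)) + (z \<bullet> integral {s..t} (v n) - \<zeta> \<bullet> integral {s..t} (\<mu> n)) + (t - s) * (\<zeta> \<bullet> z)"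
          using en(1)[OF st] by simp
        also have "integral {s..t} (v n) = u n t - u n s"
          using integral_diff_eq_interval[OF vL1 st, of n] un[of s n] un[of t n] st by simp
        also have "integral {s..t} (\<mu> n) = integral {0..t} (\<mu> n) - integral {0..s} (\<mu> n)"
          by (rule integral_diff_eq_interval[OF \<mu>L1 st])
        finally show ?thesis .
      qed
      have \<Phi>lim: "(\<lambda>n. \<Phi> (u n x)) \<longlonglongrightarrow> \<Phi> (ul x)" if "x \<in> {0..T}" for x
        using continuous_on_tendsto_compose[OF continuous_on_\<Phi>[of UNIV] ul[OF that]] by auto
      have "(\<lambda>n. \<Phi> (u n s) - \<Phi> (u n t) + (z \<bullet> (u n t - u n s) - \<zeta> \<bullet> (integral {0..t} (\<mu> n) - integral {0..s} (\<mu> n))) + (t - s) * (\<zeta> \<bullet> z))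
        \<longlonglongrightarrow> \<Phi> (ul s) - \<Phi> (ul t) + (z \<bullet> (ul t - ul s) - \<zeta> \<bullet> (integral {0..t} \<mu>l - integral {0..s} \<mu>l)) + (t - s) * (\<zeta> \<bullet> z)"
        using st by (intro tendsto_intros \<Phi>lim ul \<mu>l(2)) auto
      then have "0 \<le> \<Phi> (ul s) - \<Phi> (ul t) + (z \<bullet> (ul t - ul s) - \<zeta> \<bullet> (integral {0..t} \<mu>l - integral {0..s} \<mu>l)) + (t - s) * (\<zeta> \<bullet> z)"
        by (rule LIMSEQ_le_const) (use nn in auto)
      also have "ul t - ul s = integral {s..t} vl"
        using integral_diff_eq_interval[OF vl(1) st] vl(2)[of s] vl(2)[of t] st by simp
      also have "integral {0..t} \<mu>l - integral {0..s} \<mu>l = integral {s..t} \<mu>l"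
        by (rule integral_diff_eq_interval[OF \<mu>l(1) st, symmetric])
      also have "\<Phi> (ul s) - \<Phi> (ul t) = - (\<integral>x. \<mu>l x \<bullet> vl x \<partial>lebesgue_on {s..t})"
        using energy_identity[OF T vl m\<mu> incl st] by simp
      also have "- (\<integral>x. \<mu>l x \<bullet> vl x \<partial>lebesgue_on {s..t}) + (z \<bullet> integral {s..t} vl - \<zeta> \<bullet> integral {s..t} \<mu>l) + (t - s) * (\<zeta> \<bullet> z) =
         (\<integral>x. (- vl x - \<zeta>) \<bullet> (\<mu>l x - z) \<partial>lebesgue_on {s..t})"
        unfolding expand by (rule intexp[OF vl(1) \<mu>l(1) i\<mu>v st, symmetric])
      finally show "0 \<le> (\<integral>x. (- vl x - \<zeta>) \<bullet> (\<mu>l x - z) \<partial>lebesgue_on {s..t})" .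
    qed
    then show ?thesis by (simp add: y)
  qed
  have "AE t in ?M. \<forall>y\<in>?S. ?G y t \<ge> 0"
    by (rule AE_ball_dense[OF _ G]) (intro continuous_intros)
  then show ?thesis
  proof eventually_elim
    fix t assume a: "\<forall>y\<in>?S. ?G y t \<ge> 0"
    show "- vl t \<in> \<L> (\<mu>l t)"
      unfolding hypergraph_Laplacian_def
    proof (rule monotone_graph_imp_subdifferential)
      fix z \<zeta> assume "\<zeta> \<in> subdifferential \<phi> z"
      then have "(z, \<zeta>) \<in> ?S" by (simp add: hypergraph_Laplacian_def)
      from bspec[OF a this] show "0 \<le> (- vl t - \<zeta>) \<bullet> (\<mu>l t - z)" by simp
    qed (use energy_convex continuous_on_energy energy_nonneg in auto)
  qed
qed

end

section \<open>The vanishing viscosity limit\<close>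

context potential
begin

lemma viscosity_limit:
  assumes T: "T > 0"
    and sol\<tau>: "\<And>\<tau>. 0 < \<tau> \<Longrightarrow> \<tau> < 1 \<Longrightarrow> is_solution E w p a q \<pi> T u\<^sub>0 \<tau> (u \<tau>) (\<mu> \<tau>)"
  shows "\<exists>(\<sigma> :: nat \<Rightarrow> real) ul \<mu>l.
     (\<forall>n. 0 < \<sigma> n \<and> \<sigma> n < 1) \<and> \<sigma> \<longlonglongrightarrow> 0 \<and>
     uniform_limit {0..T} (\<lambda>n. u (\<sigma> n)) ul sequentially \<and>
     (p = 1 \<longrightarrow> Linf_weak_star_conv T (\<lambda>n. weak_deriv T (u (\<sigma> n))) (weak_deriv T ul) \<and>
        Linf_weak_star_conv T (\<lambda>n. \<mu> (\<sigma> n)) \<mu>l) \<and>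
     (p > 1 \<longrightarrow> Lp_weak_conv (p / (p - 1)) T (\<lambda>n. weak_deriv T (u (\<sigma> n))) (weak_deriv T ul) \<and>
        Lp_weak_conv (max p (p / (p - 1))) T (\<lambda>n. \<mu> (\<sigma> n)) \<mu>l) \<and>
     is_solution E w p a q \<pi> T u\<^sub>0 0 ul \<mu>l"
proof -
  let ?M = "leb_interval T"
  define v where "v = (\<lambda>\<tau>. weak_deriv T (u \<tau>))"
  have fl: "flow T u\<^sub>0 \<tau> (u \<tau>) (v \<tau>) (\<mu> \<tau>)" if "0 < \<tau>" "\<tau> < 1" for \<tau>
    unfolding v_def by (rule is_solution_imp_flow[OF sol\<tau>[OF that] T])
  obtain R B C where bounds: "\<And>\<tau> u v \<mu>. 0 < \<tau> \<Longrightarrow> \<tau> < 1 \<Longrightarrow> flow T u\<^sub>0 \<tau> u v \<mu> \<Longrightarrow>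
     (\<forall>t\<in>{0..T}. norm (u t) \<le> R) \<and>
     Lr_fun ?M r\<^sub>v v \<and> (\<integral>t. norm (v t) powr r\<^sub>v \<partial>?M) \<le> B \<and>
     Lr_fun ?M r\<^sub>\<mu> \<mu> \<and> (\<integral>t. norm (\<mu> t) powr r\<^sub>\<mu> \<partial>?M) \<le> B \<and>
     (p = 1 \<longrightarrow> (AE t in ?M. norm (v t) \<le> C) \<and> (AE t in ?M. norm (\<mu> t) \<le> C))"
    using flow_uniform_bounds[OF T, of u\<^sub>0] by metis
  \<comment> \<open>starts at \<open>1 / 2\<close>, since \<open>\<tau> < 1\<close> is required\<close>
  define \<tau> where "\<tau> = (\<lambda>n. inverse (real (Suc (Suc n))))"
  have \<tau>: "0 < \<tau> n" "\<tau> n < 1" for n by (auto simp: \<tau>_def inverse_eq_divide)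
  have \<tau>0: "\<tau> \<longlonglongrightarrow> 0" unfolding \<tau>_def by (rule LIMSEQ_Suc[OF LIMSEQ_inverse_real_of_nat])
  note bd = bounds[OF \<tau> fl[OF \<tau>]]
  have R: "norm (u (\<tau> n) t) \<le> R" if "t \<in> {0..T}" for n t using bd[of n] that by blast
  have Lv: "Lr_fun ?M r\<^sub>v (v (\<tau> n))" and Bv: "(\<integral>t. norm (v (\<tau> n) t) powr r\<^sub>v \<partial>?M) \<le> B"
    and L\<mu>: "Lr_fun ?M r\<^sub>\<mu> (\<mu> (\<tau> n))" and B\<mu>: "(\<integral>t. norm (\<mu> (\<tau> n) t) powr r\<^sub>\<mu> \<partial>?M) \<le> B" for n
    using bd[of n] by blast+
  have L1v: "L1_fun T (v (\<tau> n))" and L1\<mu>: "L1_fun T (\<mu> (\<tau> n))" for n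
    using Lr_fun_L1[OF Lv exponents_gt_1(1)] Lr_fun_L1[OF L\<mu> exponents_gt_1(2)] by blast+
  have uv: "u (\<tau> n) x = u\<^sub>0 + integral {0..x} (v (\<tau> n))" if "x \<in> {0..T}" for n x
    using fl[OF \<tau>, of n] that unfolding flow_def by metis
  \<comment> \<open>compactness for \<open>u\<close> and for the primitive of \<open>\<mu>\<close> at once\<close>
  define F where "F = (\<lambda>n x. (u (\<tau> n) x, integral {0..x} (\<mu> (\<tau> n))))"
  have Fbd: "norm (F n x) \<le> R + (T + B)" if x: "x \<in> {0..T}" for n x
  proof -
    have "norm (integral {0..x} (\<mu> (\<tau> n))) \<le> (\<integral>t. norm (\<mu> (\<tau> n) t) \<partial>?M)"
      using x by (intro interval_integral_norm_le L1\<mu>) auto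
    also have "\<dots> \<le> T + B"
      using L1_norm_le[OF L\<mu>[of n] exponents_gt_1(2) _ zero_less_one] B\<mu>[of n] T by simp
    finally show ?thesis
      using R[OF x, of n] norm_Pair_le[of "u (\<tau> n) x" "integral {0..x} (\<mu> (\<tau> n))"] unfolding F_def by linarith
  qed
  have Feq: "\<exists>d>0. \<forall>n. \<forall>x\<in>{0..T}. \<forall>y\<in>{0..T}. norm (x - y) < d \<longrightarrow> norm (F n x - F n y) < e" if e: "e > 0" for e
  proof -
    have e2: "e / 2 > 0" using e by simp
    obtain d1 where d1: "d1 > 0" "\<And>n s t. 0 \<le> s \<Longrightarrow> s \<le> t \<Longrightarrow> t \<le> T \<Longrightarrow> t - s < d1 \<Longrightarrow> norm (integral {s..t} (v (\<tau> n))) < e / 2"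
      using equicontinuity[OF exponents_gt_1(1) e2, of T B] Lv Bv by blast
    obtain d2 where d2: "d2 > 0" "\<And>n s t. 0 \<le> s \<Longrightarrow> s \<le> t \<Longrightarrow> t \<le> T \<Longrightarrow> t - s < d2 \<Longrightarrow> norm (integral {s..t} (\<mu> (\<tau> n))) < e / 2"
      using equicontinuity[OF exponents_gt_1(2) e2, of T B] L\<mu> B\<mu> by blast
    have key: "norm (F n t - F n s) < e" if st: "0 \<le> s" "s \<le> t" "t \<le> T" "t - s < min d1 d2" for n s t
    proof -
      have "F n t - F n s = (integral {s..t} (v (\<tau> n)), integral {s..t} (\<mu> (\<tau> n)))"
        using uv[of t n] uv[of s n] integral_diff_eq_interval[OF L1v st(1-3)] integral_diff_eq_interval[OF L1\<mu> st(1-3)] st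
        by (simp add: F_def)
      also have "norm \<dots> \<le> norm (integral {s..t} (v (\<tau> n))) + norm (integral {s..t} (\<mu> (\<tau> n)))" by (rule norm_Pair_le)
      also have "\<dots> < e" using d1(2)[of s t n] d2(2)[of s t n] st by simp
      finally show ?thesis .
    qed
    show ?thesis
    proof (intro exI[of _ "min d1 d2"] conjI allI ballI impI)
      fix n x y assume *: "x \<in> {0..T}" "y \<in> {0..T}" "norm (x - y) < min d1 d2"
      show "norm (F n x - F n y) < e"
      proof (cases "x \<le> y")
        case True
        then show ?thesis using key[of x y n] * by (simp add: norm_minus_commute)
      next
        case False
        then show ?thesis using key[of y x n] * by simp
      qed
    qed (use d1 d2 in auto)
  qed
  obtain g k where k: "strict_mono (k :: nat \<Rightarrow> nat)"
    and lim: "\<And>e. 0 < e \<Longrightarrow> \<exists>N. \<forall>n x. n \<ge> N \<and> x \<in> {0..T} \<longrightarrow> norm (F (k n) x - g x) < e"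
  proof (rule Arzela_Ascoli[of "{0..T}" F "R + (T + B)"])
    show "\<exists>d. 0 < d \<and> (\<forall>n y. y \<in> {0..T} \<and> norm (x - y) < d \<longrightarrow> norm (F n x - F n y) < e)"
      if x: "x \<in> {0..T}" "0 < e" for x e
      using Feq[OF x(2)] x(1) by blast
  qed (use Fbd in auto)
  define \<sigma> where "\<sigma> = \<tau> \<circ> k"
  have \<sigma>: "0 < \<sigma> n" "\<sigma> n < 1" for n using \<tau> by (auto simp: \<sigma>_def)
  have \<sigma>0: "\<sigma> \<longlonglongrightarrow> 0" unfolding \<sigma>_def by (rule LIMSEQ_subseq_LIMSEQ[OF \<tau>0 k])
  define ul where "ul = (\<lambda>x. fst (g x))"
  define Ml where "Ml = (\<lambda>x. snd (g x))"
  have ulim: "uniform_limit {0..T} (\<lambda>n. u (\<sigma> n)) ul sequentially"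
    unfolding uniform_limit_iff
  proof (intro allI impI)
    fix e :: real assume "e > 0"
    then obtain N where N: "\<And>n x. n \<ge> N \<Longrightarrow> x \<in> {0..T} \<Longrightarrow> norm (F (k n) x - g x) < e" using lim by blast
    have "dist (u (\<sigma> n) x) (ul x) < e" if "n \<ge> N" "x \<in> {0..T}" for n x
      using N[OF that] norm_fst_le[of "fst (F (k n) x - g x)" "snd (F (k n) x - g x)", unfolded prod.collapse]
      by (simp add: dist_norm F_def \<sigma>_def ul_def)
    then show "\<forall>\<^sub>F n in sequentially. \<forall>x\<in>{0..T}. dist (u (\<sigma> n) x) (ul x) < e"
      unfolding eventually_sequentially by blast
  qed
  have upw: "(\<lambda>n. u (\<sigma> n) x) \<longlonglongrightarrow> ul x" if "x \<in> {0..T}" for x using tendsto_uniform_limitI[OF ulim that] .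
  have Mlim: "(\<lambda>n. integral {0..x} (\<mu> (\<sigma> n))) \<longlonglongrightarrow> Ml x" if x: "x \<in> {0..T}" for x
  proof (rule LIMSEQ_I)
    fix e :: real assume "e > 0"
    then obtain N where N: "\<And>n x. n \<ge> N \<Longrightarrow> x \<in> {0..T} \<Longrightarrow> norm (F (k n) x - g x) < e" using lim by blast
    have "norm (integral {0..x} (\<mu> (\<sigma> n)) - Ml x) < e" if "n \<ge> N" for n
      using N[OF that x] norm_snd_le[of "snd (F (k n) x - g x)" "fst (F (k n) x - g x)", unfolded prod.collapse]
      by (simp add: F_def \<sigma>_def Ml_def)
    then show "\<exists>n0. \<forall>n\<ge>n0. norm (integral {0..x} (\<mu> (\<sigma> n)) - Ml x) < e" by blast
  qed
  have Mlim_all: "\<forall>x\<in>{0..T}. (\<lambda>n. integral {0..x} (\<mu> (\<sigma> n))) \<longlonglongrightarrow> Ml x" using Mlim by blast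
  have vlim: "(\<lambda>n. integral {0..x} (v (\<sigma> n))) \<longlonglongrightarrow> ul x - u\<^sub>0" if x: "x \<in> {0..T}" for x
  proof -
    have "integral {0..x} (v (\<sigma> n)) = u (\<sigma> n) x - u\<^sub>0" for n using uv[OF x, of "k n"] by (simp add: \<sigma>_def)
    then show ?thesis using tendsto_diff[OF upw[OF x] tendsto_const[of u\<^sub>0]] by simp
  qed
  then have vlim_all: "\<forall>x\<in>{0..T}. (\<lambda>n. integral {0..x} (v (\<sigma> n))) \<longlonglongrightarrow> ul x - u\<^sub>0" by blast
  have L\<sigma>: "Lr_fun ?M r\<^sub>v (v (\<sigma> n))" "(\<integral>t. norm (v (\<sigma> n) t) powr r\<^sub>v \<partial>?M) \<le> B"
    "Lr_fun ?M r\<^sub>\<mu> (\<mu> (\<sigma> n))" "(\<integral>t. norm (\<mu> (\<sigma> n) t) powr r\<^sub>\<mu> \<partial>?M) \<le> B" for n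
    using Lv[of "k n"] Bv[of "k n"] L\<mu>[of "k n"] B\<mu>[of "k n"] by (simp_all add: \<sigma>_def)
  from weak_limit_exists[OF exponents_gt_1(1) T, of "\<lambda>n. v (\<sigma> n)" B "\<lambda>x. ul x - u\<^sub>0", OF L\<sigma>(1,2) vlim_all]
  obtain vl hv where "Lr_fun ?M r\<^sub>v vl \<and> (\<forall>x\<in>{0..T}. integral {0..x} vl = (\<lambda>x. ul x - u\<^sub>0) x) \<and>
    (\<forall>j. hv j \<in> mids (\<lambda>n. v (\<sigma> n)) j) \<and> (\<forall>j. Lr_fun ?M r\<^sub>v (hv j)) \<and>
    (AE t in ?M. (\<lambda>j. hv j t) \<longlonglongrightarrow> vl t) \<and>
    (\<lambda>j. \<integral>t. norm (hv j t - vl t) powr r\<^sub>v \<partial>?M) \<longlonglongrightarrow> 0"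
    by (elim exE)
  then have vl: "Lr_fun ?M r\<^sub>v vl" "\<And>x. x \<in> {0..T} \<Longrightarrow> integral {0..x} vl = (\<lambda>x. ul x - u\<^sub>0) x"
    and hv: "\<And>j. hv j \<in> mids (\<lambda>n. v (\<sigma> n)) j" "AE t in ?M. (\<lambda>j. hv j t) \<longlonglongrightarrow> vl t"
    by blast+
  from weak_limit_exists[OF exponents_gt_1(2) T, of "\<lambda>n. \<mu> (\<sigma> n)" B "Ml", OF L\<sigma>(3,4) Mlim_all]
  obtain \<mu>l hm where "Lr_fun ?M r\<^sub>\<mu> \<mu>l \<and> (\<forall>x\<in>{0..T}. integral {0..x} \<mu>l = (Ml) x) \<and>
    (\<forall>j. hm j \<in> mids (\<lambda>n. \<mu> (\<sigma> n)) j) \<and> (\<forall>j. Lr_fun ?M r\<^sub>\<mu> (hm j)) \<and>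
    (AE t in ?M. (\<lambda>j. hm j t) \<longlonglongrightarrow> \<mu>l t) \<and>
    (\<lambda>j. \<integral>t. norm (hm j t - \<mu>l t) powr r\<^sub>\<mu> \<partial>?M) \<longlonglongrightarrow> 0"
    by (elim exE)
  then have \<mu>l: "Lr_fun ?M r\<^sub>\<mu> \<mu>l" "\<And>x. x \<in> {0..T} \<Longrightarrow> integral {0..x} \<mu>l = (Ml) x"
    and hm: "\<And>j. hm j \<in> mids (\<lambda>n. \<mu> (\<sigma> n)) j" "AE t in ?M. (\<lambda>j. hm j t) \<longlonglongrightarrow> \<mu>l t"
    by blast+
  have vl1: "L1_fun T vl" and \<mu>l1: "L1_fun T \<mu>l"
    using Lr_fun_L1[OF vl(1) exponents_gt_1(1)] Lr_fun_L1[OF \<mu>l(1) exponents_gt_1(2)] by blast+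
  have ul0: "ul 0 = u\<^sub>0" using vl(2)[of 0] T by simp
  have ulv: "ul x = ul 0 + integral {0..x} vl" if "x \<in> {0..T}" for x using vl(2)[OF that] ul0 by simp
  have AEbound: "AE t in ?M. norm (y t) \<le> C"
    if "\<And>n. AE t in ?M. norm (f n t) \<le> C" "\<And>j. h j \<in> mids f j" "AE t in ?M. (\<lambda>j. h j t) \<longlonglongrightarrow> y t"
    for f h and y :: "real \<Rightarrow> real ^ 'n"
  proof -
    have "AE t in ?M. \<forall>j. norm (h j t) \<le> C" using mids_AE_bound[OF that(1,2)] by (subst AE_all_countable) blast
    with that(3) show ?thesis
    proof eventually_elim
      fix t assume "(\<lambda>j. h j t) \<longlonglongrightarrow> y t" "\<forall>j. norm (h j t) \<le> C"
      then show "norm (y t) \<le> C" by (intro LIMSEQ_le_const2[OF tendsto_norm]) auto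
    qed
  qed
  have Mlim': "(\<lambda>n. integral {0..x} (\<mu> (\<sigma> n))) \<longlonglongrightarrow> integral {0..x} \<mu>l" if "x \<in> {0..T}" for x
    using Mlim[OF that] \<mu>l(2)[OF that] by simp
  have vlim': "(\<lambda>n. integral {0..x} (v (\<sigma> n))) \<longlonglongrightarrow> integral {0..x} vl" if "x \<in> {0..T}" for x
    using vlim[OF that] vl(2)[OF that] by simp
  have fl\<sigma>: "flow T u\<^sub>0 (\<sigma> n) (u (\<sigma> n)) (v (\<sigma> n)) (\<mu> (\<sigma> n))" for n by (rule fl[OF \<sigma>])
  have R\<sigma>: "norm (u (\<sigma> n) t) \<le> R" if "t \<in> {0..T}" for n t using R[OF that, of "k n"] by (simp add: \<sigma>_def)
  have i2: "AE t in ?M. \<mu>l t - lower (ul t) \<in> \<L> (ul t)"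
    by (rule limit_second_inclusion[OF T fl\<sigma> \<sigma>(1) \<sigma>0 R\<sigma> L\<sigma> ulim \<mu>l(1) Mlim'])
  have i1: "AE t in ?M. - vl t \<in> \<L> (\<mu>l t)"
    by (rule limit_first_inclusion[OF T fl\<sigma> \<sigma>(1) upw vl1 ulv \<mu>l1 Mlim' i2])
  have f: "flow T u\<^sub>0 0 ul vl \<mu>l" unfolding flow_def using vl1 \<mu>l1 ul0 ulv i1 i2 by auto
  have ac: "abs_cont_on 0 T ul" by (rule Lr_abs_cont[OF exponents_gt_1(1) T vl(1) ulv])
  have sol: "is_solution E w p a q \<pi> T u\<^sub>0 0 ul \<mu>l" and ae: "AE t in ?M. weak_deriv T ul t = vl t"
    by (rule flow_imp_is_solution[OF f T ac])+
  have f': "flow T u\<^sub>0 0 ul (weak_deriv T ul) \<mu>l" by (rule is_solution_imp_flow[OF sol T])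
  have wm: "weak_deriv T ul \<in> borel_measurable ?M" using f' by (auto simp: flow_def)
  have wd: "Lr_fun ?M r\<^sub>v (weak_deriv T ul)"
  proof -
    have "integrable ?M (\<lambda>t. norm (weak_deriv T ul t) powr r\<^sub>v)"
    proof (rule integrable_cong_AE_imp[OF Lr_funD(2)[OF vl(1)]])
      show "(\<lambda>t. norm (weak_deriv T ul t) powr r\<^sub>v) \<in> borel_measurable ?M" using wm by measurable
      show "AE t in ?M. norm (vl t) powr r\<^sub>v = norm (weak_deriv T ul t) powr r\<^sub>v" using ae by eventually_elim simp
    qed
    then show ?thesis using wm by (simp add: Lr_fun_def)
  qed
  have wlim: "(\<lambda>n. integral {0..x} (v (\<sigma> n))) \<longlonglongrightarrow> integral {0..x} (weak_deriv T ul)" if x: "x \<in> {0..T}" for x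
  proof -
    have "ul x = ul 0 + integral {0..x} (weak_deriv T ul)" using f' x unfolding flow_def by blast
    then show ?thesis using vlim'[OF x] ulv[OF x] by simp
  qed
  have case1: "Linf_weak_star_conv T (\<lambda>n. v (\<sigma> n)) (weak_deriv T ul) \<and> Linf_weak_star_conv T (\<lambda>n. \<mu> (\<sigma> n)) \<mu>l" if "p = 1"
  proof -
    have 1: "AE t in ?M. norm (v (\<sigma> n) t) \<le> C" and 2: "AE t in ?M. norm (\<mu> (\<sigma> n) t) \<le> C" for n
      using bounds[OF \<sigma> fl\<sigma>, of n] that by blast+
    have wC: "AE t in ?M. norm (weak_deriv T ul t) \<le> C"
      using AEbound[OF 1 hv] ae by eventually_elim simp
    show ?thesis
      using Linf_weak_star_convI[OF exponents_gt_1(1) T L\<sigma>(1,2) wd wlim 1 wC]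
        Linf_weak_star_convI[OF exponents_gt_1(2) T L\<sigma>(3,4) \<mu>l(1) Mlim' 2 AEbound[OF 2 hm]] by blast
  qed
  have case2: "Lp_weak_conv (p / (p - 1)) T (\<lambda>n. v (\<sigma> n)) (weak_deriv T ul) \<and>
     Lp_weak_conv (max p (p / (p - 1))) T (\<lambda>n. \<mu> (\<sigma> n)) \<mu>l" if "p > 1"
  proof -
    have "Lp_weak_conv r\<^sub>v T (\<lambda>n. v (\<sigma> n)) (weak_deriv T ul)"
      by (rule Lp_weak_convI[OF exponents_gt_1(1) T L\<sigma>(1,2) wd wlim])
    moreover have "Lp_weak_conv r\<^sub>\<mu> T (\<lambda>n. \<mu> (\<sigma> n)) \<mu>l"
      by (rule Lp_weak_convI[OF exponents_gt_1(2) T L\<sigma>(3,4) \<mu>l(1) Mlim'])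
    moreover have "r\<^sub>v = p / (p - 1)" "r\<^sub>\<mu> = max p (p / (p - 1))" using that unfolding r\<^sub>v_def r\<^sub>\<mu>_def by auto
    ultimately show ?thesis by metis
  qed
  show ?thesis
    by (rule exI[of _ \<sigma>], rule exI[of _ ul], rule exI[of _ \<mu>l])
       (use \<sigma> \<sigma>0 ulim sol case1 case2 in \<open>simp add: v_def\<close>)
qed

end

theorem theorem5p1:
  fixes E :: "'n::finite set set" and w :: "'n set \<Rightarrow> real"
    and p a q T :: real and u\<^sub>0 :: "real ^ 'n"
    and \<pi> :: "real ^ 'n \<Rightarrow> real ^ 'n" and k :: "real ^ 'n \<Rightarrow> real"
    and u\<^sub>\<tau> \<mu>\<^sub>\<tau> :: "real \<Rightarrow> real \<Rightarrow> real ^ 'n"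
  assumes "weighted_hypergraph E w" and "hypergraph_connected E"
    and "p \<ge> 1" and "a > 0" and "q > 2" and "T > 0"
    and "\<exists>L. L-lipschitz_on UNIV \<pi>" and "\<And>x. GDERIV k x :> \<pi> x"
    and "\<And>\<tau>. 0 < \<tau> \<Longrightarrow> \<tau> < 1 \<Longrightarrow> is_solution E w p a q \<pi> T u\<^sub>0 \<tau> (u\<^sub>\<tau> \<tau>) (\<mu>\<^sub>\<tau> \<tau>)"
  shows "\<exists>(\<sigma> :: nat \<Rightarrow> real) (u :: real \<Rightarrow> real ^ 'n) (\<mu> :: real \<Rightarrow> real ^ 'n).
     (\<forall>n. 0 < \<sigma> n \<and> \<sigma> n < 1) \<and> \<sigma> \<longlonglongrightarrow> 0 \<and>
     (p = 1 \<longrightarrow>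
        uniform_limit {0..T} (\<lambda>n. u\<^sub>\<tau> (\<sigma> n)) u sequentially \<and>
        Linf_weak_star_conv T (\<lambda>n. weak_deriv T (u\<^sub>\<tau> (\<sigma> n))) (weak_deriv T u) \<and>
        Linf_weak_star_conv T (\<lambda>n. \<mu>\<^sub>\<tau> (\<sigma> n)) \<mu>) \<and>
     (p > 1 \<longrightarrow>
        uniform_limit {0..T} (\<lambda>n. u\<^sub>\<tau> (\<sigma> n)) u sequentially \<and>
        Lp_weak_conv (p / (p - 1)) T (\<lambda>n. weak_deriv T (u\<^sub>\<tau> (\<sigma> n))) (weak_deriv T u) \<and>
        Lp_weak_conv (max p (p / (p - 1))) T (\<lambda>n. \<mu>\<^sub>\<tau> (\<sigma> n)) \<mu>) \<and>
     is_solution E w p a q \<pi> T u\<^sub>0 0 u \<mu>"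
proof -
  obtain L where L: "L-lipschitz_on UNIV \<pi>" using assms(7) by blast
  interpret potential E w p a q L \<pi> k
    by unfold_locales (use assms L in auto)
  from viscosity_limit[OF assms(6) assms(9)] show ?thesis by blast
qed

end
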